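(* Let $0\le m\le n$ and let $F_n$ be the free group with basis $\{x_1,\ldots,x_n\}$. The group $IA_n\cap\mathrm{Fix}_c(\{x_{m+1},\ldots,x_n\})$ is generated by the set $$\mathcal{C}_m=\{K_{ij}: 1\le i\le n,\ 1\le j\le n,\ i\ne j\}\cup\{K_{ijk}: 1\le i\le m,\ 1\le j,k\le n,\ i,j,k\text{ distinct}\}.$$
   Context: $IA_n$ is the subgroup of $\mathrm{Aut}(F_n)$ of automorphisms acting trivially on the abelianisation of $F_n$. For $Y\subset F_n$, $\mathrm{Fix}_c(Y)$ is the subgroup of $\mathrm{Aut}(F_n)$ of automorphisms taking each element of $Y$ to a conjugate of itself. For $i\ne j$, $K_{ij}$ is the automorphism with $K_{ij}(x_i)=x_jx_ix_j^{-1}$ and $K_{ij}(x_l)=x_l$ for $l\ne i$. For distinct $i,j,k$, $K_{ijk}$ is the automorphism with $K_{ijk}(x_i)=x_i[x_j,x_k]$ and $K_{ijk}(x_l)=x_l$ for $l\ne i$, where $[x,y]=xyx^{-1}y^{-1}$. *)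

theory Defs
  imports "HOL-Algebra.Bij" "HOL-Algebra.Generated_Groups" "HOL-Algebra.Coset"
begin

section \<open>The free group on a set of letters\<close>

text \<open>A letter \<open>(a, True)\<close> stands for the basis element \<open>a\<close>, and \<open>(a, False)\<close> for its formal inverse.
  Elements of the free group are the reduced words, so that equality of elements is equality of
  words. Since \<open>push\<close> multiplies a reduced word on the left by one letter, folding it over the first
  factor yields the reduced form of the concatenation.\<close>

definition letter_inv :: "'a \<times> bool \<Rightarrow> 'a \<times> bool" where
  "letter_inv l = (fst l, \<not> snd l)"

definition reduced :: "('a \<times> bool) list \<Rightarrow> bool" where
  "reduced w \<longleftrightarrow> successively (\<lambda>k l. l \<noteq> letter_inv k) w"

definition push :: "'a \<times> bool \<Rightarrow> ('a \<times> bool) list \<Rightarrow> ('a \<times> bool) list" where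
  "push l w = (case w of [] \<Rightarrow> [l] | k # v \<Rightarrow> if k = letter_inv l then v else l # w)"

definition free_group :: "'a set \<Rightarrow> ('a \<times> bool) list monoid" where
  "free_group X =
    \<lparr>carrier = {w. reduced w \<and> fst ` set w \<subseteq> X},
     mult = (\<lambda>v w. foldr push v w),
     one = []\<rparr>"

definition gen :: "'a \<Rightarrow> ('a \<times> bool) list" where
  "gen a = [(a, True)]"

text \<open>The homomorphism from a free group to \<open>G\<close> determined by the images \<open>f\<close> of the basis elements.\<close>

definition free_lift ::
  "('b, 'c) monoid_scheme \<Rightarrow> ('a \<Rightarrow> 'b) \<Rightarrow> ('a \<times> bool) list \<Rightarrow> 'b" where
  "free_lift G f w =
    foldr (\<lambda>(a, e) g. (if e then f a else inv\<^bsub>G\<^esub> f a) \<otimes>\<^bsub>G\<^esub> g) w \<one>\<^bsub>G\<^esub>"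

text \<open>The library's automorphisms are extensional functions, whence the restriction to the carrier.\<close>

definition free_endo ::
  "'a set \<Rightarrow> ('a \<Rightarrow> ('a \<times> bool) list) \<Rightarrow> ('a \<times> bool) list \<Rightarrow> ('a \<times> bool) list" where
  "free_endo X f = restrict (free_lift (free_group X) f) (carrier (free_group X))"


section \<open>Subgroups of the automorphism group\<close>

text \<open>An automorphism acts on the abelianisation by sending a coset of the derived subgroup to its
  image.\<close>

definition IA :: "('a, 'b) monoid_scheme \<Rightarrow> ('a \<Rightarrow> 'a) set" where
  "IA G = {\<phi> \<in> carrier (AutoGroup G).
            \<forall>C \<in> carrier (G Mod derived G (carrier G)). \<phi> ` C = C}"

definition Fix_c :: "('a, 'b) monoid_scheme \<Rightarrow> 'a set \<Rightarrow> ('a \<Rightarrow> 'a) set" where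
  "Fix_c G Y = {\<phi> \<in> carrier (AutoGroup G).
            \<forall>y\<in>Y. \<exists>g\<in>carrier G. \<phi> y = g \<otimes>\<^bsub>G\<^esub> y \<otimes>\<^bsub>G\<^esub> inv\<^bsub>G\<^esub> g}"

definition commutator :: "('a, 'b) monoid_scheme \<Rightarrow> 'a \<Rightarrow> 'a \<Rightarrow> 'a" where
  "commutator G x y = x \<otimes>\<^bsub>G\<^esub> y \<otimes>\<^bsub>G\<^esub> inv\<^bsub>G\<^esub> x \<otimes>\<^bsub>G\<^esub> inv\<^bsub>G\<^esub> y"


section \<open>The free group of rank n and its Magnus automorphisms\<close>

abbreviation Fn :: "nat \<Rightarrow> (nat \<times> bool) list monoid" where
  "Fn n \<equiv> free_group {1..n}"

definition K2 :: "nat \<Rightarrow> nat \<Rightarrow> nat \<Rightarrow> (nat \<times> bool) list \<Rightarrow> (nat \<times> bool) list" where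
  "K2 n i j = free_endo {1..n}
     (gen (i := gen j \<otimes>\<^bsub>Fn n\<^esub> gen i \<otimes>\<^bsub>Fn n\<^esub> inv\<^bsub>Fn n\<^esub> gen j))"

definition K3 :: "nat \<Rightarrow> nat \<Rightarrow> nat \<Rightarrow> nat \<Rightarrow> (nat \<times> bool) list \<Rightarrow> (nat \<times> bool) list" where
  "K3 n i j k = free_endo {1..n}
     (gen (i := gen i \<otimes>\<^bsub>Fn n\<^esub> commutator (Fn n) (gen j) (gen k)))"

definition magnus_set :: "nat \<Rightarrow> nat \<Rightarrow> ((nat \<times> bool) list \<Rightarrow> (nat \<times> bool) list) set" where
  "magnus_set n m =
     {K2 n i j | i j. i \<in> {1..n} \<and> j \<in> {1..n} \<and> i \<noteq> j} \<union>
     {K3 n i j k | i j k. i \<in> {1..m} \<and> j \<in> {1..n} \<and> k \<in> {1..n} \<and>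
                          i \<noteq> j \<and> i \<noteq> k \<and> j \<noteq> k}"


section \<open>Basic facts\<close>

text \<open>The construction is a group with the universal property of the free group, and the maps
  \<open>K2\<close> and \<open>K3\<close> are automorphisms with the prescribed values on the basis.\<close>

lemma letter_inv_invol [simp]: "letter_inv (letter_inv l) = l"
  by (simp add: letter_inv_def)

lemma letter_inv_neq [simp]: "letter_inv l \<noteq> l" "l \<noteq> letter_inv l"
  by (cases l; simp add: letter_inv_def)+

lemma fst_letter_inv [simp]: "fst (letter_inv l) = fst l"
  by (simp add: letter_inv_def)

lemma reduced_Nil [simp]: "reduced []"
  by (simp add: reduced_def)

lemma reduced_Cons:
  "reduced (l # w) \<longleftrightarrow> reduced w \<and> (w = [] \<or> hd w \<noteq> letter_inv l)"
  by (cases w) (auto simp: reduced_def)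

lemma reduced_push: "reduced w \<Longrightarrow> reduced (push l w)"
  by (cases w) (auto simp: push_def reduced_Cons)

lemma push_letter_inv: "reduced w \<Longrightarrow> push (letter_inv l) (push l w) = w"
  by (cases w) (auto simp: push_def reduced_Cons split: list.splits)

lemma push_letter_inv': "reduced w \<Longrightarrow> push l (push (letter_inv l) w) = w"
  using push_letter_inv[of w "letter_inv l"] by simp

lemma set_push: "set (push l w) \<subseteq> insert l (set w)"
  by (cases w) (auto simp: push_def)

lemma reduced_foldr_push: "reduced w \<Longrightarrow> reduced (foldr push v w)"
  by (induction v) (auto simp: reduced_push)

lemma set_foldr_push: "set (foldr push v w) \<subseteq> set v \<union> set w"
proof (induction v)
  case (Cons a v)
  then show ?case using set_push[of a "foldr push v w"] by auto
qed simp

lemma foldr_push_push: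
  assumes "reduced u"
  shows "foldr push (push l v) u = push l (foldr push v u)"
proof (cases "v \<noteq> [] \<and> hd v = letter_inv l")
  case True
  then obtain v' where "v = letter_inv l # v'" by (cases v) auto
  then show ?thesis
    using push_letter_inv'[OF reduced_foldr_push[OF assms]] by (simp add: push_def)
next
  case False
  then show ?thesis by (cases v) (auto simp: push_def)
qed

lemma foldr_push_assoc:
  "reduced u \<Longrightarrow> foldr push (foldr push v w) u = foldr push v (foldr push w u)"
  by (induction v) (auto simp: foldr_push_push)

lemma foldr_push_Nil: "reduced w \<Longrightarrow> foldr push w [] = w"
  by (induction w) (auto simp: reduced_Cons push_def split: list.splits)

lemma foldr_push_inverse:
  "reduced w \<Longrightarrow> foldr push (rev (map letter_inv v)) (foldr push v w) = w"
  by (induction v arbitrary: w) (auto simp: push_letter_inv reduced_foldr_push)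

theorem group_free_group: "group (free_group X)"
proof (rule groupI)
  show "\<And>v w. \<lbrakk>v \<in> carrier (free_group X); w \<in> carrier (free_group X)\<rbrakk>
    \<Longrightarrow> v \<otimes>\<^bsub>free_group X\<^esub> w \<in> carrier (free_group X)"
    using set_foldr_push by (fastforce simp: free_group_def reduced_foldr_push)
next
  fix v assume v: "v \<in> carrier (free_group X)"
  let ?u = "foldr push (rev (map letter_inv v)) []"
  have "?u \<in> carrier (free_group X)"
    using v set_foldr_push[of "rev (map letter_inv v)" "[]"]
    by (fastforce simp: free_group_def reduced_foldr_push)
  moreover have "?u \<otimes>\<^bsub>free_group X\<^esub> v = \<one>\<^bsub>free_group X\<^esub>"
    using v foldr_push_inverse[of "[]" v]
    by (simp add: free_group_def foldr_push_assoc foldr_push_Nil)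
  ultimately show "\<exists>u\<in>carrier (free_group X). u \<otimes>\<^bsub>free_group X\<^esub> v = \<one>\<^bsub>free_group X\<^esub>"
    by blast
qed (auto simp: free_group_def foldr_push_assoc)

lemma gen_closed [simp]: "a \<in> X \<Longrightarrow> gen a \<in> carrier (free_group X)"
  by (simp add: gen_def free_group_def reduced_Cons)

lemma inv_gen: "a \<in> X \<Longrightarrow> inv\<^bsub>free_group X\<^esub> gen a = [(a, False)]"
  by (rule group.inv_equality[OF group_free_group])
    (auto simp: gen_def free_group_def reduced_Cons push_def letter_inv_def)

lemma (in group) free_lift_closed:
  assumes "f \<in> X \<rightarrow> carrier G" "fst ` set w \<subseteq> X"
  shows "free_lift G f w \<in> carrier G"
  using assms(2)
proof (induction w)
  case (Cons l w)
  then show ?case using assms(1) by (cases l) (auto simp: free_lift_def)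
qed (simp add: free_lift_def)

lemma (in group) free_lift_push:
  assumes f: "f \<in> X \<rightarrow> carrier G" and "fst l \<in> X" "fst ` set w \<subseteq> X"
  shows "free_lift G f (push l w) = free_lift G f (l # w)"
proof (cases "w \<noteq> [] \<and> hd w = letter_inv l")
  case True
  then obtain v where w: "w = letter_inv l # v" by (cases w) auto
  then have v: "free_lift G f v \<in> carrier G"
    using assms free_lift_closed[OF f] by simp
  obtain a e where l: "l = (a, e)" by (cases l)
  then have a: "f a \<in> carrier G" using assms by auto
  have "free_lift G f (l # w) = free_lift G f v"
    using v a by (auto simp: w l letter_inv_def free_lift_def m_assoc[symmetric])
  then show ?thesis by (simp add: push_def w)
next
  case False
  then show ?thesis by (cases w) (auto simp: push_def)
qed

theorem (in group) free_lift_hom: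
  assumes f: "f \<in> X \<rightarrow> carrier G"
  shows "free_lift G f \<in> hom (free_group X) G"
proof (rule homI)
  show "\<And>w. w \<in> carrier (free_group X) \<Longrightarrow> free_lift G f w \<in> carrier G"
    using free_lift_closed[OF f] by (simp add: free_group_def)
next
  fix v w assume "v \<in> carrier (free_group X)" "w \<in> carrier (free_group X)"
  then have "fst ` set v \<subseteq> X" and w: "fst ` set w \<subseteq> X" by (auto simp: free_group_def)
  from this(1) have "free_lift G f (foldr push v w) = free_lift G f v \<otimes> free_lift G f w"
  proof (induction v)
    case Nil
    then show ?case using free_lift_closed[OF f w] by (simp add: free_lift_def)
  next
    case (Cons l v)
    obtain a e where l: "l = (a, e)" by (cases l)
    then have a: "f a \<in> carrier G" using Cons.prems f by auto
    have "fst ` set (foldr push v w) \<subseteq> X"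
      using set_foldr_push[of v w] w Cons.prems by fastforce
    then have "free_lift G f (foldr push (l # v) w) = free_lift G f (l # foldr push v w)"
      using Cons.prems free_lift_push[OF f] by simp
    also have "\<dots> = (if e then f a else inv f a) \<otimes> (free_lift G f v \<otimes> free_lift G f w)"
      using Cons by (simp add: l free_lift_def)
    also have "\<dots> = free_lift G f (l # v) \<otimes> free_lift G f w"
      using free_lift_closed[OF f w] free_lift_closed[OF f, of v] Cons.prems a
      by (auto simp: l free_lift_def m_assoc[symmetric])
    finally show ?case .
  qed
  then show "free_lift G f (v \<otimes>\<^bsub>free_group X\<^esub> w) = free_lift G f v \<otimes> free_lift G f w"
    by (simp add: free_group_def)
qed

lemma (in group) free_lift_gen: "f a \<in> carrier G \<Longrightarrow> free_lift G f (gen a) = f a"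
  by (simp add: free_lift_def gen_def)

theorem (in group) free_lift_unique:
  assumes h: "h \<in> hom (free_group X) G" and "w \<in> carrier (free_group X)"
  shows "h w = free_lift G (\<lambda>a. h (gen a)) w"
  using assms(2)
proof (induction w)
  case Nil
  have "h \<one>\<^bsub>free_group X\<^esub> = \<one>" by (rule hom_one[OF h group_free_group is_group])
  then show ?case by (simp add: free_lift_def free_group_def)
next
  case (Cons l w)
  interpret P: group "free_group X" by (rule group_free_group)
  interpret H: group_hom "free_group X" G h
    by unfold_locales (rule h)
  obtain a e where l: "l = (a, e)" by (cases l)
  have a: "a \<in> X" and w: "w \<in> carrier (free_group X)"
    using Cons.prems by (auto simp: l free_group_def reduced_Cons)
  have x: "[l] \<in> carrier (free_group X)" using a by (simp add: l free_group_def reduced_Cons)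
  have "l # w = [l] \<otimes>\<^bsub>free_group X\<^esub> w"
    using Cons.prems by (cases w) (auto simp: free_group_def push_def reduced_Cons)
  then have "h (l # w) = h [l] \<otimes> h w" using H.hom_mult[OF x w] by simp
  moreover have "h [l] = (if e then h (gen a) else inv h (gen a))"
  proof (cases e)
    case True
    then show ?thesis by (simp add: l gen_def)
  next
    case False
    then have "[l] = inv\<^bsub>free_group X\<^esub> gen a" by (simp add: l inv_gen[OF a])
    with False show ?thesis using H.hom_inv[OF gen_closed[OF a]] by simp
  qed
  ultimately show ?case using Cons.IH[OF w] by (simp add: l free_lift_def)
qed

lemma free_endo_hom:
  assumes "f \<in> X \<rightarrow> carrier (free_group X)"
  shows "free_endo X f \<in> hom (free_group X) (free_group X)"
proof -
  interpret group "free_group X" by (rule group_free_group)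
  show ?thesis using free_lift_hom[OF assms] by (auto simp: hom_def free_endo_def)
qed

lemma free_endo_gen:
  assumes "f \<in> X \<rightarrow> carrier (free_group X)" "a \<in> X"
  shows "free_endo X f (gen a) = f a"
proof -
  interpret group "free_group X" by (rule group_free_group)
  show ?thesis using assms free_lift_gen[of f a] by (auto simp: free_endo_def)
qed

lemma hom_free_group_eqI:
  assumes "g \<in> hom (free_group X) (free_group X)" "h \<in> hom (free_group X) (free_group X)"
    and "\<And>a. a \<in> X \<Longrightarrow> g (gen a) = h (gen a)" and w: "w \<in> carrier (free_group X)"
  shows "g w = h w"
proof -
  interpret group "free_group X" by (rule group_free_group)
  have "fst ` set w \<subseteq> X" using w by (simp add: free_group_def)
  then have "free_lift (free_group X) (\<lambda>a. g (gen a)) w = free_lift (free_group X) (\<lambda>a. h (gen a)) w"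
    by (induction w) (auto simp: free_lift_def assms(3))
  then show ?thesis using free_lift_unique[OF assms(1) w] free_lift_unique[OF assms(2) w] by simp
qed

lemma free_endo_auto:
  assumes f: "f \<in> X \<rightarrow> carrier (free_group X)" and g: "g \<in> X \<rightarrow> carrier (free_group X)"
    and fg: "\<And>a. a \<in> X \<Longrightarrow> free_endo X f (g a) = gen a"
    and gf: "\<And>a. a \<in> X \<Longrightarrow> free_endo X g (f a) = gen a"
  shows "free_endo X f \<in> carrier (AutoGroup (free_group X))"
proof -
  interpret group "free_group X" by (rule group_free_group)
  note hf = free_endo_hom[OF f] and hg = free_endo_hom[OF g]
  have id: "(\<lambda>w. w) \<in> hom (free_group X) (free_group X)" by (auto simp: hom_def)
  have comp: "(\<lambda>w. p (q w)) \<in> hom (free_group X) (free_group X)"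
    if "p \<in> hom (free_group X) (free_group X)" "q \<in> hom (free_group X) (free_group X)" for p q
    using that by (auto simp: hom_def Pi_iff)
  have "free_endo X f (free_endo X g w) = w" if "w \<in> carrier (free_group X)" for w
    using hom_free_group_eqI[OF comp[OF hf hg] id _ that] by (simp add: free_endo_gen[OF g] fg)
  moreover have "free_endo X g (free_endo X f w) = w" if "w \<in> carrier (free_group X)" for w
    using hom_free_group_eqI[OF comp[OF hg hf] id _ that] by (simp add: free_endo_gen[OF f] gf)
  ultimately have "bij_betw (free_endo X f) (carrier (free_group X)) (carrier (free_group X))"
    using hf hg by (intro bij_betwI[where g = "free_endo X g"]) (auto simp: hom_def)
  then show ?thesis using hf
    by (simp add: AutoGroup_def auto_def Bij_def) (simp add: free_endo_def)
qed

lemma K2_gen: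
  assumes "i \<in> {1..n}" "j \<in> {1..n}" "l \<in> {1..n}"
  shows "K2 n i j (gen l) =
    (if l = i then gen j \<otimes>\<^bsub>Fn n\<^esub> gen i \<otimes>\<^bsub>Fn n\<^esub> inv\<^bsub>Fn n\<^esub> gen j else gen l)"
proof -
  interpret group "Fn n" by (rule group_free_group)
  show ?thesis unfolding K2_def
    by (subst free_endo_gen) (use assms in \<open>auto simp del: atLeastAtMost_iff One_nat_def\<close>)
qed

lemma K3_gen:
  assumes "i \<in> {1..n}" "j \<in> {1..n}" "k \<in> {1..n}" "l \<in> {1..n}"
  shows "K3 n i j k (gen l) =
    (if l = i then gen i \<otimes>\<^bsub>Fn n\<^esub> commutator (Fn n) (gen j) (gen k) else gen l)"
proof -
  interpret group "Fn n" by (rule group_free_group)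
  show ?thesis unfolding K3_def
    by (subst free_endo_gen) (use assms in \<open>auto simp: commutator_def simp del: atLeastAtMost_iff One_nat_def\<close>)
qed

lemma K2_auto:
  assumes "i \<in> {1..n}" "j \<in> {1..n}" "i \<noteq> j"
  shows "K2 n i j \<in> carrier (AutoGroup (Fn n))"
proof -
  interpret group "Fn n" by (rule group_free_group)
  let ?f = "gen (i := gen j \<otimes>\<^bsub>Fn n\<^esub> gen i \<otimes>\<^bsub>Fn n\<^esub> inv\<^bsub>Fn n\<^esub> gen j)"
  let ?g = "gen (i := inv\<^bsub>Fn n\<^esub> gen j \<otimes>\<^bsub>Fn n\<^esub> gen i \<otimes>\<^bsub>Fn n\<^esub> gen j)"
  have c: "gen i \<in> carrier (Fn n)" "gen j \<in> carrier (Fn n)" using assms by auto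
  have f: "?f \<in> {1..n} \<rightarrow> carrier (Fn n)" and g: "?g \<in> {1..n} \<rightarrow> carrier (Fn n)"
    using c by (auto simp del: atLeastAtMost_iff One_nat_def)
  define p where "p = free_endo {1..n} ?f"
  interpret p: group_hom "Fn n" "Fn n" p
    unfolding p_def by unfold_locales (rule free_endo_hom[OF f])
  define q where "q = free_endo {1..n} ?g"
  interpret q: group_hom "Fn n" "Fn n" q
    unfolding q_def by unfold_locales (rule free_endo_hom[OF g])
  have cancel: "x \<otimes>\<^bsub>Fn n\<^esub> (inv\<^bsub>Fn n\<^esub> x \<otimes>\<^bsub>Fn n\<^esub> y) = y" "inv\<^bsub>Fn n\<^esub> x \<otimes>\<^bsub>Fn n\<^esub> (x \<otimes>\<^bsub>Fn n\<^esub> y) = y"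
    if "x \<in> carrier (Fn n)" "y \<in> carrier (Fn n)" for x y
    using that by (simp_all add: m_assoc[symmetric] del: One_nat_def)
  note vals = free_endo_gen[OF f, folded p_def] free_endo_gen[OF g, folded q_def]
  have "p \<in> carrier (AutoGroup (Fn n))"
    by (rule free_endo_auto[OF f g, folded p_def q_def])
      (use assms c in \<open>auto simp: vals m_assoc cancel simp del: atLeastAtMost_iff One_nat_def\<close>)
  then show ?thesis by (simp only: K2_def p_def)
qed

lemma K3_auto:
  assumes "i \<in> {1..n}" "j \<in> {1..n}" "k \<in> {1..n}" "i \<noteq> j" "i \<noteq> k"
  shows "K3 n i j k \<in> carrier (AutoGroup (Fn n))"
proof -
  interpret group "Fn n" by (rule group_free_group)
  let ?f = "gen (i := gen i \<otimes>\<^bsub>Fn n\<^esub> commutator (Fn n) (gen j) (gen k))"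
  let ?g = "gen (i := gen i \<otimes>\<^bsub>Fn n\<^esub> commutator (Fn n) (gen k) (gen j))"
  have c: "gen i \<in> carrier (Fn n)" "gen j \<in> carrier (Fn n)" "gen k \<in> carrier (Fn n)"
    using assms by auto
  have f: "?f \<in> {1..n} \<rightarrow> carrier (Fn n)" and g: "?g \<in> {1..n} \<rightarrow> carrier (Fn n)"
    using c by (auto simp: commutator_def simp del: atLeastAtMost_iff One_nat_def)
  define p where "p = free_endo {1..n} ?f"
  interpret p: group_hom "Fn n" "Fn n" p
    unfolding p_def by unfold_locales (rule free_endo_hom[OF f])
  define q where "q = free_endo {1..n} ?g"
  interpret q: group_hom "Fn n" "Fn n" q
    unfolding q_def by unfold_locales (rule free_endo_hom[OF g])
  have cancel: "x \<otimes>\<^bsub>Fn n\<^esub> (inv\<^bsub>Fn n\<^esub> x \<otimes>\<^bsub>Fn n\<^esub> y) = y" "inv\<^bsub>Fn n\<^esub> x \<otimes>\<^bsub>Fn n\<^esub> (x \<otimes>\<^bsub>Fn n\<^esub> y) = y"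
    if "x \<in> carrier (Fn n)" "y \<in> carrier (Fn n)" for x y
    using that by (simp_all add: m_assoc[symmetric] del: One_nat_def)
  note vals = free_endo_gen[OF f, folded p_def] free_endo_gen[OF g, folded q_def]
  have "p \<in> carrier (AutoGroup (Fn n))"
    by (rule free_endo_auto[OF f g, folded p_def q_def])
      (use assms c in \<open>auto simp: vals commutator_def m_assoc cancel simp del: atLeastAtMost_iff One_nat_def\<close>)
  then show ?thesis by (simp only: K3_def p_def)
qed

end

theory Submission
  imports Defs
begin

text \<open>Let \<open>N\<close> be the group generated by \<open>magnus_set n m\<close> and \<open>G\<close> the group generated by \<open>N\<close>, the
  transvections \<open>x\<^sub>i \<mapsto> x\<^sub>i x\<^sub>j\<close> with \<open>i \<le> m\<close> and the signed permutations of the first \<open>m\<close> letters.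
  Nielsen reduction, in which the images of the letters \<open>x\<^sub>j\<close> with \<open>j > m\<close> may only be conjugated,
  shows that \<open>G\<close> consists of the automorphisms taking every such \<open>x\<^sub>j\<close> to a conjugate. Moreover \<open>N\<close>
  is normal in \<open>G\<close>, and modulo \<open>N\<close> the transvections satisfy the Steinberg relations. Let
  \<open>\<phi> \<in> G\<close> act trivially on the abelianisation and follow the class of \<open>x\<^sub>m\<close> under the factors of
  \<open>\<phi>\<close>. Peak reduction with respect to the sum of the absolute values of the coordinates, using only
  the Steinberg relations, rewrites \<open>\<phi>\<close> modulo \<open>N\<close> as a product of generators that fix \<open>x\<^sub>m\<close>, and
  induction on \<open>m\<close> shows \<open>\<phi> \<in> N\<close>.\<close>

section \<open>Free groups and their automorphisms as additive groups\<close>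

text \<open>That a product of transvections with trivial matrix lies in \<open>N\<close> is a
  question about relations. Instead of a presentation of the matrix group, only loops at the single
  vector \<open>unit_vec m\<close> are contracted, and the remaining stabiliser is handed to
  \<open>m - 1\<close>. Already the first step turns \<open>x_m\<close> into a letter that may only
  be conjugated, so even the case of all \<open>IA\<close> automorphisms needs the statement for
  every \<open>m\<close>. Such letters shape both halves of the argument. In Nielsen reduction the
  image of \<open>x_j\<close> is a word \<open>h x h^-1\<close> that cannot be multiplied by another
  image, so cancellation beyond its centre has to be charged to the other word. In peak reduction
  the coordinates beyond \<open>m\<close> can be changed but never serve as sources of a change;
  hence the norm runs over all \<open>n\<close> coordinates while primitivity is demanded of the
  first \<open>m\<close>. Signed permutations enter twice: a tuple that cannot be reduced further is
  one, and a peak between two opposite transvections is bypassed through one. Normality of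
  \<open>N\<close> is what allows a relation that holds only modulo \<open>N\<close> to be applied
  in the middle of a product.\<close>

text \<open>The library's class of groups that need not be commutative is \<open>group_add\<close>, so the free group
  on all natural numbers and the group of its automorphisms are written additively; the group
  \<open>Fn n\<close> is the subgroup \<open>Fs {1..n}\<close> of the former.\<close>

lemmas group_norm = diff_conv_add_uminus add.assoc minus_add

section \<open>The free group on all natural numbers\<close>

typedef fword = "{w :: (nat \<times> bool) list. reduced w}"
  morphisms letters Fword
  by (rule exI[of _ "[]"]) simp

lemma reduced_letters [simp]: "reduced (letters x)"
  using letters by auto

lemma letters_Fword: "reduced w \<Longrightarrow> letters (Fword w) = w"
  by (simp add: Fword_inverse)

lemma length_push_le: "length (push l w) \<le> Suc (length w)"
  by (auto simp: push_def split: list.splits)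

lemma length_foldr_push_le: "length (foldr push v w) \<le> length v + length w"
  by (induction v) (auto intro: order_trans[OF length_push_le])

instantiation fword :: group_add
begin

definition zero_fword :: fword where
  "0 = Fword []"

definition plus_fword :: "fword \<Rightarrow> fword \<Rightarrow> fword" where
  "x + y = Fword (foldr push (letters x) (letters y))"

definition uminus_fword :: "fword \<Rightarrow> fword" where
  "- x = Fword (foldr push (rev (map letter_inv (letters x))) [])"

definition minus_fword :: "fword \<Rightarrow> fword \<Rightarrow> fword" where
  "x - y = x + - y" for x y :: fword

instance
proof
  fix a b c :: fword
  have red: "reduced (foldr push v (letters x))" for v x
    by (simp add: reduced_foldr_push)
  show "a + b + c = a + (b + c)"
    by (simp add: plus_fword_def letters_Fword red foldr_push_assoc)
  show "0 + a = a" "a + 0 = a"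
    by (simp_all add: plus_fword_def zero_fword_def letters_Fword foldr_push_Nil letters_inverse)
  show "- a + a = 0"
    using foldr_push_inverse[of "[]" "letters a"]
    by (simp add: plus_fword_def zero_fword_def uminus_fword_def letters_Fword
        reduced_foldr_push foldr_push_assoc foldr_push_Nil)
  show "a + - b = a - b"
    by (simp add: minus_fword_def)
qed

end

lemma letters_0 [simp]: "letters 0 = []"
  by (simp add: zero_fword_def letters_Fword)

lemma letters_plus: "letters (x + y) = foldr push (letters x) (letters y)"
  by (simp add: plus_fword_def letters_Fword reduced_foldr_push)

definition X :: "nat \<Rightarrow> fword" where
  "X a = Fword [(a, True)]"

lemma letters_X: "letters (X a) = [(a, True)]"
  by (simp add: X_def letters_Fword reduced_Cons)

lemma letters_minus_X: "letters (- X a) = [(a, False)]"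
  by (simp add: uminus_fword_def letters_X push_def letters_Fword reduced_Cons letter_inv_def)

definition wval :: "(nat \<Rightarrow> 'b::group_add) \<Rightarrow> (nat \<times> bool) list \<Rightarrow> 'b" where
  "wval f w = sum_list (map (\<lambda>(a, e). if e then f a else - f a) w)"

definition fhom :: "(nat \<Rightarrow> 'b::group_add) \<Rightarrow> fword \<Rightarrow> 'b" where
  "fhom f x = wval f (letters x)"

abbreviation ev :: "(nat \<times> bool) list \<Rightarrow> fword" where
  "ev \<equiv> wval X"

lemma wval_Nil [simp]: "wval f [] = 0"
  and wval_Cons: "wval f (l # w) = (if snd l then f (fst l) else - f (fst l)) + wval f w"
  and wval_append: "wval f (v @ w) = wval f v + wval f w"
  by (auto simp: wval_def split: prod.splits)

lemma wval_letter_inv: "wval f (rev (map letter_inv w)) = - wval f w"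
  by (induction w) (auto simp: wval_append wval_Cons letter_inv_def minus_add
      simp del: add_uminus_conv_diff)

lemma wval_push: "wval f (push l w) = wval f (l # w)"
  by (cases w) (auto simp: push_def wval_Cons letter_inv_def)

lemma wval_foldr_push: "wval f (foldr push v w) = wval f v + wval f w"
  by (induction v) (auto simp: wval_push wval_Cons add.assoc)

lemma fhom_add: "fhom f (x + y) = fhom f x + fhom f y"
  by (simp add: fhom_def letters_plus wval_foldr_push)

lemma fhom_X [simp]: "fhom f (X a) = f a"
  by (simp add: fhom_def letters_X wval_Cons)

lemma letters_ev: "letters (ev w) = foldr push w []"
proof (induction w)
  case (Cons l w)
  have "letters (if snd l then X (fst l) else - X (fst l)) = [l]"
    by (cases l) (simp add: letters_X letters_minus_X)
  then show ?case by (simp add: wval_Cons letters_plus Cons)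
qed simp

lemma ev_letters [simp]: "ev (letters x) = x"
  by (metis letters_ev foldr_push_Nil letters_inject reduced_letters)

lemma letters_ev_reduced: "reduced w \<Longrightarrow> letters (ev w) = w"
  by (simp add: letters_ev foldr_push_Nil)

lemma length_letters_ev_le: "length (letters (ev w)) \<le> length w"
  using length_foldr_push_le[of w "[]"] by (simp add: letters_ev)

lemma letters_ev_eqI: "length (letters (ev w)) = length w \<Longrightarrow> letters (ev w) = w"
proof (induction w)
  case (Cons l w)
  have le: "length (letters (ev w)) \<le> length w"
    by (rule length_letters_ev_le)
  have l: "letters (ev (l # w)) = push l (letters (ev w))"
    by (simp add: letters_ev)
  have "length (letters (ev w)) = length w"
    using Cons.prems le length_push_le[of l "letters (ev w)"] unfolding l by simp
  then have "letters (ev w) = w" by (rule Cons.IH)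
  then show ?case using Cons.prems unfolding l
    by (auto simp: push_def split: list.splits if_splits)
qed simp

lemma reduced_rev_letter_inv:
  assumes "reduced w"
  shows "reduced (rev (map letter_inv w))"
  using assms
proof (induction w)
  case (Cons l w)
  then show ?case
    by (cases w) (auto simp: reduced_def successively_append_iff)
qed simp

lemma letters_uminus: "letters (- x) = rev (map letter_inv (letters x))"
  by (simp add: uminus_fword_def reduced_rev_letter_inv foldr_push_Nil letters_Fword)

lemma fword_induct [case_names zero plus minus]:
  assumes "P 0" "\<And>a x. P x \<Longrightarrow> P (X a + x)" "\<And>a x. P x \<Longrightarrow> P (- X a + x)"
  shows "P x"
proof -
  have "P (ev w)" for w
    by (induction w) (use assms in \<open>auto simp: wval_Cons\<close>)
  from this[of "letters x"] show ?thesis by simp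
qed

section \<open>Homomorphisms and the subgroups on a set of letters\<close>

definition hom_f :: "(fword \<Rightarrow> 'b::group_add) \<Rightarrow> bool" where
  "hom_f h \<longleftrightarrow> (\<forall>x y. h (x + y) = h x + h y)"

lemma hom_f_fhom: "hom_f (fhom f)"
  by (simp add: hom_f_def fhom_add)

lemma hom_f_add: "hom_f h \<Longrightarrow> h (x + y) = h x + h y"
  by (simp add: hom_f_def)

lemma hom_f_0: "hom_f h \<Longrightarrow> h 0 = 0"
  by (metis hom_f_def add_0_right add_left_cancel)

lemma hom_f_minus: "hom_f h \<Longrightarrow> h (- x) = - h x"
  by (metis hom_f_def hom_f_0 minus_unique right_minus)

lemma hom_f_eqI:
  assumes "hom_f g" "hom_f h" "\<And>a. g (X a) = h (X a)"
  shows "g x = h x"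
  by (induction x rule: fword_induct)
    (use assms in \<open>auto simp: hom_f_add hom_f_0 hom_f_minus\<close>)

definition Fs :: "nat set \<Rightarrow> fword set" where
  "Fs A = {x. fst ` set (letters x) \<subseteq> A}"

lemma Fs_0 [simp]: "0 \<in> Fs A"
  by (simp add: Fs_def)

lemma Fs_X [simp]: "X a \<in> Fs A \<longleftrightarrow> a \<in> A"
  by (simp add: Fs_def letters_X)

lemma Fs_add [simp]: "x \<in> Fs A \<Longrightarrow> y \<in> Fs A \<Longrightarrow> x + y \<in> Fs A"
  using set_foldr_push[of "letters x" "letters y"] by (fastforce simp: Fs_def letters_plus)

lemma Fs_uminus [simp]: "- x \<in> Fs A \<longleftrightarrow> x \<in> Fs A"
  by (simp add: Fs_def letters_uminus image_image)

lemma Fs_diff [simp]: "x \<in> Fs A \<Longrightarrow> y \<in> Fs A \<Longrightarrow> x - y \<in> Fs A"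
  using Fs_add[of x A "- y"] by simp

lemma Fs_mono: "x \<in> Fs A \<Longrightarrow> A \<subseteq> B \<Longrightarrow> x \<in> Fs B"
  by (auto simp: Fs_def)

lemma Fs_UNIV [simp]: "x \<in> Fs UNIV"
  by (simp add: Fs_def)

lemma Fs_ev: "fst ` set w \<subseteq> A \<Longrightarrow> ev w \<in> Fs A"
  using set_foldr_push[of w "[]"] by (fastforce simp: Fs_def letters_ev)

lemma Fs_induct [consumes 1, case_names zero plus minus]:
  assumes x: "x \<in> Fs A" and "P 0"
    "\<And>a x. a \<in> A \<Longrightarrow> x \<in> Fs A \<Longrightarrow> P x \<Longrightarrow> P (X a + x)"
    "\<And>a x. a \<in> A \<Longrightarrow> x \<in> Fs A \<Longrightarrow> P x \<Longrightarrow> P (- X a + x)"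
  shows "P x"
proof -
  have "P (ev w)" if "fst ` set w \<subseteq> A" for w
    using that
  proof (induction w)
    case (Cons l w)
    then have "ev w \<in> Fs A" by (intro Fs_ev) auto
    then show ?case using Cons assms(3,4)[of "fst l" "ev w"] by (auto simp: wval_Cons)
  qed (simp add: assms)
  from this[of "letters x"] x show ?thesis by (simp add: Fs_def)
qed

lemma hom_f_cong_Fs:
  assumes "x \<in> Fs A" "hom_f g" "hom_f h" "\<And>a. a \<in> A \<Longrightarrow> g (X a) = h (X a)"
  shows "g x = h x"
  using assms(1)
  by (induction rule: Fs_induct) (use assms in \<open>auto simp: hom_f_add hom_f_0 hom_f_minus\<close>)

lemma hom_f_Fs:
  assumes "x \<in> Fs A" "hom_f h" "\<And>a. a \<in> A \<Longrightarrow> h (X a) \<in> Fs B"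
  shows "h x \<in> Fs B"
  using assms(1)
  by (induction rule: Fs_induct) (use assms in \<open>auto simp: hom_f_add hom_f_0 hom_f_minus\<close>)

section \<open>Exponent sums\<close>

definition ab :: "fword \<Rightarrow> nat \<Rightarrow> int" where
  "ab x a = fhom (\<lambda>b. if b = a then 1 else 0) x"

lemma ab_add [simp]: "ab (x + y) a = ab x a + ab y a"
  by (simp add: ab_def fhom_add)

lemma ab_0 [simp]: "ab 0 a = 0"
  by (simp add: ab_def fhom_def)

lemma ab_uminus [simp]: "ab (- x) a = - ab x a"
  by (simp add: ab_def hom_f_minus hom_f_fhom)

lemma ab_diff [simp]: "ab (x - y) a = ab x a - ab y a"
  using ab_add[of x "- y"] by simp

lemma ab_X [simp]: "ab (X b) a = (if b = a then 1 else 0)"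
  by (simp add: ab_def)

lemma ab_outside: "x \<in> Fs A \<Longrightarrow> a \<notin> A \<Longrightarrow> ab x a = 0"
  by (induction rule: Fs_induct) auto

text \<open>A product of letters in which every exponent sum vanishes is trivial modulo commutators:
  cancel its first letter against an occurrence of the inverse letter.\<close>

lemma ab_0_imp_mem:
  assumes D0: "0 \<in> D" and Dadd: "\<And>x y. x \<in> D \<Longrightarrow> y \<in> D \<Longrightarrow> x + y \<in> D"
    and Dneg: "\<And>x. x \<in> D \<Longrightarrow> - x \<in> D"
    and Dconj: "\<And>x a. x \<in> D \<Longrightarrow> a \<in> A \<Longrightarrow> X a + x - X a \<in> D \<and> - X a + x + X a \<in> D"
    and Dcomm: "\<And>a b. a \<in> A \<Longrightarrow> b \<in> A \<Longrightarrow> a \<noteq> b \<Longrightarrow> X a + X b - X a - X b \<in> D"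
    and x: "x \<in> Fs A" "ab x = (\<lambda>_. 0)"
  shows "x \<in> D"
proof -
  define lt where "lt l = (if snd l then X (fst l) else - X (fst l))" for l :: "nat \<times> bool"
  have conj: "lt l + x - lt l \<in> D" "- lt l + x + lt l \<in> D" if "x \<in> D" "fst l \<in> A" for x l
    using Dconj[OF that] by (auto simp: lt_def)
  have X1: "X a + X b - X a - X b \<in> D" if "a \<in> A" "b \<in> A" for a b
    using Dcomm[OF that] D0 by (cases "a = b") auto
  have X2: "lt l + X b - lt l - X b \<in> D" if "fst l \<in> A" "b \<in> A" for l b
  proof (cases "snd l")
    case False
    have "- X (fst l) + - (X (fst l) + X b - X (fst l) - X b) + X (fst l) \<in> D"
      using Dconj[OF Dneg[OF X1[OF that]] that(1)] by simp
    moreover have "- X (fst l) + - (X (fst l) + X b - X (fst l) - X b) + X (fst l)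
      = lt l + X b - lt l - X b"
      using False by (simp add: lt_def group_norm del: add_uminus_conv_diff)
    ultimately show ?thesis by simp
  qed (use X1[OF that] in \<open>simp add: lt_def\<close>)
  have lcomm: "lt l + lt k - lt l - lt k \<in> D" if "fst l \<in> A" "fst k \<in> A" for l k
  proof (cases "snd k")
    case False
    have "- X (fst k) + - (lt l + X (fst k) - lt l - X (fst k)) + X (fst k) \<in> D"
      using Dconj[OF Dneg[OF X2[OF that]] that(2)] by simp
    moreover have "- X (fst k) + - (lt l + X (fst k) - lt l - X (fst k)) + X (fst k)
      = lt l + lt k - lt l - lt k"
      using False by (simp add: lt_def[of k] group_norm del: add_uminus_conv_diff)
    ultimately show ?thesis by simp
  qed (use X2[OF that] in \<open>simp add: lt_def[of k]\<close>)
  have comm: "lt l + ev w - lt l - ev w \<in> D" if "fst l \<in> A" "fst ` set w \<subseteq> A" for l w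
    using that(2)
  proof (induction w)
    case (Cons k w)
    have k: "ev (k # w) = lt k + ev w" by (simp add: wval_Cons lt_def)
    have "(lt l + lt k - lt l - lt k) + (lt k + (lt l + ev w - lt l - ev w) - lt k) \<in> D"
      using Cons that(1) by (intro Dadd lcomm conj) auto
    then show ?case unfolding k by (simp add: group_norm del: add_uminus_conv_diff)
  qed (use D0 in simp)
  have "ev w \<in> D" if "fst ` set w \<subseteq> A" "ab (ev w) = (\<lambda>_. 0)" for w
    using that
  proof (induction "length w" arbitrary: w rule: less_induct)
    case less
    show ?case
    proof (cases w)
      case (Cons l u)
      \<comment> \<open>Otherwise all occurrences of the generator of \<open>l\<close> carry the
        same sign as \<open>l\<close>, and its exponent sum in \<open>w\<close> cannot
        vanish.\<close>
      have "letter_inv l \<in> set u"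
      proof (rule ccontr)
        assume n: "letter_inv l \<notin> set u"
        have "(if snd l then 1 else -1) * ab (ev u) (fst l) \<ge> 0"
          using n by (induction u) (auto simp: wval_Cons letter_inv_def prod_eq_iff)
        moreover have "ab (ev w) (fst l) = 0" using less.prems by simp
        ultimately show False by (auto simp: Cons wval_Cons split: if_splits)
      qed
      then obtain p q where u: "u = p @ letter_inv l # q" by (auto simp: in_set_conv_decomp)
      have inv: "(if \<not> snd l then X (fst l) else - X (fst l)) = - lt l" by (simp add: lt_def)
      have w: "ev w = lt l + (ev p + (- lt l + ev q))"
        by (simp add: Cons u wval_Cons wval_append letter_inv_def inv) (simp add: lt_def)
      have "ab (ev (p @ q)) = (\<lambda>_. 0)"
        using less.prems(2) unfolding w by (simp add: wval_append fun_eq_iff)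
      then have "ev p + ev q \<in> D"
        using less.hyps[of "p @ q"] less.prems(1) by (auto simp: Cons u wval_append)
      \<comment> \<open>The word \<open>l p l^-1 q\<close> is the commutator of \<open>l\<close> and
        \<open>p\<close> followed by the shorter word \<open>p q\<close>.\<close>
      from Dadd[OF comm this, of l p] have "(lt l + ev p - lt l - ev p) + (ev p + ev q) \<in> D"
        using less.prems(1) by (auto simp: Cons u)
      then show ?thesis by (simp add: w group_norm del: add_uminus_conv_diff)
    qed (simp add: D0)
  qed
  from this[of "letters x"] show ?thesis using x by (simp add: Fs_def)
qed

section \<open>The automorphism group\<close>

typedef aut = "{\<phi> :: fword \<Rightarrow> fword. bij \<phi> \<and> hom_f \<phi>}"
  morphisms app Aut
  by (rule exI[of _ "\<lambda>x. x"]) (simp add: hom_f_def bij_id[unfolded id_def])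

lemma app_bij: "bij (app \<phi>)" and app_hom: "hom_f (app \<phi>)"
  using app[of \<phi>] by auto

lemma app_Aut: "bij \<phi> \<Longrightarrow> hom_f \<phi> \<Longrightarrow> app (Aut \<phi>) = \<phi>"
  by (simp add: Aut_inverse)

lemma app_add [simp]: "app \<phi> (x + y) = app \<phi> x + app \<phi> y"
  by (rule hom_f_add[OF app_hom])

lemma app_0 [simp]: "app \<phi> 0 = 0"
  by (rule hom_f_0[OF app_hom])

lemma app_uminus [simp]: "app \<phi> (- x) = - app \<phi> x"
  by (rule hom_f_minus[OF app_hom])

lemma app_diff [simp]: "app \<phi> (x - y) = app \<phi> x - app \<phi> y"
  using app_add[of \<phi> x "- y"] by simp

lemma app_inject_iff [simp]: "app \<phi> x = app \<phi> y \<longleftrightarrow> x = y"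
  using app_bij[of \<phi>] by (auto simp: bij_def inj_def)

instantiation aut :: group_add
begin

definition zero_aut :: aut where
  "0 = Aut (\<lambda>x. x)"

definition plus_aut :: "aut \<Rightarrow> aut \<Rightarrow> aut" where
  "\<phi> + \<psi> = Aut (\<lambda>x. app \<phi> (app \<psi> x))"

definition uminus_aut :: "aut \<Rightarrow> aut" where
  "- \<phi> = Aut (inv_into UNIV (app \<phi>))"

definition minus_aut :: "aut \<Rightarrow> aut \<Rightarrow> aut" where
  "\<phi> - \<psi> = \<phi> + - \<psi>" for \<phi> \<psi> :: aut

lemma app_zero_aut [simp]: "app 0 x = x"
  by (simp add: zero_aut_def app_Aut hom_f_def bij_id[unfolded id_def])

lemma app_plus_aut [simp]: "app (\<phi> + \<psi>) x = app \<phi> (app \<psi> x)"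
  using bij_comp[OF app_bij app_bij, of \<phi> \<psi>]
  by (simp add: plus_aut_def app_Aut hom_f_def comp_def)

lemma app_inv_app: "app (- \<phi>) = inv_into UNIV (app \<phi>)"
proof -
  have "hom_f (inv_into UNIV (app \<phi>))"
    unfolding hom_f_def
  proof (intro allI)
    fix x y
    have "app \<phi> (inv_into UNIV (app \<phi>) x + inv_into UNIV (app \<phi>) y) = x + y"
      using app_bij[of \<phi>] by (simp add: bij_is_surj surj_f_inv_f)
    then show "inv_into UNIV (app \<phi>) (x + y) = inv_into UNIV (app \<phi>) x + inv_into UNIV (app \<phi>) y"
      using app_bij[of \<phi>] by (metis bij_is_inj inv_f_f)
  qed
  then show ?thesis by (simp add: uminus_aut_def app_Aut bij_imp_bij_inv app_bij)
qed

instance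
proof
  fix a b c :: aut
  show "a + b + c = a + (b + c)" by (rule app_inject[THEN iffD1]) (simp add: fun_eq_iff)
  show "0 + a = a" "a + 0 = a" by (simp_all add: plus_aut_def app_inverse)
  show "- a + a = 0"
    using app_bij[of a] by (simp add: plus_aut_def app_inv_app zero_aut_def bij_is_inj)
  show "a + - b = a - b" by (simp add: minus_aut_def)
qed

end

lemma app_uminus_app [simp]: "app (- \<phi>) (app \<phi> x) = x" "app \<phi> (app (- \<phi>) x) = x"
  by (metis app_plus_aut app_zero_aut left_minus right_minus)+

lemma aut_eqI:
  assumes "\<And>a. app \<phi> (X a) = app \<psi> (X a)"
  shows "\<phi> = \<psi>"
  using hom_f_eqI[OF app_hom app_hom assms] by (simp add: app_inject[symmetric] fun_eq_iff)

lemma app_cong_Fs: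
  assumes "x \<in> Fs A" "\<And>a. a \<in> A \<Longrightarrow> app \<phi> (X a) = app \<psi> (X a)"
  shows "app \<phi> x = app \<psi> x"
  by (rule hom_f_cong_Fs[OF assms(1) app_hom app_hom assms(2)])

lemma app_Fs:
  assumes "x \<in> Fs A" "\<And>a. a \<in> A \<Longrightarrow> app \<phi> (X a) \<in> Fs B"
  shows "app \<phi> x \<in> Fs B"
  by (rule hom_f_Fs[OF assms(1) app_hom assms(2)])

section \<open>Automorphisms prescribed on the basis\<close>

lemma Aut_fhom:
  assumes "\<And>a. fhom f (g a) = X a" "\<And>a. fhom g (f a) = X a"
  shows "app (Aut (fhom f)) = fhom f"
proof (rule app_Aut[OF _ hom_f_fhom])
  have "hom_f (\<lambda>x. fhom f (fhom g x))" "hom_f (\<lambda>x. fhom g (fhom f x))" "hom_f (\<lambda>x :: fword. x)"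
    by (simp_all add: hom_f_def fhom_add)
  then have "fhom f (fhom g x) = x" "fhom g (fhom f x) = x" for x
    using assms by (auto intro: hom_f_eqI[where x = x])
  then show "bij (fhom f)" by (intro o_bij[of "fhom g"]) (auto simp: fun_eq_iff)
qed

text \<open>Junk value: \<open>tr i u v\<close> is meaningful only if \<open>X i\<close> does not occur in \<open>u\<close> and \<open>v\<close>.\<close>

definition tr :: "nat \<Rightarrow> fword \<Rightarrow> fword \<Rightarrow> aut" where
  "tr i u v = Aut (fhom (X(i := u + X i + v)))"

lemma app_tr:
  assumes "u \<in> Fs (- {i})" "v \<in> Fs (- {i})"
  shows "app (tr i u v) (X l) = (if l = i then u + X i + v else X l)"
proof -
  have id: "fhom (X(i := w)) x = x" if "x \<in> Fs (- {i})" for w x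
  proof -
    have "hom_f (\<lambda>x :: fword. x)" by (simp add: hom_f_def)
    from hom_f_cong_Fs[OF that hom_f_fhom this] show ?thesis by simp
  qed
  have "app (tr i u v) = fhom (X(i := u + X i + v))"
    unfolding tr_def
  proof (rule Aut_fhom[where g = "X(i := - u + X i - v)"])
    have h: "fhom (X(i := w)) (x - y) = fhom (X(i := w)) x - fhom (X(i := w)) y" for w x y
      using hom_f_add[OF hom_f_fhom, of "X(i := w)" x "- y"] hom_f_minus[OF hom_f_fhom, of "X(i := w)" y]
      by simp
    show "fhom (X(i := u + X i + v)) ((X(i := - u + X i - v)) a) = X a"
      "fhom (X(i := - u + X i - v)) ((X(i := u + X i + v)) a) = X a" for a
      using assms by (auto simp: fhom_add h hom_f_minus[OF hom_f_fhom] id group_norm simp del: add_uminus_conv_diff)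
  qed
  then show ?thesis by simp
qed

lemma app_tr_avoid:
  assumes "u \<in> Fs (- {i})" "v \<in> Fs (- {i})" "x \<in> Fs (- {i})"
  shows "app (tr i u v) x = x"
  using app_cong_Fs[OF assms(3), of "tr i u v" 0] by (simp add: app_tr assms)

text \<open>The right summand acts first, and its factors end up outermost on both sides.\<close>

lemma tr_add:
  assumes "u \<in> Fs (- {i})" "v \<in> Fs (- {i})" "u' \<in> Fs (- {i})" "v' \<in> Fs (- {i})"
  shows "tr i u v + tr i u' v' = tr i (u' + u) (v + v')"
  by (rule aut_eqI) (simp add: app_tr app_tr_avoid assms add.assoc)

lemma tr_0 [simp]: "tr i 0 0 = 0"
  by (rule aut_eqI) (simp add: app_tr)

lemma tr_uminus:
  assumes "u \<in> Fs (- {i})" "v \<in> Fs (- {i})"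
  shows "- tr i u v = tr i (- u) (- v)"
  by (rule minus_unique) (simp add: tr_add assms)

section \<open>Subgroups given by generators\<close>

inductive_set sgen :: "'a::group_add set \<Rightarrow> 'a set" for B where
  zero: "0 \<in> sgen B"
| plus: "b \<in> B \<Longrightarrow> x \<in> sgen B \<Longrightarrow> b + x \<in> sgen B"
| minus: "b \<in> B \<Longrightarrow> x \<in> sgen B \<Longrightarrow> - b + x \<in> sgen B"

lemma sgen_base: "b \<in> B \<Longrightarrow> b \<in> sgen B"
  using sgen.plus[OF _ sgen.zero] by fastforce

lemma sgen_add: "x \<in> sgen B \<Longrightarrow> y \<in> sgen B \<Longrightarrow> x + y \<in> sgen B"
  by (induction rule: sgen.induct) (auto simp: add.assoc intro: sgen.intros)

lemma sgen_uminus: "x \<in> sgen B \<Longrightarrow> - x \<in> sgen B"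
proof (induction rule: sgen.induct)
  case (plus b x)
  have "- b + 0 \<in> sgen B" using plus by (intro sgen.intros)
  from sgen_add[OF plus.IH this] show ?case by (simp add: minus_add)
next
  case (minus b x)
  have "b + 0 \<in> sgen B" using minus by (intro sgen.intros)
  from sgen_add[OF minus.IH this] show ?case
    by (simp only: minus_add minus_minus add_0_right)
qed (auto intro: sgen.zero)

lemma sgen_uminus_iff: "- x \<in> sgen B \<longleftrightarrow> x \<in> sgen B"
  using sgen_uminus[of x] sgen_uminus[of "- x"] by auto

lemma sgen_diff: "x \<in> sgen B \<Longrightarrow> y \<in> sgen B \<Longrightarrow> x - y \<in> sgen B"
  using sgen_add[OF _ sgen_uminus] by fastforce

lemma sgen_step: "b \<in> B \<or> - b \<in> B \<Longrightarrow> x \<in> sgen B \<Longrightarrow> b + x \<in> sgen B"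
  using sgen.plus[of b B x] sgen.minus[of "- b" B x] by auto

lemma sgen_induct [consumes 1, case_names zero step]:
  assumes "x \<in> sgen B" "P 0"
    "\<And>b x. b \<in> B \<or> - b \<in> B \<Longrightarrow> x \<in> sgen B \<Longrightarrow> P x \<Longrightarrow> P (b + x)"
  shows "P x"
  using assms(1) by (induction rule: sgen.induct) (use assms(2,3) in auto)

lemma sgen_subset: "B \<subseteq> sgen C \<Longrightarrow> sgen B \<subseteq> sgen C"
proof
  fix x assume "B \<subseteq> sgen C" "x \<in> sgen B"
  from this(2,1) show "x \<in> sgen C"
    by (induction rule: sgen.induct) (auto intro: sgen_add sgen_uminus sgen.zero)
qed

lemma sgen_mono: "B \<subseteq> C \<Longrightarrow> sgen B \<subseteq> sgen C"
  by (rule sgen_subset) (auto intro: sgen_base)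

lemma sgen_conj:
  assumes "x \<in> sgen B" "\<And>b. b \<in> B \<Longrightarrow> q + b - q \<in> sgen C"
  shows "q + x - q \<in> sgen C"
  using assms(1)
proof (induction rule: sgen.induct)
  case (plus b x)
  from sgen_add[OF assms(2)[OF plus(1)] plus(3)] show ?case
    by (simp add: group_norm del: add_uminus_conv_diff)
next
  case (minus b x)
  from sgen_add[OF sgen_uminus[OF assms(2)[OF minus(1)]] minus(3)] show ?case
    by (simp add: group_norm del: add_uminus_conv_diff)
qed (simp add: sgen.zero)

section \<open>The group generated by the Magnus automorphisms is normal\<close>

definition magnus_gens :: "nat \<Rightarrow> nat \<Rightarrow> aut set" where
  "magnus_gens n m =
     {tr i (X j) (- X j) | i j. i \<in> {1..n} \<and> j \<in> {1..n} \<and> i \<noteq> j} \<union>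
     {tr i 0 (X j + X k - X j - X k) | i j k. i \<in> {1..m} \<and> j \<in> {1..n} \<and> k \<in> {1..n} \<and>
                          i \<noteq> j \<and> i \<noteq> k \<and> j \<noteq> k}"

abbreviation magnus_group :: "nat \<Rightarrow> nat \<Rightarrow> aut set" where
  "magnus_group n m \<equiv> sgen (magnus_gens n m)"

lemma Fs_Compl: "u \<in> Fs (A - {i}) \<Longrightarrow> u \<in> Fs (- {i})"
  by (erule Fs_mono) auto

text \<open>By \<open>tr_add\<close>, sending \<open>u\<close> to \<open>tr i u (- u)\<close>
  reverses products, so the letters of \<open>u\<close> can be split off one at a time, each giving
  a generator or its inverse.\<close>

lemma tr_conj_N:
  assumes i: "i \<in> {1..n}" and u: "u \<in> Fs ({1..n} - {i})"
  shows "tr i u (- u) \<in> magnus_group n m"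
  using u
proof (induction rule: Fs_induct)
  case zero
  then show ?case by (simp add: sgen.zero)
next
  case (plus a x)
  have "tr i (X a) (- X a) \<in> magnus_group n m"
    using plus(1) i by (intro sgen_base) (auto simp: magnus_gens_def)
  moreover have "tr i (X a + x) (- (X a + x)) = tr i x (- x) + tr i (X a) (- X a)"
    using plus(1,2) Fs_Compl by (subst tr_add) (auto simp: minus_add simp del: add_uminus_conv_diff)
  ultimately show ?case using plus.IH by (metis sgen_add)
next
  case (minus a x)
  have "tr i (X a) (- X a) \<in> magnus_group n m"
    using minus(1) i by (intro sgen_base) (auto simp: magnus_gens_def)
  then have "- tr i (X a) (- X a) \<in> magnus_group n m" by (rule sgen_uminus)
  moreover have "tr i (- X a + x) (- (- X a + x)) = tr i x (- x) + - tr i (X a) (- X a)"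
    using minus(1,2) Fs_Compl
    by (subst tr_uminus, simp, simp, subst tr_add) (auto simp: minus_add simp del: add_uminus_conv_diff)
  ultimately show ?case using minus.IH by (metis sgen_add)
qed

text \<open>The main source of elements of \<open>N\<close>. The right factors \<open>c\<close> with
  \<open>tr i 0 c\<close> in \<open>N\<close> form a subgroup stable under conjugation, because
  conjugating \<open>tr i 0 c\<close> by a partial conjugation with \<open>w\<close> conjugates
  \<open>c\<close> by \<open>w\<close>. Containing the basic commutators, it contains every word
  with vanishing exponent sums. A left factor \<open>u\<close> is first carried to the right end by
  the partial conjugation with \<open>u\<close>.\<close>

lemma tr_comm_N:
  assumes i: "i \<in> {1..m}" and mn: "m \<le> n"
    and u: "u \<in> Fs ({1..n} - {i})" and v: "v \<in> Fs ({1..n} - {i})"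
    and ab: "\<And>a. ab u a + ab v a = 0"
  shows "tr i u v \<in> magnus_group n m"
proof -
  note [simp] = Fs_Compl
  let ?A = "{1..n} - {i}"
  define D where "D = {c \<in> Fs ?A. tr i 0 c \<in> magnus_group n m}"
  have i': "i \<in> {1..n}" using i mn by auto
  have conj: "w + c - w \<in> D" if "c \<in> D" "w \<in> Fs ?A" for c w
  proof -
    have cw: "c \<in> Fs (- {i})" "w \<in> Fs (- {i})" using that by (auto simp: D_def)
    have "- tr i w (- w) + tr i 0 c + tr i w (- w) \<in> magnus_group n m"
      using that tr_conj_N[OF i' that(2)] by (intro sgen_add sgen_uminus) (auto simp: D_def)
    also have "- tr i w (- w) + tr i 0 c + tr i w (- w) = tr i 0 (w + c - w)"
      using cw by (simp add: tr_uminus tr_add)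
    finally show ?thesis using that by (simp add: D_def)
  qed
  have "v + u \<in> D"
  proof (rule ab_0_imp_mem[where A = ?A])
    show "0 \<in> D" by (simp add: D_def sgen.zero)
    show "x + y \<in> D" if "x \<in> D" "y \<in> D" for x y
      using that sgen_add[of "tr i 0 x" _ "tr i 0 y"] by (auto simp: D_def tr_add)
    show "- x \<in> D" if "x \<in> D" for x
      using that sgen_uminus[of "tr i 0 x"] by (auto simp: D_def tr_uminus)
    show "X a + x - X a \<in> D \<and> - X a + x + X a \<in> D" if "x \<in> D" "a \<in> ?A" for x a
      using conj[OF that(1), of "X a"] conj[OF that(1), of "- X a"] that(2) by simp
    show "X a + X b - X a - X b \<in> D" if "a \<in> ?A" "b \<in> ?A" "a \<noteq> b" for a b
      using that i unfolding D_def magnus_gens_def by (auto intro!: sgen_base[OF UnI2])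
    show "v + u \<in> Fs ?A" using u v by simp
    show "ab (v + u) = (\<lambda>_. 0)" using ab by (simp add: fun_eq_iff add.commute)
  qed
  then have "tr i 0 (v + u) + tr i u (- u) \<in> magnus_group n m"
    using tr_conj_N[OF i' u] by (intro sgen_add) (auto simp: D_def)
  moreover have "tr i 0 (v + u) + tr i u (- u) = tr i u v"
    using u v by (subst tr_add) (auto simp: add.assoc simp del: add_uminus_conv_diff)
  ultimately show ?thesis by simp
qed

lemma conj_memI: "q + b = r + q \<Longrightarrow> r \<in> S \<Longrightarrow> q + b - q \<in> S" for q :: "'a::group_add"
  by simp

section \<open>Conjugation by signed permutations\<close>

definition sw :: "bool \<Rightarrow> 'a::group_add \<Rightarrow> 'a" where
  "sw e x = (if e then x else - x)"

lemma sw_simps [simp]: "sw True x = x" "sw False x = - x"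
  by (simp_all add: sw_def)

definition signed_perm :: "(nat \<Rightarrow> nat) \<Rightarrow> (nat \<Rightarrow> bool) \<Rightarrow> aut \<Rightarrow> bool" where
  "signed_perm \<sigma> \<epsilon> \<phi> \<longleftrightarrow> bij \<sigma> \<and> (\<forall>l. app \<phi> (X l) = sw (\<epsilon> l) (X (\<sigma> l)))"

definition signed_perms :: "nat set \<Rightarrow> aut set" where
  "signed_perms A = {\<phi>. \<exists>\<sigma> \<epsilon>. signed_perm \<sigma> \<epsilon> \<phi> \<and> (\<forall>l. l \<notin> A \<longrightarrow> \<sigma> l = l \<and> \<epsilon> l)}"

lemma ex_signed_perm:
  assumes "bij \<sigma>"
  shows "\<exists>\<phi>. signed_perm \<sigma> \<epsilon> \<phi>"
proof -
  let ?f = "\<lambda>l. sw (\<epsilon> l) (X (\<sigma> l))"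
  let ?g = "\<lambda>l. sw (\<epsilon> (inv_into UNIV \<sigma> l)) (X (inv_into UNIV \<sigma> l))"
  have 1: "\<sigma> (inv_into UNIV \<sigma> l) = l" "inv_into UNIV \<sigma> (\<sigma> l) = l" for l
    using assms by (auto simp: bij_is_surj surj_f_inv_f bij_is_inj)
  have "app (Aut (fhom ?f)) = fhom ?f"
    by (rule Aut_fhom[where g = ?g]) (auto simp: sw_def 1 hom_f_minus[OF hom_f_fhom])
  then show ?thesis using assms by (auto simp: signed_perm_def intro!: exI[of _ "Aut (fhom ?f)"])
qed

lemma signed_perm_add:
  assumes "signed_perm \<sigma> \<epsilon> \<phi>" "signed_perm \<sigma>' \<epsilon>' \<psi>"
  shows "signed_perm (\<sigma> \<circ> \<sigma>') (\<lambda>l. \<epsilon>' l = \<epsilon> (\<sigma>' l)) (\<phi> + \<psi>)"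
  using assms by (auto simp: signed_perm_def sw_def bij_comp)

lemma signed_perm_uminus:
  assumes "signed_perm \<sigma> \<epsilon> \<phi>"
  shows "signed_perm (inv_into UNIV \<sigma>) (\<lambda>l. \<epsilon> (inv_into UNIV \<sigma> l)) (- \<phi>)"
proof -
  have b: "bij \<sigma>" using assms by (simp add: signed_perm_def)
  have "app (- \<phi>) (X l) = sw (\<epsilon> (inv_into UNIV \<sigma> l)) (X (inv_into UNIV \<sigma> l))" for l
  proof -
    define k where "k = inv_into UNIV \<sigma> l"
    have "l = \<sigma> k" using b by (simp add: k_def bij_is_surj surj_f_inv_f)
    moreover have "app \<phi> (X k) = sw (\<epsilon> k) (X (\<sigma> k))" using assms by (simp add: signed_perm_def)
    then have "X (\<sigma> k) = app \<phi> (sw (\<epsilon> k) (X k))" by (cases "\<epsilon> k") simp_all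
    ultimately have "app (- \<phi>) (X l) = sw (\<epsilon> k) (X k)" by simp
    then show ?thesis by (simp add: k_def)
  qed
  then show ?thesis using b by (simp add: signed_perm_def bij_imp_bij_inv)
qed

lemma SP_add: "\<phi> \<in> signed_perms A \<Longrightarrow> \<psi> \<in> signed_perms A \<Longrightarrow> \<phi> + \<psi> \<in> signed_perms A"
proof -
  assume "\<phi> \<in> signed_perms A" "\<psi> \<in> signed_perms A"
  then obtain \<sigma> \<epsilon> \<sigma>' \<epsilon>' where s: "signed_perm \<sigma> \<epsilon> \<phi>" "signed_perm \<sigma>' \<epsilon>' \<psi>"
    and o: "\<And>l. l \<notin> A \<Longrightarrow> \<sigma> l = l \<and> \<epsilon> l" "\<And>l. l \<notin> A \<Longrightarrow> \<sigma>' l = l \<and> \<epsilon>' l"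
    unfolding signed_perms_def by blast
  then show ?thesis
    unfolding signed_perms_def using signed_perm_add[OF s] by (auto intro!: exI[of _ "\<sigma> \<circ> \<sigma>'"])
qed

lemma SP_uminus: "\<phi> \<in> signed_perms A \<Longrightarrow> - \<phi> \<in> signed_perms A"
proof -
  assume "\<phi> \<in> signed_perms A"
  then obtain \<sigma> \<epsilon> where s: "signed_perm \<sigma> \<epsilon> \<phi>" and o: "\<And>l. l \<notin> A \<Longrightarrow> \<sigma> l = l \<and> \<epsilon> l"
    by (auto simp: signed_perms_def)
  then have "inv_into UNIV \<sigma> l = l" if "l \<notin> A" for l
    using that o[OF that] s inv_into_f_f[of \<sigma> UNIV l]
    by (simp add: signed_perm_def bij_is_inj)
  then show ?thesis using signed_perm_uminus[OF s] o unfolding signed_perms_def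
    by (auto intro!: exI[of _ "inv_into UNIV \<sigma>"])
qed

lemma signed_perm_Fs:
  assumes "signed_perm \<sigma> \<epsilon> \<phi>" "x \<in> Fs A"
  shows "app \<phi> x \<in> Fs (\<sigma> ` A)"
  using assms(2) by (rule app_Fs) (use assms(1) in \<open>auto simp: signed_perm_def sw_def\<close>)

text \<open>If \<open>x_i\<close> goes to an inverse letter, the image of \<open>u x_i v\<close> has
  to be inverted to read off the new value, which exchanges the two factors and changes their
  signs.\<close>

lemma signed_perm_conj_tr:
  assumes s: "signed_perm \<sigma> \<epsilon> \<phi>" and u: "u \<in> Fs (- {i})" and v: "v \<in> Fs (- {i})"
  shows "\<phi> + tr i u v =
    (if \<epsilon> i then tr (\<sigma> i) (app \<phi> u) (app \<phi> v) else tr (\<sigma> i) (- app \<phi> v) (- app \<phi> u)) + \<phi>"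
proof (rule aut_eqI)
  fix l
  have b: "inj \<sigma>" using s by (simp add: signed_perm_def bij_is_inj)
  have eq: "app \<phi> (X l) = sw (\<epsilon> l) (X (\<sigma> l))" for l using s by (simp add: signed_perm_def)
  have "\<sigma> ` (- {i}) \<subseteq> - {\<sigma> i}" using b by (auto simp: inj_def)
  then have "app \<phi> u \<in> Fs (- {\<sigma> i})" "app \<phi> v \<in> Fs (- {\<sigma> i})"
    using signed_perm_Fs[OF s u] signed_perm_Fs[OF s v] Fs_mono by blast+
  then show "app (\<phi> + tr i u v) (X l) = app ((if \<epsilon> i then tr (\<sigma> i) (app \<phi> u) (app \<phi> v)
      else tr (\<sigma> i) (- app \<phi> v) (- app \<phi> u)) + \<phi>) (X l)"
    using u v b by (auto simp: app_tr eq sw_def inj_eq group_norm simp del: add_uminus_conv_diff)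
qed

text \<open>Words with vanishing exponent sums are generated by commutators and their conjugates,
  and an automorphism maps commutators to commutators.\<close>

lemma ab_0_app:
  assumes "\<And>a. ab u a + ab v a = 0"
  shows "ab (app \<phi> u) a + ab (app \<phi> v) a = 0"
proof -
  let ?D = "{x. \<forall>a. ab (app \<phi> x) a = 0}"
  have "u + v \<in> ?D"
    by (rule ab_0_imp_mem[where A = UNIV]) (use assms in \<open>auto simp: fun_eq_iff\<close>)
  then show ?thesis by simp
qed

lemma signed_perm_conj_N:
  assumes s: "signed_perm \<sigma> \<epsilon> \<phi>" and \<sigma>: "\<sigma> ` {1..n} \<subseteq> {1..n}" "\<sigma> ` {1..m} \<subseteq> {1..m}"
    and mn: "m \<le> n" and x: "x \<in> magnus_group n m"
  shows "\<phi> + x - \<phi> \<in> magnus_group n m"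
  using x
proof (rule sgen_conj)
  fix b assume "b \<in> magnus_gens n m"
  have inj: "inj \<sigma>" using s by (simp add: signed_perm_def bij_is_inj)
  have F: "app \<phi> u \<in> Fs ({1..n} - {\<sigma> i})" if "u \<in> Fs ({1..n} - {i})" for u i
  proof -
    have "\<sigma> ` ({1..n} - {i}) \<subseteq> {1..n} - {\<sigma> i}"
      using \<sigma>(1) inj by (auto simp: inj_eq)
    then show ?thesis using signed_perm_Fs[OF s that] Fs_mono by blast
  qed
  note b = \<open>b \<in> magnus_gens n m\<close>[unfolded magnus_gens_def Un_iff]
  then show "\<phi> + b - \<phi> \<in> magnus_group n m"
  proof
    assume "b \<in> {tr i (X j) (- X j) | i j. i \<in> {1..n} \<and> j \<in> {1..n} \<and> i \<noteq> j}"
    then obtain i j where b: "b = tr i (X j) (- X j)" and ij: "i \<in> {1..n}" "j \<in> {1..n}" "i \<noteq> j"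
      by blast
    have i: "\<sigma> i \<in> {1..n}" using \<sigma>(1) ij by blast
    have j: "app \<phi> (X j) \<in> Fs ({1..n} - {\<sigma> i})" using ij by (intro F) simp
    show ?thesis
    proof (rule conj_memI)
      show "\<phi> + b = tr (\<sigma> i) (app \<phi> (X j)) (- app \<phi> (X j)) + \<phi>"
        unfolding b using ij by (subst signed_perm_conj_tr[OF s]) auto
    qed (rule tr_conj_N[OF i j])
  next
    assume "b \<in> {tr i 0 (X j + X k - X j - X k) | i j k. i \<in> {1..m} \<and> j \<in> {1..n} \<and> k \<in> {1..n} \<and>
                          i \<noteq> j \<and> i \<noteq> k \<and> j \<noteq> k}"
    then obtain i j k where b: "b = tr i 0 (X j + X k - X j - X k)"
      and ijk: "i \<in> {1..m}" "j \<in> {1..n}" "k \<in> {1..n}" "i \<noteq> j" "i \<noteq> k"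
      by blast
    let ?c = "X j + X k - X j - X k"
    have i: "\<sigma> i \<in> {1..m}" using \<sigma>(2) ijk by blast
    have c: "?c \<in> Fs ({1..n} - {i})" using ijk by simp
    have c': "?c \<in> Fs (- {i})" using ijk by simp
    have z: "ab (app \<phi> 0) a + ab (app \<phi> ?c) a = 0" for a
      by (rule ab_0_app) simp
    show ?thesis unfolding b
      by (rule conj_memI[OF signed_perm_conj_tr[OF s _ c']])
        (use F[OF c] z in \<open>auto intro!: tr_comm_N[OF i mn] simp del: app_add app_diff\<close>)
  qed
qed

section \<open>Conjugation by transvections\<close>

definition E :: "nat \<Rightarrow> nat \<Rightarrow> aut" where
  "E i j = tr i 0 (X j)"

lemma app_E: "i \<noteq> j \<Longrightarrow> app (E i j) (X l) = (if l = i then X i + X j else X l)"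
  by (simp add: E_def app_tr)

text \<open>The cases record how the moved letter \<open>i\<close> meets \<open>a\<close> and
  \<open>b\<close>. Apart from both, the factors are merely transported; for \<open>i = a\<close>
  the right factor is also conjugated by \<open>x_b\<close>; for \<open>i = b\<close> the image
  \<open>x_a x_b\<close> feels the change of \<open>x_b\<close>, and a compensating factor on
  \<open>x_a\<close> appears.\<close>

lemma E_conj_N:
  assumes a: "a \<in> {1..m}" and b: "b \<in> {1..n}" and neq: "a \<noteq> b" and mn: "m \<le> n"
    and x: "x \<in> magnus_group n m"
  shows "E a b + x - E a b \<in> magnus_group n m"
  using x
proof (rule sgen_conj)
  fix y assume "y \<in> magnus_gens n m"
  note Kdef = \<open>y \<in> magnus_gens n m\<close>[unfolded magnus_gens_def Un_iff]
  have an: "a \<in> {1..n}" using a mn by auto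
  have ab_E: "ab (app (E a b) u) c + ab (app (E a b) v) c = 0"
    if "\<And>a. ab u a + ab v a = 0" for u v c
    using that by (rule ab_0_app)
  have Fst: "app (E a b) u \<in> Fs ({1..n} - {i})" if "u \<in> Fs ({1..n} - {i})" "i \<noteq> b" "i \<noteq> a" for u i
    using that(1) by (rule app_Fs) (use that an b in \<open>auto simp: app_E[OF neq]\<close>)
  have other: "E a b + tr i u v = tr i (app (E a b) u) (app (E a b) v) + E a b"
    if "i \<noteq> a" "i \<noteq> b" "u \<in> Fs ({1..n} - {i})" "v \<in> Fs ({1..n} - {i})" for i u v
  proof (rule aut_eqI)
    fix l
    show "app (E a b + tr i u v) (X l) = app (tr i (app (E a b) u) (app (E a b) v) + E a b) (X l)"
      using that Fst[THEN Fs_Compl] Fs_Compl neq by (auto simp: app_tr app_E[OF neq])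
  qed
  have same: "E a b + tr a u v = tr a u (X b + v - X b) + E a b"
    if "u \<in> Fs ({1..n} - {a})" "v \<in> Fs ({1..n} - {a})" for u v
  proof (rule aut_eqI)
    fix l
    have "app (E a b) u = u" "app (E a b) v = v"
      unfolding E_def using that Fs_Compl neq by (auto simp: app_tr_avoid)
    then show "app (E a b + tr a u v) (X l) = app (tr a u (X b + v - X b) + E a b) (X l)"
      using that Fs_Compl neq
      by (auto simp: app_tr app_E[OF neq] group_norm simp del: add_uminus_conv_diff)
  qed
  have commN: "tr i 0 (X j + X k - X j - X k) \<in> magnus_group n m"
    if "i \<in> {1..m}" "j \<in> {1..n}" "k \<in> {1..n}" "i \<noteq> j" "i \<noteq> k" for i j k
    using that by (intro tr_comm_N mn) auto
  have conjK: "E a b + tr b (X j) (- X j) - E a b \<in> magnus_group n m" if j: "j \<in> {1..n}" "j \<noteq> b" for j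
  proof (cases "j = a")
    case True
    show ?thesis
    proof (rule conj_memI)
      show "E a b + tr b (X j) (- X j) = tr b (X a) (- X a) + tr a (X b) (- X b) + E a b"
        using neq True by (intro aut_eqI)
          (auto simp: app_tr app_E[OF neq] group_norm simp del: add_uminus_conv_diff)
      show "tr b (X a) (- X a) + tr a (X b) (- X b) \<in> magnus_group n m"
        using an b neq by (intro sgen_add tr_conj_N) auto
    qed
  next
    case False
    show ?thesis
    proof (rule conj_memI)
      show "E a b + tr b (X j) (- X j) = tr a 0 (X b + X j - X b - X j) + tr b (X j) (- X j) + E a b"
        using neq False j by (intro aut_eqI)
          (auto simp: app_tr app_E[OF neq] group_norm simp del: add_uminus_conv_diff)
      show "tr a 0 (X b + X j - X b - X j) + tr b (X j) (- X j) \<in> magnus_group n m"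
        using a b neq j False by (intro sgen_add tr_conj_N commN) auto
    qed
  qed
  show "E a b + y - E a b \<in> magnus_group n m"
    using Kdef
  proof
    assume "y \<in> {tr i (X j) (- X j) | i j. i \<in> {1..n} \<and> j \<in> {1..n} \<and> i \<noteq> j}"
    then obtain i j where y: "y = tr i (X j) (- X j)" and ij: "i \<in> {1..n}" "j \<in> {1..n}" "i \<noteq> j"
      by blast
    consider "i \<noteq> a" "i \<noteq> b" | "i = a" | "i = b" by blast
    then show ?thesis
    proof cases
      case 1
      have u: "X j \<in> Fs ({1..n} - {i})" using ij by simp
      show ?thesis unfolding y
        by (rule conj_memI[OF other])
          (use u 1 Fst[OF u] in \<open>auto intro!: tr_conj_N[OF ij(1)]\<close>)
    next
      case 2
      have u: "X j \<in> Fs ({1..n} - {i})" using ij by simp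
      show ?thesis unfolding y 2
        by (rule conj_memI[OF same])
          (use u 2 b neq in \<open>auto intro!: tr_comm_N[OF a mn]\<close>)
    next
      case 3
      then show ?thesis unfolding y using conjK ij by auto
    qed
  next
    assume "y \<in> {tr i 0 (X j + X k - X j - X k) | i j k. i \<in> {1..m} \<and> j \<in> {1..n} \<and> k \<in> {1..n} \<and>
                          i \<noteq> j \<and> i \<noteq> k \<and> j \<noteq> k}"
    then obtain i j k where y: "y = tr i 0 (X j + X k - X j - X k)"
      and ijk: "i \<in> {1..m}" "j \<in> {1..n}" "k \<in> {1..n}" "i \<noteq> j" "i \<noteq> k" "j \<noteq> k"
      by blast
    let ?c = "X j + X k - X j - X k"
    have c: "?c \<in> Fs ({1..n} - {i})" using ijk by simp
    text \<open>The commutator itself has a complicated conjugate, unlike the element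
      \<open>tr b (X k) (- X a - X k + X a)\<close>, of which it is a conjugate by elements of \<open>N\<close>.\<close>
    have key: "E a b + tr b 0 (X a + X k - X a - X k) - E a b \<in> magnus_group n m"
      if b: "b \<in> {1..m}" and k: "k \<in> {1..n}" "k \<noteq> a" "k \<noteq> b" for k
    proof -
      define M where "M = tr b (X k) (- X a - X k + X a)"
      define Ka where "Ka = tr b (X a) (- X a)"
      define Kk where "Kk = tr b (X k) (- X k)"
      have bn: "b \<in> {1..n}" using b mn by auto
      have M: "E a b + M - E a b \<in> magnus_group n m"
      proof (rule conj_memI)
        show "E a b + M = tr b (X k - X a - X k + X a) 0 + tr a (X k) (- X k) + E a b"
          unfolding M_def using neq k by (intro aut_eqI)
            (auto simp: app_tr app_E[OF neq] group_norm simp del: add_uminus_conv_diff)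
        show "tr b (X k - X a - X k + X a) 0 + tr a (X k) (- X k) \<in> magnus_group n m"
          using an k neq by (intro sgen_add tr_conj_N tr_comm_N[OF b mn]) auto
      qed
      have Ka: "E a b + Ka - E a b \<in> magnus_group n m" and Kk: "E a b + Kk - E a b \<in> magnus_group n m"
        unfolding Ka_def Kk_def using conjK an k neq by auto
      have eq: "tr b 0 (X a + X k - X a - X k) = - Ka + - Kk + M + Ka"
        unfolding Ka_def Kk_def M_def using neq k
        by (simp add: tr_uminus tr_add group_norm del: add_uminus_conv_diff)
      have "- (E a b + Ka - E a b) + - (E a b + Kk - E a b) + (E a b + M - E a b)
          + (E a b + Ka - E a b) \<in> magnus_group n m"
        using M Ka Kk by (intro sgen_add sgen_uminus)
      then show ?thesis unfolding eq by (simp add: group_norm del: add_uminus_conv_diff)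
    qed
    consider "i \<noteq> a" "i \<noteq> b" | "i = a" | "i = b" "j = a" | "i = b" "k = a"
      | "i = b" "j \<noteq> a" "k \<noteq> a" by blast
    then show ?thesis
    proof cases
      case 1
      have "ab (app (E a b) 0) d + ab (app (E a b) ?c) d = 0" for d
        by (rule ab_E) simp
      then show ?thesis unfolding y
        by (intro conj_memI[OF other])
          (use c 1 Fst[OF c] in \<open>auto intro!: tr_comm_N[OF ijk(1) mn] simp del: app_add app_diff\<close>)
    next
      case 2
      show ?thesis unfolding y 2
        by (rule conj_memI[OF same])
          (use c 2 b neq in \<open>auto intro!: tr_comm_N[OF a mn]\<close>)
    next
      case 3
      then show ?thesis unfolding y using key ijk by auto
    next
      case 4
      have "- (E a b + tr b 0 (X a + X j - X a - X j) - E a b) \<in> magnus_group n m"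
        using key ijk 4 by (intro sgen_uminus) auto
      moreover have "y = - tr b 0 (X a + X j - X a - X j)"
        unfolding y using 4 ijk by (simp add: tr_uminus group_norm del: add_uminus_conv_diff)
      ultimately show ?thesis by (simp add: group_norm del: add_uminus_conv_diff)
    next
      case 5
      show ?thesis unfolding y
      proof (rule conj_memI)
        show "E a b + tr i 0 ?c = tr a 0 (X b - ?c - X b) + tr b 0 ?c + E a b"
          using neq 5 ijk by (intro aut_eqI)
            (auto simp: app_tr app_E[OF neq] group_norm simp del: add_uminus_conv_diff)
        show "tr a 0 (X b - ?c - X b) + tr b 0 ?c \<in> magnus_group n m"
          using a b neq ijk 5 by (intro sgen_add tr_comm_N[OF _ mn]) auto
      qed
    qed
  qed
qed

text \<open>Inverting the letter \<open>x_b\<close> conjugates \<open>E a b\<close> into its inverse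
  and normalises \<open>N\<close>, so \<open>E_conj_N\<close> is applied between two such
  inversions. This works for \<open>b\<close> beyond \<open>m\<close> too, since the underlying
  permutation is the identity.\<close>

lemma E_uminus_conj_N:
  assumes a: "a \<in> {1..m}" and b: "b \<in> {1..n}" and neq: "a \<noteq> b" and mn: "m \<le> n"
    and x: "x \<in> magnus_group n m"
  shows "- E a b + x + E a b \<in> magnus_group n m"
proof -
  obtain \<iota> where \<iota>: "signed_perm id (\<lambda>l. l \<noteq> b) \<iota>" using ex_signed_perm[of id] by auto
  have i: "app \<iota> (X l) = (if l = b then - X b else X l)" for l
    using \<iota> by (auto simp: signed_perm_def sw_def)
  have inv: "\<iota> + \<iota> = 0" by (rule aut_eqI) (simp add: i)
  then have m\<iota>: "- \<iota> = \<iota>" by (rule minus_unique)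
  have conj: "\<iota> + z - \<iota> \<in> magnus_group n m" if "z \<in> magnus_group n m" for z
    using signed_perm_conj_N[OF \<iota> _ _ mn that] by simp
  have "E a b + (\<iota> + E a b) = \<iota>"
    by (rule aut_eqI) (use neq in \<open>auto simp: i app_E\<close>)
  then have "- E a b + (E a b + (\<iota> + E a b)) = - E a b + \<iota>" by (rule arg_cong)
  then have eq: "\<iota> + E a b - \<iota> = - E a b" by (simp only: minus_add_cancel add_diff_cancel)
  have "\<iota> + (E a b + (\<iota> + x - \<iota>) - E a b) - \<iota> \<in> magnus_group n m"
    by (intro conj E_conj_N assms)
  moreover have "\<iota> + (E a b + (\<iota> + x - \<iota>) - E a b) - \<iota>
      = (\<iota> + E a b - \<iota>) + x - (\<iota> + E a b - \<iota>)"
    by (simp add: m\<iota> group_norm del: add_uminus_conv_diff)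
  ultimately show ?thesis by (simp only: eq diff_minus_eq_add)
qed

section \<open>Nielsen reduction of conjugating automorphisms\<close>

fun lcp :: "'a list \<Rightarrow> 'a list \<Rightarrow> nat" where
  "lcp (x # xs) (y # ys) = (if x = y then Suc (lcp xs ys) else 0)"
| "lcp _ _ = 0"

lemma le_lcp_iff:
  "k \<le> lcp xs ys \<longleftrightarrow> k \<le> length xs \<and> k \<le> length ys \<and> take k xs = take k ys"
proof (induction xs ys arbitrary: k rule: lcp.induct)
  case (1 x xs y ys)
  show ?case by (cases k) (auto simp: 1)
qed auto

abbreviation inv_word :: "(nat \<times> bool) list \<Rightarrow> (nat \<times> bool) list" where
  "inv_word w \<equiv> rev (map letter_inv w)"

lemma inv_word_inv_word [simp]: "inv_word (inv_word w) = w"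
  by (simp add: rev_map comp_def)

definition len :: "fword \<Rightarrow> nat" where
  "len x = length (letters x)"

text \<open>The number of letters that cancel in \<open>- x + y\<close>, that is, the Gromov product
  of \<open>x\<close> and \<open>y\<close> in the Cayley tree.\<close>

definition cp :: "fword \<Rightarrow> fword \<Rightarrow> nat" where
  "cp x y = lcp (letters x) (letters y)"

lemma len_uminus [simp]: "len (- x) = len x"
  by (simp add: len_def letters_uminus)

lemma len_ev_le: "len (ev w) \<le> length w"
  by (simp add: len_def length_letters_ev_le)

lemma len_eq_0 [simp]: "len x = 0 \<longleftrightarrow> x = 0"
  by (metis ev_letters len_def length_0_conv letters_0 wval_Nil)

lemma le_cp_iff: "k \<le> cp x y \<longleftrightarrow> k \<le> len x \<and> k \<le> len y \<and> take k (letters x) = take k (letters y)"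
  by (simp add: cp_def len_def le_lcp_iff)

lemma cp_commute: "cp x y = cp y x"
proof -
  have "k \<le> cp x y \<longleftrightarrow> k \<le> cp y x" for k
    unfolding le_cp_iff by auto
  then show ?thesis by (meson order_antisym order_refl)
qed

lemma cp_prefixI: "letters x = p @ a \<Longrightarrow> letters y = p @ b \<Longrightarrow> length p \<le> cp x y"
  by (simp add: le_cp_iff len_def)

lemma cp_prefixE:
  assumes "k \<le> cp x y"
  obtains p a b where "letters x = p @ a" "letters y = p @ b" "length p = k"
proof
  have k: "k \<le> len x" "take k (letters x) = take k (letters y)"
    using assms by (auto simp: le_cp_iff)
  show "letters x = take k (letters x) @ drop k (letters x)"
    "letters y = take k (letters x) @ drop k (letters y)"
    using k by (metis append_take_drop_id)+
  show "length (take k (letters x)) = k" using assms by (simp add: le_cp_iff len_def)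
qed

text \<open>The ultrametric property of a tree: of three pairwise common prefixes the two shortest
  have equal length.\<close>

lemma cp_eqI:
  assumes "cp x y < cp y z"
  shows "cp x z = cp x y"
proof -
  have "k \<le> cp x z \<longleftrightarrow> k \<le> cp x y" if "k \<le> cp y z" for k
    using that unfolding le_cp_iff by auto
  from this[of "cp x y"] this[of "Suc (cp x y)"] assms show ?thesis by simp
qed

text \<open>Once the longest common prefix is removed, the two tails begin with different letters
  and nothing more cancels.\<close>

lemma len_minus_add: "len (- x + y) + 2 * cp x y = len x + len y"
proof -
  obtain p a b where p: "letters x = p @ a" "letters y = p @ b" "length p = cp x y"
    by (rule cp_prefixE[OF order_refl])
  have hd: "hd a \<noteq> hd b" if "a \<noteq> []" "b \<noteq> []"
  proof
    assume "hd a = hd b"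
    then have "Suc (cp x y) \<le> cp x y"
      using p that by (intro order_trans[OF _ cp_prefixI[of x "p @ [hd a]" "tl a" y "tl b"]])
        (auto simp: neq_Nil_conv)
    then show False by simp
  qed
  have r: "reduced (p @ a)" "reduced (p @ b)" using p by (metis reduced_letters)+
  have "successively (\<lambda>k l. l \<noteq> letter_inv k) (inv_word a)" "reduced b"
    using r reduced_rev_letter_inv[of a] by (auto simp: reduced_def successively_append_iff)
  then have "reduced (inv_word a @ b)"
    using hd by (cases a; cases b) (auto simp: reduced_def successively_append_iff)
  moreover have "- x + y = ev (inv_word a @ b)"
  proof -
    have "x = ev p + ev a" "y = ev p + ev b"
      using p by (metis ev_letters wval_append)+
    then show ?thesis
      by (simp add: wval_append wval_letter_inv group_norm del: add_uminus_conv_diff)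
  qed
  ultimately have "len (- x + y) = length a + length b"
    by (simp add: len_def letters_ev_reduced)
  then show ?thesis using p by (simp add: len_def)
qed

text \<open>If cancellation between neighbouring factors never exceeds half of a factor, and no factor is
  cancelled completely from both sides, then every factor contributes a letter to the product.\<close>

lemma length_le_len_wval:
  fixes f :: "nat \<Rightarrow> fword" and A :: "nat set"
  defines "g \<equiv> \<lambda>l. sw (snd l) (f (fst l))"
  assumes pos: "\<And>l. fst l \<in> A \<Longrightarrow> g l \<noteq> 0"
    and half: "\<And>k l. fst k \<in> A \<Longrightarrow> fst l \<in> A \<Longrightarrow> l \<noteq> letter_inv k \<Longrightarrow> 2 * cp (- g k) (g l) \<le> len (g k)"
    and both: "\<And>j k l. fst j \<in> A \<Longrightarrow> fst k \<in> A \<Longrightarrow> fst l \<in> A \<Longrightarrow> k \<noteq> letter_inv j \<Longrightarrow>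
      l \<noteq> letter_inv k \<Longrightarrow> cp (- g j) (g k) + cp (- g k) (g l) < len (g k)"
    and w: "reduced w" "fst ` set w \<subseteq> A"
  shows "length w \<le> len (wval f w)"
proof -
  have C: "wval f (l # w) = g l + wval f w" for l w
    by (simp add: wval_Cons g_def sw_def)
  \<comment> \<open>Here \<open>c\<close> counts the letters of the first factor that cancel against
    the rest. The other letters survive as a prefix of the product, and this prefix is all that a
    further factor on the left can meet.\<close>
  have *: "\<exists>c. length w + (len (g l) - c) \<le> len (wval f (l # w)) \<and>
      len (g l) - c \<le> cp (wval f (l # w)) (g l) \<and> 2 * c \<le> len (g l) \<and>
      (w \<noteq> [] \<longrightarrow> c = cp (- g l) (g (hd w))) \<and> (w = [] \<longrightarrow> c = 0)"
    if "reduced (l # w)" "fst ` set (l # w) \<subseteq> A" for l w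
    using that
  proof (induction w arbitrary: l)
    case Nil
    show ?case using cp_prefixI[of "g l" "letters (g l)" "[]" "g l" "[]"]
      by (intro exI[of _ 0]) (simp add: C len_def)
  next
    case (Cons k w)
    let ?x = "wval f (k # w)"
    have A: "fst l \<in> A" "fst k \<in> A" and Aw: "fst ` set (k # w) \<subseteq> A"
      using Cons.prems(2) by simp_all
    have kl: "k \<noteq> letter_inv l" and rk: "reduced (k # w)"
      using Cons.prems(1) by (simp_all add: reduced_Cons[of l])
    from Cons.IH[OF rk Aw] obtain c where
      c: "length w + (len (g k) - c) \<le> len ?x" "len (g k) - c \<le> cp ?x (g k)" "2 * c \<le> len (g k)"
        "w \<noteq> [] \<Longrightarrow> c = cp (- g k) (g (hd w))" "w = [] \<Longrightarrow> c = 0" by blast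
    define d where "d = cp (- g l) (g k)"
    have half_l: "2 * d \<le> len (g l)" using half[OF A kl] by (simp add: d_def)
    have half_k: "2 * d \<le> len (g k)"
    proof -
      have "g (letter_inv q) = - g q" for q by (auto simp: g_def letter_inv_def sw_def)
      then show ?thesis
        using half[of "letter_inv k" "letter_inv l"] A kl cp_commute[of "g k" "- g l"]
        by (auto simp: d_def)
    qed
    have gk: "g k \<noteq> 0" using pos A by simp
    \<comment> \<open>A letter of \<open>g k\<close> survives between its two neighbours. At the end
      of the word there is no right neighbour, and half of a nontrivial factor is less than the
      whole.\<close>
    have dc: "d + c < len (g k)"
    proof (cases w)
      case Nil
      then have "c = 0" "len (g k) \<noteq> 0" using c(5) gk by auto
      then show ?thesis using half_k by linarith
    next
      case (Cons r w')
      then show ?thesis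
        using both[of l k r] A kl rk Aw c(4) by (simp add: d_def reduced_Cons)
    qed
    have "cp (- g l) ?x = d"
      unfolding d_def using dc c(2) cp_commute[of ?x "g k"]
      by (intro cp_eqI) (simp add: d_def)
    then have lenx: "len (g l + ?x) + 2 * d = len (g l) + len ?x"
      using len_minus_add[of "- g l" ?x] by simp
    have "len (- (g l + ?x) + g l) + 2 * cp (g l + ?x) (g l) = len (g l + ?x) + len (g l)"
      by (rule len_minus_add)
    moreover have "- (g l + ?x) + g l = - ?x" by (simp add: group_norm del: add_uminus_conv_diff)
    ultimately have "cp (g l + ?x) (g l) = len (g l) - d" using lenx by simp
    moreover have "length (k # w) + (len (g l) - d) \<le> len (g l + ?x)"
    proof -
      have "1 \<le> len (g k) - c - d" "d \<le> len (g l)" using dc half_l by linarith+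
      then show ?thesis using c(1) lenx dc by simp
    qed
    ultimately show ?case
      using half_l by (intro exI[of _ d]) (simp add: C[of l] d_def)
  qed
  show ?thesis
  proof (cases w)
    case (Cons l v)
    obtain c where c: "length v + (len (g l) - c) \<le> len (wval f (l # v))" "2 * c \<le> len (g l)"
      using *[OF w[unfolded Cons]] by blast
    have "len (g l) \<noteq> 0" using pos[of l] w Cons by simp
    then have "1 \<le> len (g l) - c" using c(2) by linarith
    then have "length v + 1 \<le> length v + (len (g l) - c)" by (rule add_left_mono)
    from order_trans[OF this c(1)] show ?thesis unfolding Cons by simp
  qed simp
qed

text \<open>At odd length the middle letter would be its own inverse; at even length the second half
  is the inverse of the first.\<close>

lemma inv_word_fixed:
  assumes "inv_word w = w"
  shows "ev w = 0"
proof (cases "even (length w)")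
  case True
  define h where "h = length w div 2"
  have h: "length w = 2 * h" using True by (simp add: h_def)
  have "drop h (inv_word w) = inv_word (take h w)"
    using h by (simp add: drop_rev take_map)
  then have "drop h w = inv_word (take h w)" using assms by simp
  then have "ev (take h w @ drop h w) = ev (take h w) + - ev (take h w)"
    by (simp only: wval_append wval_letter_inv)
  then show ?thesis by simp
next
  case False
  then obtain h where h: "length w = 2 * h + 1" by (auto elim: oddE)
  have "inv_word w ! h = letter_inv (w ! h)"
    using h by (simp add: rev_nth)
  then show ?thesis using assms by simp
qed

text \<open>If half of \<open>x\<close> cancelled in \<open>x + x\<close>, then \<open>x\<close>
  would be \<open>b^-1 q b\<close> with a middle part \<open>q\<close> equal to its own inverse,
  hence trivial.\<close>

lemma cp_uminus_self:
  assumes "x \<noteq> 0"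
  shows "2 * cp (- x) x < len x"
proof (rule ccontr)
  assume "\<not> ?thesis"
  then have ge: "len x \<le> 2 * cp (- x) x" by simp
  obtain p a b where p: "letters (- x) = p @ a" "letters x = p @ b" "length p = cp (- x) x"
    by (rule cp_prefixE[OF order_refl])
  have e: "inv_word b @ inv_word p = p @ a" using p by (simp add: letters_uminus)
  have le: "length b \<le> length p" using ge p by (simp add: len_def)
  have "take (length b) (inv_word b @ inv_word p) = take (length b) (p @ a)" by (simp only: e)
  then have "inv_word b = take (length b) p" using le by simp
  then obtain q where q: "p = inv_word b @ q" by (metis append_take_drop_id)
  have "inv_word b @ inv_word q @ b = inv_word b @ q @ a" using e unfolding q by (simp add: rev_map comp_def)
  then have "inv_word q = q" by (simp add: append_eq_append_conv)
  then have "ev q = 0" by (rule inv_word_fixed)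
  moreover have "x = ev (inv_word b @ q @ b)" using p q by (metis append_assoc ev_letters)
  ultimately have "x = 0" by (simp add: wval_append wval_letter_inv)
  then show False using assms by simp
qed

text \<open>Final letters of the conjugator that are powers of \<open>x_j\<close> commute with
  \<open>x_j\<close> and are dropped; after that the conjugate is reduced as written. Images of
  letters beyond \<open>m\<close> therefore have odd length and a visible central letter.\<close>

lemma conj_letters:
  "\<exists>h. letters (g + sw e (X j) - g) = h @ [(j, e)] @ inv_word h"
proof -
  have "\<exists>h. letters (ev w + sw e (X j) - ev w) = h @ [(j, e)] @ inv_word h" if "reduced w" for w
    using that
  proof (induction w rule: rev_induct)
    case Nil
    show ?case by (intro exI[of _ "[]"]) (auto simp: sw_def letters_X letters_minus_X)
  next
    case (snoc l w)
    show ?case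
    proof (cases "fst l = j")
      case True
      have "ev (w @ [l]) + sw e (X j) - ev (w @ [l]) = ev w + sw e (X j) - ev w"
        using True by (auto simp: wval_append wval_Cons sw_def group_norm simp del: add_uminus_conv_diff)
      then show ?thesis using snoc by (auto simp: reduced_def successively_append_iff)
    next
      case False
      let ?v = "(w @ [l]) @ [(j, e)] @ inv_word (w @ [l])"
      have "reduced ?v"
        using snoc.prems reduced_rev_letter_inv[OF snoc.prems] False
        by (auto simp: reduced_def successively_append_iff letter_inv_def)
      moreover have "ev (w @ [l]) + sw e (X j) - ev (w @ [l]) = ev ?v"
        unfolding wval_append[of _ "w @ [l]"] wval_append[of _ "[(j, e)]"] wval_letter_inv
        by (simp add: wval_Cons sw_def group_norm del: add_uminus_conv_diff)
      ultimately show ?thesis by (metis letters_ev_reduced)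
    qed
  qed
  from this[of "letters g"] show ?thesis by simp
qed

text \<open>The word as a number in base \<open>2 * n + 2\<close>, lowest digit first: over the
  letters up to \<open>n\<close> the digits stay below the base, which makes the code injective at
  fixed length.\<close>

fun code :: "nat \<Rightarrow> (nat \<times> bool) list \<Rightarrow> nat" where
  "code n [] = 0"
| "code n ((a, e) # w) = 2 * a + of_bool e + (2 * n + 2) * code n w"

lemma code_append: "code n (v @ w) = code n v + (2 * n + 2) ^ length v * code n w"
  by (induction v) (auto simp: algebra_simps)

lemma code_inj:
  assumes "length v = length w" "fst ` set v \<subseteq> {1..n}" "fst ` set w \<subseteq> {1..n}" "code n v = code n w"
  shows "v = w"
  using assms
proof (induction v w rule: list_induct2)
  case (Cons k v l w)
  obtain a d b e where k: "k = (a, d)" "l = (b, e)" by (cases k, cases l)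
  have "2 * a + of_bool d < 2 * n + 2" "2 * b + of_bool e < 2 * n + 2"
    using Cons.prems by (auto simp: k)
  moreover have "2 * a + of_bool d + (2 * n + 2) * code n v = 2 * b + of_bool e + (2 * n + 2) * code n w"
    using Cons.prems by (simp add: k)
  moreover have "x = y \<and> p = q" if "x < K" "y < K" "x + K * p = y + K * q" for x y p q K :: nat
    using arg_cong[OF that(3), of "\<lambda>z. z mod K"] arg_cong[OF that(3), of "\<lambda>z. z div K"] that(1,2)
    by simp
  ultimately have *: "2 * a + of_bool d = 2 * b + of_bool e" "code n v = code n w"
    by blast+
  from *(1) have "a = b \<and> d = e" by (cases d; cases e; simp; presburger)
  then show ?case using Cons *(2) by (simp add: k)
qed simp

text \<open>Ties in length are broken by the codes of the initial halves of a word and of its inverse.\<close>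

definition kappa :: "nat \<Rightarrow> fword \<Rightarrow> nat" where
  "kappa n x = code n (take ((len x + 1) div 2) (letters x)) + code n (take ((len x + 1) div 2) (letters (- x)))"

lemma kappa_uminus [simp]: "kappa n (- x) = kappa n x"
  by (simp add: kappa_def)

section \<open>The group of conjugating automorphisms and its generators\<close>

definition nielsen_gens :: "nat \<Rightarrow> nat \<Rightarrow> aut set" where
  "nielsen_gens n m = magnus_gens n m \<union> {E i j | i j. i \<in> {1..m} \<and> j \<in> {1..n} \<and> i \<noteq> j} \<union> signed_perms {1..m}"

abbreviation nielsen_group :: "nat \<Rightarrow> nat \<Rightarrow> aut set" where
  "nielsen_group n m \<equiv> sgen (nielsen_gens n m)"

text \<open>Automorphisms of \<open>F_n\<close> continued by the identity on the other letters; the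
  condition on \<open>- \<phi>\<close> makes the restriction to \<open>F_n\<close>
  surjective.\<close>

definition Aut_Fn :: "nat \<Rightarrow> aut set" where
  "Aut_Fn n = {\<phi>. (\<forall>x\<in>Fs {1..n}. app \<phi> x \<in> Fs {1..n} \<and> app (- \<phi>) x \<in> Fs {1..n}) \<and>
    (\<forall>l. l \<notin> {1..n} \<longrightarrow> app \<phi> (X l) = X l)}"

definition Conj_Fn :: "nat \<Rightarrow> nat \<Rightarrow> aut set" where
  "Conj_Fn n m = {\<phi> \<in> Aut_Fn n. \<forall>j\<in>{m+1..n}. \<exists>g\<in>Fs {1..n}. app \<phi> (X j) = g + X j - g}"

lemma An_add: "\<phi> \<in> Aut_Fn n \<Longrightarrow> \<psi> \<in> Aut_Fn n \<Longrightarrow> \<phi> + \<psi> \<in> Aut_Fn n"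
  by (auto simp: Aut_Fn_def minus_add simp del: add_uminus_conv_diff)

lemma An_uminus: "\<phi> \<in> Aut_Fn n \<Longrightarrow> - \<phi> \<in> Aut_Fn n"
proof -
  have "app (- \<phi>) (X l) = X l" if "app \<phi> (X l) = X l" for l
    using app_uminus_app(1)[of \<phi> "X l"] that by simp
  then show "\<phi> \<in> Aut_Fn n \<Longrightarrow> - \<phi> \<in> Aut_Fn n" by (simp add: Aut_Fn_def)
qed

lemma An_Fs: "\<phi> \<in> Aut_Fn n \<Longrightarrow> x \<in> Fs {1..n} \<Longrightarrow> app \<phi> x \<in> Fs {1..n}"
  by (simp add: Aut_Fn_def)

lemma tr_Fs:
  assumes "i \<in> {1..n}" "u \<in> Fs ({1..n} - {i})" "v \<in> Fs ({1..n} - {i})" "x \<in> Fs {1..n}"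
  shows "app (tr i u v) x \<in> Fs {1..n}"
proof (rule app_Fs[OF assms(4)])
  fix a assume "a \<in> {1..n}"
  then show "app (tr i u v) (X a) \<in> Fs {1..n}"
    using assms Fs_mono[OF assms(2), of "{1..n}"] Fs_mono[OF assms(3), of "{1..n}"]
    by (auto simp: app_tr Fs_Compl intro!: Fs_add simp del: atLeastAtMost_iff)
qed

lemma tr_An:
  assumes "i \<in> {1..n}" "u \<in> Fs ({1..n} - {i})" "v \<in> Fs ({1..n} - {i})"
  shows "tr i u v \<in> Aut_Fn n"
  using assms tr_Fs[OF assms] tr_Fs[OF assms(1), of "- u" "- v"]
  by (auto simp: Aut_Fn_def tr_uminus app_tr Fs_Compl)

lemma tr_Gam:
  assumes "i \<in> {1..n}" "u \<in> Fs ({1..n} - {i})" "v \<in> Fs ({1..n} - {i})" "i \<notin> {1..m} \<Longrightarrow> v = - u"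
  shows "tr i u v \<in> Conj_Fn n m"
  unfolding Conj_Fn_def mem_Collect_eq
proof (intro conjI ballI)
  show "tr i u v \<in> Aut_Fn n" using assms by (intro tr_An)
  fix j assume j: "j \<in> {m + 1..n}"
  show "\<exists>g\<in>Fs {1..n}. app (tr i u v) (X j) = g + X j - g"
  proof (cases "j = i")
    case True
    then have "v = - u" using j assms(4) by auto
    then show ?thesis using True assms Fs_mono[OF assms(2), of "{1..n}"]
      by (intro bexI[of _ u]) (auto simp: app_tr Fs_Compl)
  next
    case False
    then show ?thesis using assms by (intro bexI[of _ 0]) (auto simp: app_tr Fs_Compl)
  qed
qed

lemma Gam_add:
  assumes "\<phi> \<in> Conj_Fn n m" "\<psi> \<in> Conj_Fn n m"
  shows "\<phi> + \<psi> \<in> Conj_Fn n m"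
  unfolding Conj_Fn_def mem_Collect_eq
proof (intro conjI ballI)
  show "\<phi> + \<psi> \<in> Aut_Fn n" using assms by (auto simp: Conj_Fn_def intro: An_add)
  fix j assume j: "j \<in> {m + 1..n}"
  obtain g h where g: "g \<in> Fs {1..n}" "app \<phi> (X j) = g + X j - g"
    and h: "h \<in> Fs {1..n}" "app \<psi> (X j) = h + X j - h"
    using assms j unfolding Conj_Fn_def by blast
  have "app \<phi> h \<in> Fs {1..n}" using assms h by (auto simp: Conj_Fn_def Aut_Fn_def)
  then show "\<exists>g\<in>Fs {1..n}. app (\<phi> + \<psi>) (X j) = g + X j - g"
    using g h by (intro bexI[of _ "app \<phi> h + g"]) (auto simp: group_norm simp del: add_uminus_conv_diff)
qed

lemma N_subset_GG: "magnus_group n m \<subseteq> nielsen_group n m"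
  by (rule sgen_mono) (auto simp: nielsen_gens_def)

lemma E_GG: "i \<in> {1..m} \<Longrightarrow> j \<in> {1..n} \<Longrightarrow> i \<noteq> j \<Longrightarrow> E i j \<in> nielsen_group n m"
  by (rule sgen_base) (auto simp: nielsen_gens_def)

lemma tr_GG:
  assumes mn: "m \<le> n" and i: "i \<in> {1..m}" and j: "j \<in> {1..n}" and "i \<noteq> j"
  shows "tr i 0 (sw e (X j)) \<in> nielsen_group n m" "tr i (sw e (X j)) 0 \<in> nielsen_group n m"
proof -
  have X: "sw e (X j) \<in> Fs ({1..n} - {i})" using assms by (auto simp: sw_def)
  show 1: "tr i 0 (sw e (X j)) \<in> nielsen_group n m"
    using E_GG[OF i j] sgen_uminus[OF E_GG[OF i j]] assms by (cases e) (auto simp: E_def tr_uminus)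
  have "tr i (sw e (X j)) (- sw e (X j)) \<in> nielsen_group n m"
    using tr_conj_N[OF _ X] N_subset_GG i mn by fastforce
  from sgen_add[OF 1 this] show "tr i (sw e (X j)) 0 \<in> nielsen_group n m"
    using X[THEN Fs_Compl] by (simp add: tr_add)
qed

text \<open>Adding \<open>\<tau>\<close> on the right changes one entry in the tuple of images. The
  signs \<open>d\<close> and \<open>e\<close> reduce all one-sided variants to left multiplication
  of a signed image; a letter beyond \<open>m\<close> has only the conjugating variant.\<close>

lemma nielsen_move:
  fixes d e :: bool
  assumes mn: "m \<le> n" and \<phi>: "\<phi> \<in> Conj_Fn n m" and i: "i \<in> {1..n}" and j: "j \<in> {1..n}" and ij: "i \<noteq> j"
  defines "v \<equiv> sw e (app \<phi> (X j))" and "w \<equiv> sw d (app \<phi> (X i))"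
  assumes new: "new = v + w \<and> i \<in> {1..m} \<or> new = v + w - v"
  shows "\<exists>\<tau>\<in>nielsen_group n m. \<phi> + \<tau> \<in> Conj_Fn n m \<and> sw d (app (\<phi> + \<tau>) (X i)) = new \<and>
    (\<forall>a. a \<noteq> i \<longrightarrow> app (\<phi> + \<tau>) (X a) = app \<phi> (X a))"
  using new
proof (elim disjE conjE)
  assume new: "new = v + w" and i: "i \<in> {1..m}"
  \<comment> \<open>Left multiplication of the inverse of an image by \<open>v\<close> is right
    multiplication of the image by the inverse of \<open>v\<close>, hence the two cases.\<close>
  define \<tau> where "\<tau> = (if d then tr i (sw e (X j)) 0 else tr i 0 (sw (\<not> e) (X j)))"
  have X: "sw e' (X j) \<in> Fs ({1..n} - {i})" for e' using j ij by (auto simp: sw_def)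
  have "\<tau> \<in> nielsen_group n m" using tr_GG[OF mn i j ij] by (simp add: \<tau>_def)
  moreover have "\<tau> \<in> Conj_Fn n m"
    using X i mn by (auto simp: \<tau>_def intro!: tr_Gam)
  then have "\<phi> + \<tau> \<in> Conj_Fn n m" by (rule Gam_add[OF \<phi>])
  moreover have "sw d (app (\<phi> + \<tau>) (X i)) = new"
    using X[THEN Fs_Compl] unfolding new v_def w_def \<tau>_def
    by (auto simp: app_tr sw_def group_norm simp del: add_uminus_conv_diff)
  moreover have "app (\<phi> + \<tau>) (X a) = app \<phi> (X a)" if "a \<noteq> i" for a
    using X[THEN Fs_Compl] that by (auto simp: \<tau>_def app_tr)
  ultimately show ?thesis by blast
next
  assume new: "new = v + w - v"
  define \<tau> where "\<tau> = tr i (sw e (X j)) (- sw e (X j))"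
  have X: "sw e' (X j) \<in> Fs ({1..n} - {i})" for e' using j ij by (auto simp: sw_def)
  have "\<tau> \<in> nielsen_group n m" using tr_conj_N[OF i X, of e m] N_subset_GG[of n m] by (auto simp: \<tau>_def)
  moreover have "\<tau> \<in> Conj_Fn n m"
    using X i mn by (auto simp: \<tau>_def intro!: tr_Gam)
  then have "\<phi> + \<tau> \<in> Conj_Fn n m" by (rule Gam_add[OF \<phi>])
  moreover have "sw d (app (\<phi> + \<tau>) (X i)) = new"
    using X[THEN Fs_Compl] unfolding new v_def w_def \<tau>_def
    by (auto simp: app_tr sw_def group_norm simp del: add_uminus_conv_diff)
  moreover have "app (\<phi> + \<tau>) (X a) = app \<phi> (X a)" if "a \<noteq> i" for a
    using X[THEN Fs_Compl] that by (auto simp: \<tau>_def app_tr)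
  ultimately show ?thesis by blast
qed

section \<open>Moves that make a tuple of images smaller\<close>

definition smaller :: "nat \<Rightarrow> fword \<Rightarrow> fword \<Rightarrow> bool" where
  "smaller n x y \<longleftrightarrow> len x < len y \<or> len x = len y \<and> kappa n x < kappa n y"

definition nielsen_less :: "nat \<Rightarrow> (aut \<times> aut) set" where
  "nielsen_less n = inv_image (less_than <*lex*> less_than)
    (\<lambda>\<phi>. (\<Sum>i\<in>{1..n}. len (app \<phi> (X i)), \<Sum>i\<in>{1..n}. kappa n (app \<phi> (X i))))"

lemma wf_nielsen_less: "wf (nielsen_less n)"
  unfolding nielsen_less_def by (intro wf_inv_image wf_lex_prod wf_less_than)

lemma nielsen_lessI:
  assumes "i \<in> {1..n}" "smaller n (sw d (app \<psi> (X i))) (sw d (app \<phi> (X i)))"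
    "\<And>a. a \<noteq> i \<Longrightarrow> app \<psi> (X a) = app \<phi> (X a)"
  shows "(\<psi>, \<phi>) \<in> nielsen_less n"
proof -
  have "(\<Sum>a\<in>{1..n} - {i}. F (app \<psi> (X a))) = (\<Sum>a\<in>{1..n} - {i}. F (app \<phi> (X a)))"
    for F :: "fword \<Rightarrow> nat"
    using assms(3) by (intro sum.cong) auto
  moreover have "(\<Sum>a\<in>{1..n}. F a) = F i + (\<Sum>a\<in>{1..n} - {i}. F a)" for F :: "nat \<Rightarrow> nat"
    using assms(1) by (intro sum.remove) auto
  ultimately show ?thesis
    using assms(2) by (cases d) (auto simp: nielsen_less_def smaller_def)
qed

lemma half_reduce:
  assumes "len v < 2 * cp v w"
  shows "smaller n (- v + w) w"
  using len_minus_add[of v w] assms by (simp add: smaller_def)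

text \<open>Conjugation replaces the outer prefix \<open>p\<close> by the inverse of
  \<open>a\<close>, which is shorter, at both ends of \<open>w\<close>.\<close>

lemma conj_reduce:
  assumes v: "letters v = p @ a" and w: "letters w = p @ h @ [x] @ inv_word h @ inv_word p"
    and "length a < length p"
  shows "smaller n (- v + w + v) w"
proof -
  have "v = ev p + ev a" "w = ev p + ev h + ev [x] - ev h - ev p"
    using v w wval_letter_inv[of X h] wval_letter_inv[of X p]
    by (metis ev_letters wval_append add.assoc add_uminus_conv_diff)+
  then have "- v + w + v = ev (inv_word a @ h @ [x] @ inv_word h @ a)"
    by (simp only: wval_append wval_letter_inv)
      (simp add: group_norm del: add_uminus_conv_diff)
  then have "len (- v + w + v) \<le> length (inv_word a @ h @ [x] @ inv_word h @ a)"
    by (simp only: len_ev_le)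
  moreover have "len w = length (letters w)" by (simp add: len_def)
  ultimately show ?thesis using assms(3) by (simp add: smaller_def w)
qed

text \<open>Since \<open>v\<close> contains the central letter of \<open>w\<close> in the same
  position, multiplying by the inverse of \<open>w\<close> deletes that letter from
  \<open>v\<close>.\<close>

lemma beyond_centre_reduce:
  assumes v: "letters v = h @ [x] @ a" and w: "letters w = h @ [x] @ inv_word h"
  shows "smaller n (- w + v) v"
proof -
  have "v = ev h + ev [x] + ev a" "w = ev h + ev [x] - ev h"
    using v w wval_letter_inv[of X h]
    by (metis ev_letters wval_append add.assoc add_uminus_conv_diff)+
  then have "- w + v = ev (h @ a)"
    by (simp only: wval_append wval_letter_inv)
      (simp add: group_norm del: add_uminus_conv_diff)
  then have "len (- w + v) \<le> length (h @ a)"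
    by (simp only: len_ev_le)
  moreover have "len v = length (letters v)" by (simp add: len_def)
  ultimately show ?thesis by (simp add: smaller_def v)
qed

lemma conj_prefix_reduce:
  assumes v: "letters v = h @ [x] @ g @ [y] @ inv_word (h @ [x] @ g)"
    and w: "letters w = h @ [x] @ inv_word h"
  shows "smaller n (- w + v + w) v"
proof -
  have "v = ev h + ev [x] + ev g + ev [y] - ev g - ev [x] - ev h"
    using v wval_letter_inv[of X "h @ [x] @ g"]
    by (metis (no_types, lifting) ev_letters wval_append add.assoc add_uminus_conv_diff minus_add)
  moreover have "w = ev h + ev [x] - ev h"
    using w wval_letter_inv[of X h]
    by (metis ev_letters wval_append add.assoc add_uminus_conv_diff)
  ultimately have "- w + v + w = ev (h @ g @ [y] @ inv_word g @ inv_word h)"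
    by (simp only: wval_append wval_letter_inv)
      (simp add: group_norm del: add_uminus_conv_diff)
  then have "len (- w + v + w) \<le> length (h @ g @ [y] @ inv_word g @ inv_word h)"
    by (simp only: len_ev_le)
  moreover have "len v = length (letters v)" by (simp add: len_def)
  ultimately show ?thesis by (simp add: smaller_def v)
qed

text \<open>Both words are conjugates of letters and agree up to and including the centre of
  \<open>w\<close>. The word whose centre lies farther to the left conjugates the other to a shorter
  one; coinciding centres would be the same letter.\<close>

lemma two_conj_reduce:
  assumes v: "letters v = g @ [y] @ inv_word g" "letters v = h @ [x] @ a"
    and w: "letters w = h @ [x] @ inv_word h" and xy: "fst x \<noteq> fst y"
  shows "smaller n (- w + v + w) v \<or> smaller n (- v + w + v) w"
proof -
  have e: "g @ [y] @ inv_word g = h @ [x] @ a" using v by simp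
  consider "length h < length g" | "length h = length g" | "length g < length h" by linarith
  then show ?thesis
  proof cases
    case 1
    have "take (Suc (length h)) (g @ [y] @ inv_word g) = take (Suc (length h)) (h @ [x] @ a)"
      by (simp only: e)
    then have "take (Suc (length h)) g = h @ [x]" using 1 by simp
    then obtain g' where "g = h @ [x] @ g'" by (metis append_take_drop_id append.assoc)
    then show ?thesis using conj_prefix_reduce[OF _ w, of v g' y n] v by auto
  next
    case 2
    then have "y = x" using e by simp
    then show ?thesis using xy by simp
  next
    case 3
    have "take (Suc (length g)) (g @ [y] @ inv_word g) = take (Suc (length g)) (h @ [x] @ a)"
      by (simp only: e)
    then have "g @ [y] = take (Suc (length g)) h" using 3 by simp
    then obtain h' where "h = g @ [y] @ h'" by (metis append_take_drop_id append.assoc)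
    then show ?thesis using conj_prefix_reduce[OF _ v(1), of w h' x n] w by auto
  qed
qed

text \<open>The exchanged prefix is at most half of the word, so the half read from the other end
  stays the same and only one of the two codes changes.\<close>

lemma kappa_less:
  assumes "letters x = p @ a" "letters y = q @ a" "length p = length q"
    "2 * length q \<le> len y" "code n p < code n q"
  shows "smaller n x y"
proof -
  let ?h = "(len y + 1) div 2"
  have l: "len y = length q + length a" "len x = len y" using assms by (simp_all add: len_def)
  have h: "length q \<le> ?h" "?h \<le> length a" using assms(4) l by simp_all
  have t: "take ?h (letters x) = p @ take (?h - length q) a"
    "take ?h (letters y) = q @ take (?h - length q) a"
    using assms h by simp_all
  have t': "take ?h (letters (- x)) = take ?h (letters (- y))"
    using assms h by (simp add: letters_uminus)
  have "kappa n x < kappa n y"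
    unfolding kappa_def l(2) t t' using assms(3,5) by (simp add: code_append)
  then show ?thesis by (simp add: smaller_def l)
qed

text \<open>Exactly half of \<open>v\<close> cancels, so the prefix \<open>p\<close> of
  \<open>w\<close> is traded for the equally long \<open>q\<close>. The length formula for the
  product certifies that the traded word is reduced.\<close>

lemma kappa_half_reduce:
  assumes v: "letters v = p @ inv_word q" "length q = length p" and w: "letters w = p @ b"
    and cp: "cp v w = length p" and le: "2 * length p \<le> len w" and code: "code n q < code n p"
  shows "smaller n (- v + w) w"
proof (rule kappa_less)
  have "v = ev p - ev q" "w = ev p + ev b"
    using v w wval_letter_inv[of X q] by (metis ev_letters wval_append add_uminus_conv_diff)+
  then have e: "- v + w = ev (q @ b)"
    by (simp only: wval_append) (simp add: group_norm del: add_uminus_conv_diff)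
  have "len v = 2 * length p" "len w = length p + length b" using v w by (simp_all add: len_def)
  then have "len (- v + w) = length (q @ b)" using len_minus_add[of v w] cp v(2) by simp
  then show "letters (- v + w) = q @ b" unfolding e len_def by (rule letters_ev_eqI)
qed (use assms in auto)

lemma kappa_conj_reduce:
  assumes v: "letters v = p @ inv_word q" "length q = length p"
    and w: "letters w = p @ h @ [x] @ inv_word (p @ h)" and code: "code n q < code n p"
  shows "smaller n (- v + w + v) w"
proof -
  let ?l = "q @ h @ [x] @ inv_word (q @ h)"
  have "v = ev p - ev q" "w = ev p + ev h + ev [x] - ev h - ev p"
    using v w wval_letter_inv[of X q] wval_letter_inv[of X "p @ h"]
    by (metis (no_types, lifting) ev_letters wval_append add.assoc add_uminus_conv_diff minus_add)+
  then have e: "- v + w + v = ev ?l"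
    unfolding wval_append[of _ q] wval_append[of _ h] wval_append[of _ "[x]"] wval_letter_inv
    by (simp add: wval_append group_norm del: add_uminus_conv_diff)
  have l: "len w = length ?l" using w v by (simp add: len_def)
  have "len (- v + w + v) \<le> length ?l" unfolding e by (rule len_ev_le)
  then consider "len (- v + w + v) < len w" | "len (- v + w + v) = length ?l"
    using l by linarith
  then show ?thesis
  proof cases
    case 2
    have n: "letters (- v + w + v) = ?l" using 2 unfolding e len_def by (rule letters_ev_eqI)
    \<comment> \<open>The rounding up in \<open>kappa\<close> makes both halves begin with
      \<open>p\<close> and reach the central letter, so trading \<open>p\<close> for
      \<open>q\<close> lowers both codes.\<close>
    have h: "(len w + 1) div 2 = length p + length h + 1" using l v(2) by simp
    have "kappa n (- v + w + v) < kappa n w"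
      unfolding kappa_def 2 l[symmetric] h letters_uminus n w
      using code v(2) by (simp add: code_append)
    then show ?thesis using 2 l by (simp add: smaller_def)
  qed (simp add: smaller_def)
qed

text \<open>At a tuple that no move makes smaller, \<open>length_le_len_wval\<close> applies: the
  word that \<open>\<phi>\<close> sends to a letter \<open>x_k\<close> is no longer than
  \<open>x_k\<close>, so the inverse of \<open>\<phi>\<close> is a signed permutation.\<close>

lemma Gam_subset_GG:
  assumes mn: "m \<le> n" and "\<phi> \<in> Conj_Fn n m"
  shows "\<phi> \<in> nielsen_group n m"
  using assms(2)
proof (induction \<phi> rule: wf_induct_rule[OF wf_nielsen_less[of n]])
  case (1 \<phi>)
  show ?case
  proof (rule ccontr)
    assume notin: "\<phi> \<notin> nielsen_group n m"
    have \<phi>: "\<phi> \<in> Conj_Fn n m" by fact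
    then have An: "\<phi> \<in> Aut_Fn n" and cj: "\<And>j. j \<in> {m+1..n} \<Longrightarrow> \<exists>g. app \<phi> (X j) = g + X j - g"
      by (auto simp: Conj_Fn_def)
    define f where "f l = sw (snd l) (app \<phi> (X (fst l)))" for l :: "nat \<times> bool"
    have f_inv: "f (letter_inv l) = - f l" for l by (auto simp: f_def letter_inv_def sw_def)
    have fF: "f l \<in> Fs {1..n}" if "fst l \<in> {1..n}" for l
      using that An_Fs[OF An, of "X (fst l)"] by (simp add: f_def sw_def del: atLeastAtMost_iff)
    have f0: "f l \<noteq> 0" for l
    proof
      assume "f l = 0"
      then have "app \<phi> (X (fst l)) = app \<phi> 0" by (cases l) (auto simp: f_def sw_def split: if_splits)
      then have "letters (X (fst l)) = []" by (simp only: app_inject_iff letters_0)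
      then show False by (simp add: letters_X)
    qed
    have irred: "\<not> smaller n new (f l)"
      if that': "fst k \<in> {1..n}" "fst l \<in> {1..n}" "fst k \<noteq> fst l"
        "new = f k + f l \<and> fst l \<in> {1..m} \<or> new = f k + f l - f k" for k l new
    proof
      assume "smaller n new (f l)"
      obtain \<tau> where \<tau>: "\<tau> \<in> nielsen_group n m" "\<phi> + \<tau> \<in> Conj_Fn n m" "sw (snd l) (app (\<phi> + \<tau>) (X (fst l))) = new"
        "\<And>a. a \<noteq> fst l \<Longrightarrow> app (\<phi> + \<tau>) (X a) = app \<phi> (X a)"
        using nielsen_move[OF mn \<phi> that'(2,1) that'(3)[symmetric], of new "snd k" "snd l"] that'(4)
        unfolding f_def by blast
      then have "(\<phi> + \<tau>, \<phi>) \<in> nielsen_less n"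
        using nielsen_lessI[OF that'(2), of "snd l" "\<phi> + \<tau>" \<phi>] \<open>smaller n new (f l)\<close>
        by (simp add: f_def)
      then have "\<phi> + \<tau> \<in> nielsen_group n m" using 1 \<tau>(2) by blast
      from sgen_diff[OF this \<tau>(1)] show False using notin by simp
    qed
    have irred1: "\<not> smaller n (- f k + f l) (f l)"
      if "fst k \<in> {1..n}" "fst l \<in> {1..m}" "fst k \<noteq> fst l" for k l
      using irred[of "letter_inv k" l "- f k + f l"] that mn by (auto simp: f_inv)
    have irred2: "\<not> smaller n (- f k + f l + f k) (f l)"
      if "fst k \<in> {1..n}" "fst l \<in> {1..n}" "fst k \<noteq> fst l" for k l
      using irred[of "letter_inv k" l "- f k + f l + f k"] that by (auto simp: f_inv)
    have shape: "\<exists>h. letters (f l) = h @ [l] @ inv_word h" if l: "fst l \<in> {1..n}" "fst l \<notin> {1..m}" for l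
    proof -
      obtain j e where le: "l = (j, e)" by (cases l)
      obtain g where "app \<phi> (X j) = g + X j - g" using cj[of j] l le by auto
      then have "f l = g + sw e (X j) - g"
        by (auto simp: f_def le sw_def group_norm simp del: add_uminus_conv_diff)
      then show ?thesis using conj_letters[of g e j] le by simp
    qed
    have half: "2 * cp (f k) (f l) \<le> len (f k)"
      if kl: "fst k \<in> {1..n}" "fst l \<in> {1..n}" "fst k \<noteq> fst l" for k l
    proof (rule ccontr)
      assume "\<not> ?thesis"
      then have gt: "len (f k) < 2 * cp (f k) (f l)" by simp
      obtain p a b where p: "letters (f k) = p @ a" "letters (f l) = p @ b" "length p = cp (f k) (f l)"
        by (rule cp_prefixE[OF order_refl])
      have ap: "length a < length p" using gt p by (simp add: len_def)
      have nl: "fst l \<notin> {1..m}"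
        using irred1[OF kl(1) _ kl(3)] half_reduce[OF gt] by blast
      then obtain h where h: "letters (f l) = h @ [l] @ inv_word h" using shape kl by blast
      \<comment> \<open>Now \<open>l\<close> lies beyond \<open>m\<close>. If the overlap
        \<open>p\<close> ends before the central letter of \<open>f l\<close>, conjugation by
        \<open>f k\<close> shortens \<open>f l\<close>. If it passes that letter, \<open>f l\<close>
        shortens \<open>f k\<close>, or, when \<open>k\<close> lies beyond \<open>m\<close> as well,
        the two conjugates are compared by their centres.\<close>
      show False
      proof (cases "length p \<le> length h")
        case True
        have "take (length p) (h @ [l] @ inv_word h) = take (length p) (p @ b)" using h p by simp
        then have "take (length p) h = p" using True by simp
        then obtain h' where "h = p @ h'" by (metis append_take_drop_id)
        then have "smaller n (- f k + f l + f k) (f l)"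
          using h p ap by (intro conj_reduce) auto
        then show False using irred2 kl by blast
      next
        case False
        have "take (Suc (length h)) (h @ [l] @ inv_word h) = take (Suc (length h)) (p @ b)"
          using h p by simp
        then have "take (Suc (length h)) p = h @ [l]" using False by simp
        then obtain p' where p': "p = h @ [l] @ p'" by (metis append_take_drop_id append.assoc)
        then have lk: "letters (f k) = h @ [l] @ (p' @ a)" using p by simp
        show False
        proof (cases "fst k \<in> {1..m}")
          case True
          then show False
            using irred1[of l k] beyond_centre_reduce[OF lk h, of n] kl by auto
        next
          case False
          then obtain g where "letters (f k) = g @ [k] @ inv_word g" using shape kl by blast
          from two_conj_reduce[OF this lk h, of n] kl
          show False using irred2[of l k] irred2[of k l] by auto
        qed
      qed
    qed
    have code_half: "\<not> code n q < code n p"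
      if kl: "fst k \<in> {1..n}" "fst l \<in> {1..n}" "fst k \<noteq> fst l"
        and p: "letters (f k) = p @ inv_word q" "length q = length p" "letters (f l) = p @ b" for k l p q b
    proof
      assume lt: "code n q < code n p"
      have lk: "len (f k) = 2 * length p" using p by (simp add: len_def)
      have "length p \<le> cp (f k) (f l)" using p by (intro cp_prefixI)
      then have cp: "cp (f k) (f l) = length p" using half[OF kl] lk by linarith
      have le: "2 * length p \<le> len (f l)"
        using half[of l k] kl cp by (simp add: cp_commute)
      have nl: "fst l \<notin> {1..m}"
        using irred1[OF kl(1) _ kl(3)] kappa_half_reduce[OF p cp le lt] by blast
      then obtain h where h: "letters (f l) = h @ [l] @ inv_word h" using shape kl by blast
      \<comment> \<open>The length is odd, so an overlap of at most half of it stops before the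
        central letter.\<close>
      have "len (f l) = 2 * length h + 1" using h by (simp add: len_def)
      then have "length p \<le> length h" using le by simp
      moreover have "take (length p) (h @ [l] @ inv_word h) = take (length p) (p @ b)" using h p by simp
      ultimately have "take (length p) h = p" by simp
      then obtain h' where "h = p @ h'" by (metis append_take_drop_id)
      then have "smaller n (- f k + f l + f k) (f l)"
        using h p lt by (intro kappa_conj_reduce) auto
      then show False using irred2 kl by blast
    qed
    have half': "2 * cp (- f k) (f l) \<le> len (f k)" "2 * cp (- f k) (f l) \<le> len (f l)"
      "fst k = fst l \<Longrightarrow> 2 * cp (- f k) (f l) < len (f l)"
      if "fst k \<in> {1..n}" "fst l \<in> {1..n}" "l \<noteq> letter_inv k" for k l
    proof -
      have "2 * cp (- f k) (f l) \<le> len (f k) \<and> 2 * cp (- f k) (f l) \<le> len (f l) \<and>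
        (fst k = fst l \<longrightarrow> 2 * cp (- f k) (f l) < len (f l))"
      proof (cases "fst k = fst l")
        case True
        then have "l = k" using that(3) by (cases k; cases l) (auto simp: letter_inv_def)
        then show ?thesis using cp_uminus_self[OF f0, of k] by simp
      next
        case False
        then show ?thesis
          using half[of "letter_inv k" l] half[of l "letter_inv k"] that
          by (simp add: f_inv cp_commute[of "f l"])
      qed
      then show "2 * cp (- f k) (f l) \<le> len (f k)" "2 * cp (- f k) (f l) \<le> len (f l)"
        "fst k = fst l \<Longrightarrow> 2 * cp (- f k) (f l) < len (f l)" by auto
    qed
    have both: "cp (- f j) (f k) + cp (- f k) (f l) < len (f k)"
      if A: "fst j \<in> {1..n}" "fst k \<in> {1..n}" "fst l \<in> {1..n}"
        and jk: "k \<noteq> letter_inv j" and kl: "l \<noteq> letter_inv k" for j k l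
    proof (rule ccontr)
      assume "\<not> ?thesis"
      then have ge: "len (f k) \<le> cp (- f j) (f k) + cp (- f k) (f l)" by simp
      note h1 = half'(2,3)[OF A(1,2) jk] and h2 = half'(1,3)[OF A(2,3) kl]
      have e1: "2 * cp (- f j) (f k) = len (f k)" and e2: "2 * cp (- f k) (f l) = len (f k)"
        using h1 h2 ge by linarith+
      have jk': "fst j \<noteq> fst k" using h1(2) e1 by auto
      have kl': "fst k \<noteq> fst l"
      proof
        assume "fst k = fst l"
        then have "f l = f k" using kl by (cases k; cases l) (auto simp: letter_inv_def)
        then show False using cp_uminus_self[OF f0, of k] e2 by simp
      qed
      obtain p a b where p: "letters (- f j) = p @ a" "letters (f k) = p @ b"
        "length p = cp (- f j) (f k)"
        by (rule cp_prefixE[OF order_refl])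
      obtain q c d where q: "letters (- f k) = q @ c" "letters (f l) = q @ d"
        "length q = cp (- f k) (f l)"
        by (rule cp_prefixE[OF order_refl])
      have pq: "length q = length p" using p q e1 e2 by simp
      have lb: "length b = length p" using p e1 by (simp add: len_def)
      have "inv_word b @ inv_word p = q @ c"
        using p(2) q(1) by (simp add: letters_uminus)
      then have iq: "inv_word b = q" "inv_word p = c" using lb pq by (simp_all add: append_eq_append_conv)
      have b: "b = inv_word q" unfolding iq(1)[symmetric] by simp
      \<comment> \<open>Here \<open>f k\<close> is \<open>p\<close> followed by the inverse of
        \<open>q\<close>, and each half is cancelled by one neighbour. Applying
        \<open>code_half\<close> to \<open>f k\<close> and to its inverse forces equal codes, hence
        \<open>p = q\<close> and \<open>f k\<close> trivial.\<close>
      have "\<not> code n q < code n p"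
        using code_half[of k "letter_inv j" p q a] p(1,2) pq jk' A b by (simp add: f_inv)
      moreover have "\<not> code n p < code n q"
        using code_half[of "letter_inv k" l q p d] q(1,2) pq kl' A iq(2) by (simp add: f_inv)
      moreover have "fst ` set p \<subseteq> {1..n}" "fst ` set q \<subseteq> {1..n}"
        using fF[OF A(2)] fF[OF A(3)] p(2) q(2) by (auto simp: Fs_def)
      ultimately have "p = q" using pq by (intro code_inj[of p q n]) auto
      then have "f k = ev p + - ev p"
        using p(2) b by (metis ev_letters wval_append wval_letter_inv)
      then show False using f0 by simp
    qed
    have "\<exists>l. fst l \<in> {1..n} \<and> app (- \<phi>) (X k) = sw (snd l) (X (fst l))" if k: "k \<in> {1..n}" for k
    proof -
      define y where "y = app (- \<phi>) (X k)"
      have y: "y \<in> Fs {1..n}" using k An by (auto simp: y_def Aut_Fn_def)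
      have "hom_f (fhom (\<lambda>a. app \<phi> (X a)))" by (rule hom_f_fhom)
      then have "app \<phi> y = fhom (\<lambda>a. app \<phi> (X a)) y"
        by (rule hom_f_eqI[OF app_hom]) simp
      then have "X k = wval (\<lambda>a. app \<phi> (X a)) (letters y)" by (simp add: y_def fhom_def)
      moreover have "length (letters y) \<le> len (wval (\<lambda>a. app \<phi> (X a)) (letters y))"
      proof (rule length_le_len_wval[where A = "{1..n}"], fold f_def)
        show "fst ` set (letters y) \<subseteq> {1..n}" using y by (simp add: Fs_def)
      qed (use f0 half' both in auto)
      moreover have "len (X k) = 1" by (simp add: len_def letters_X)
      ultimately have "length (letters y) \<le> 1" by simp
      moreover have "letters y \<noteq> []"
      proof
        assume "letters y = []"
        then have "y = 0" by (metis ev_letters wval_Nil)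
        then have "app \<phi> y = 0" by simp
        then have "letters (X k) = []" by (simp add: y_def)
        then show False by (simp add: letters_X)
      qed
      ultimately obtain l where l: "letters y = [l]" by (cases "letters y") auto
      then have "y = ev [l]" by (metis ev_letters)
      then have "y = sw (snd l) (X (fst l))" by (simp add: wval_Cons sw_def)
      moreover have "fst l \<in> {1..n}" using y l by (auto simp: Fs_def)
      ultimately show ?thesis by (auto simp: y_def)
    qed
    then obtain L where L: "\<And>k. k \<in> {1..n} \<Longrightarrow> fst (L k) \<in> {1..n}"
      "\<And>k. k \<in> {1..n} \<Longrightarrow> app (- \<phi>) (X k) = sw (snd (L k)) (X (fst (L k)))" by metis
    define \<sigma> where "\<sigma> k = (if k \<in> {1..n} then fst (L k) else k)" for k
    define \<epsilon> where "\<epsilon> k = (k \<in> {1..n} \<longrightarrow> snd (L k))" for k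
    have eq: "app (- \<phi>) (X k) = sw (\<epsilon> k) (X (\<sigma> k))" for k
      using L(2) An An_uminus[OF An] by (auto simp: \<sigma>_def \<epsilon>_def Aut_Fn_def)
    have "inj \<sigma>"
    proof (rule injI)
      fix a b assume "\<sigma> a = \<sigma> b"
      then have "app (- \<phi>) (X a) = app (- \<phi>) (X b) \<or> app (- \<phi>) (X a) = app (- \<phi>) (- X b)"
        by (simp only: eq app_uminus) (auto simp: sw_def)
      then have "X a = X b \<or> X a = - X b" by (simp only: app_inject_iff)
      then have "letters (X a) = letters (X b) \<or> letters (X a) = letters (- X b)" by auto
      then show "a = b" by (simp add: letters_X letters_minus_X)
    qed
    moreover have "surj \<sigma>"
    proof -
      have "\<sigma> ` {1..n} = {1..n}"
      proof (rule endo_inj_surj)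
        show "\<sigma> ` {1..n} \<subseteq> {1..n}" using L(1) by (auto simp only: \<sigma>_def if_True)
        show "inj_on \<sigma> {1..n}" using \<open>inj \<sigma>\<close> by (rule inj_on_subset) simp
      qed simp
      moreover have "\<sigma> l = l" if "l \<notin> {1..n}" for l using that by (simp only: \<sigma>_def if_False)
      ultimately have "l \<in> range \<sigma>" for l by (cases "l \<in> {1..n}") (blast, metis rangeI)
      then show ?thesis by blast
    qed
    ultimately have "signed_perm \<sigma> \<epsilon> (- \<phi>)" using eq by (simp add: signed_perm_def bij_def)
    moreover have "\<sigma> l = l \<and> \<epsilon> l" if "l \<notin> {1..m}" for l
    proof (cases "l \<in> {1..n}")
      case True
      then obtain g where "app \<phi> (X l) = g + X l - g" using cj[of l] \<open>l \<notin> {1..m}\<close> by auto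
      then have "app (- \<phi>) (app \<phi> (X l)) = app (- \<phi>) (g + X l - g)" by simp
      then have "X l = app (- \<phi>) g + app (- \<phi>) (X l) - app (- \<phi>) g" by (simp only: app_uminus_app app_add app_diff)
      \<comment> \<open>Conjugation keeps exponent sums, so the signed letter can only be
        \<open>x_l\<close> itself.\<close>
      then have "ab (X l) l = ab (app (- \<phi>) (X l)) l" by (metis ab_add ab_diff add_diff_cancel_left')
      then show ?thesis unfolding eq by (cases "\<epsilon> l") (auto split: if_splits)
    qed (auto simp: \<sigma>_def \<epsilon>_def)
    ultimately have "- \<phi> \<in> signed_perms {1..m}" unfolding signed_perms_def by blast
    then have "- \<phi> \<in> nielsen_group n m" by (intro sgen_base) (simp add: nielsen_gens_def)
    then show False using notin sgen_uminus_iff by blast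
  qed
qed

section \<open>The action on the abelianisation\<close>

lemma N_An:
  assumes "m \<le> n" "\<phi> \<in> magnus_group n m"
  shows "\<phi> \<in> Aut_Fn n"
  using assms(2)
proof (induction rule: sgen.induct)
  case zero
  show ?case by (simp add: Aut_Fn_def)
next
  case (plus b x)
  have "b \<in> Aut_Fn n" using plus(1) assms(1) by (auto simp: magnus_gens_def intro!: tr_An)
  then show ?case using plus by (intro An_add)
next
  case (minus b x)
  have "b \<in> Aut_Fn n" using minus(1) assms(1) by (auto simp: magnus_gens_def intro!: tr_An)
  then show ?case using minus by (intro An_add An_uminus)
qed

lemma SP_An:
  assumes "A \<subseteq> {1..n}" "\<phi> \<in> signed_perms A"
  shows "\<phi> \<in> Aut_Fn n"
proof -
  have *: "app \<psi> x \<in> Fs {1..n}" if \<psi>: "\<psi> \<in> signed_perms A" and x: "x \<in> Fs {1..n}" for \<psi> x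
  proof (rule app_Fs[OF x])
    obtain \<sigma> \<epsilon> where s: "signed_perm \<sigma> \<epsilon> \<psi>" and o: "\<And>l. l \<notin> A \<Longrightarrow> \<sigma> l = l \<and> \<epsilon> l"
      using \<psi> unfolding signed_perms_def by blast
    fix a assume a: "a \<in> {1..n}"
    have "\<sigma> a \<in> {1..n}"
    proof (rule ccontr)
      assume "\<sigma> a \<notin> {1..n}"
      then have "\<sigma> (\<sigma> a) = \<sigma> a" using o assms(1) by blast
      then have "\<sigma> a = a" using s by (simp add: signed_perm_def bij_is_inj inj_eq)
      then show False using a \<open>\<sigma> a \<notin> {1..n}\<close> by simp
    qed
    then show "app \<psi> (X a) \<in> Fs {1..n}"
      using s by (simp add: signed_perm_def sw_def del: atLeastAtMost_iff)
  qed
  have "app \<phi> (X l) = X l" if "l \<notin> {1..n}" for l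
    using assms that unfolding signed_perms_def signed_perm_def by fastforce
  then show ?thesis using *[OF assms(2)] *[OF SP_uminus[OF assms(2)]] by (simp add: Aut_Fn_def)
qed

lemma sgen_An:
  assumes "\<And>b. b \<in> B \<Longrightarrow> b \<in> Aut_Fn n" "\<phi> \<in> sgen B"
  shows "\<phi> \<in> Aut_Fn n"
  using assms(2)
proof (induction rule: sgen.induct)
  case zero
  show ?case by (simp add: Aut_Fn_def)
qed (use assms(1) in \<open>auto intro: An_add An_uminus\<close>)

lemma GG_An:
  assumes "m \<le> n" "\<phi> \<in> nielsen_group n m"
  shows "\<phi> \<in> Aut_Fn n"
proof (rule sgen_An[OF _ assms(2)])
  fix b assume "b \<in> nielsen_gens n m"
  then consider "b \<in> magnus_gens n m" | i j where "b = E i j" "i \<in> {1..m}" "j \<in> {1..n}" "i \<noteq> j"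
    | "b \<in> signed_perms {1..m}" unfolding nielsen_gens_def by blast
  then show "b \<in> Aut_Fn n"
  proof cases
    case 1
    then show ?thesis using N_An assms(1) sgen_base by blast
  next
    case 2
    then show ?thesis unfolding E_def using assms(1) by (auto intro!: tr_An)
  next
    case 3
    then show ?thesis using SP_An[of "{1..m}" n] assms(1) by auto
  qed
qed

lemma GG_conj_N:
  assumes mn: "m \<le> n" and q: "q \<in> nielsen_group n m" and x: "x \<in> magnus_group n m"
  shows "q + x - q \<in> magnus_group n m"
proof -
  have *: "b + x - b \<in> magnus_group n m \<and> - b + x + b \<in> magnus_group n m" if "b \<in> nielsen_gens n m" "x \<in> magnus_group n m" for b x
  proof -
    from that(1) consider "b \<in> magnus_gens n m" | i j where "b = E i j" "i \<in> {1..m}" "j \<in> {1..n}" "i \<noteq> j"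
      | "b \<in> signed_perms {1..m}" unfolding nielsen_gens_def by blast
    then show ?thesis
    proof cases
      case 1
      then show ?thesis using that(2) by (meson sgen_base sgen_add sgen_diff sgen_uminus)
    next
      case 2
      then show ?thesis using E_conj_N E_uminus_conj_N mn that(2) by blast
    next
      case 3
      have "\<psi> + x - \<psi> \<in> magnus_group n m" if \<psi>: "\<psi> \<in> signed_perms {1..m}" for \<psi>
      proof -
        obtain \<sigma> \<epsilon> where s: "signed_perm \<sigma> \<epsilon> \<psi>" and o: "\<And>l. l \<notin> {1..m} \<Longrightarrow> \<sigma> l = l \<and> \<epsilon> l"
          using \<psi> unfolding signed_perms_def by blast
        have "\<sigma> ` {1..m} \<subseteq> {1..m}"
        proof
          fix y assume "y \<in> \<sigma> ` {1..m}"
          then obtain a where a: "a \<in> {1..m}" "y = \<sigma> a" by blast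
          show "y \<in> {1..m}"
          proof (rule ccontr)
            assume n: "y \<notin> {1..m}"
            then have "\<sigma> y = \<sigma> a" using o a by simp
            then have "y = a" using s by (simp add: signed_perm_def bij_is_inj inj_eq)
            then show False using a n by simp
          qed
        qed
        moreover from this o mn have "\<sigma> ` {1..n} \<subseteq> {1..n}" by fastforce
        ultimately show ?thesis using signed_perm_conj_N[OF s _ _ mn \<open>x \<in> magnus_group n m\<close>] by simp
      qed
      from this[OF 3] this[OF SP_uminus[OF 3]] show ?thesis by simp
    qed
  qed
  show ?thesis using q x
  proof (induction arbitrary: x rule: sgen.induct)
    case (plus b y)
    have "b + (y + x - y) - b \<in> magnus_group n m" using * plus by blast
    then show ?case by (simp add: group_norm del: add_uminus_conv_diff)
  next
    case (minus b y)
    have "- b + (y + x - y) + b \<in> magnus_group n m" using * minus by blast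
    then show ?case by (simp add: group_norm del: add_uminus_conv_diff)
  qed simp
qed

section \<open>The action on exponent vectors\<close>

definition act :: "nat \<Rightarrow> aut \<Rightarrow> (nat \<Rightarrow> int) \<Rightarrow> nat \<Rightarrow> int" where
  "act n \<phi> v a = (\<Sum>i\<in>{1..n}. v i * ab (app \<phi> (X i)) a)"

lemma ab_app:
  assumes "x \<in> Fs {1..n}"
  shows "ab (app \<phi> x) = act n \<phi> (ab x)"
  using assms
proof (induction rule: Fs_induct)
  case zero
  show ?case by (simp add: act_def fun_eq_iff)
next
  case (plus b x)
  have "(\<Sum>i\<in>{1..n}. ab (X b) i * ab (app \<phi> (X i)) a) = ab (app \<phi> (X b)) a" for a
    using plus(1) by (simp add: sum.delta if_distrib[of "\<lambda>z. z * _"] cong: if_cong)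
  then show ?case using plus(3) by (simp add: act_def fun_eq_iff algebra_simps sum.distrib)
next
  case (minus b x)
  have "(\<Sum>i\<in>{1..n}. ab (X b) i * ab (app \<phi> (X i)) a) = ab (app \<phi> (X b)) a" for a
    using minus(1) by (simp add: sum.delta if_distrib[of "\<lambda>z. z * _"] cong: if_cong)
  then show ?case using minus(3)
    by (simp add: act_def fun_eq_iff algebra_simps sum.distrib sum_subtractf)
qed

lemma act_add:
  assumes "\<psi> \<in> Aut_Fn n"
  shows "act n (\<phi> + \<psi>) v = act n \<phi> (act n \<psi> v)"
proof
  fix a
  have "act n (\<phi> + \<psi>) v a = (\<Sum>k\<in>{1..n}. v k * act n \<phi> (ab (app \<psi> (X k))) a)"
    unfolding act_def[of n "\<phi> + \<psi>"]
  proof (rule sum.cong[OF refl])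
    fix k assume "k \<in> {1..n}"
    then have "app \<psi> (X k) \<in> Fs {1..n}" by (intro An_Fs[OF assms]) simp
    then show "v k * ab (app (\<phi> + \<psi>) (X k)) a = v k * act n \<phi> (ab (app \<psi> (X k))) a"
      by (simp only: app_plus_aut ab_app)
  qed
  also have "\<dots> = (\<Sum>k\<in>{1..n}. \<Sum>i\<in>{1..n}. v k * ab (app \<psi> (X k)) i * ab (app \<phi> (X i)) a)"
    by (simp add: act_def sum_distrib_left mult.assoc)
  also have "\<dots> = (\<Sum>i\<in>{1..n}. \<Sum>k\<in>{1..n}. v k * ab (app \<psi> (X k)) i * ab (app \<phi> (X i)) a)"
    by (rule sum.swap)
  also have "\<dots> = act n \<phi> (act n \<psi> v) a"
    by (simp add: act_def sum_distrib_right)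
  finally show "act n (\<phi> + \<psi>) v a = act n \<phi> (act n \<psi> v) a" .
qed

definition supp :: "nat \<Rightarrow> (nat \<Rightarrow> int) \<Rightarrow> bool" where
  "supp n v \<longleftrightarrow> (\<forall>a. a \<notin> {1..n} \<longrightarrow> v a = 0)"

lemma act_cong_ab:
  assumes "\<And>i. i \<in> {1..n} \<Longrightarrow> ab (app \<phi> (X i)) = ab (app \<psi> (X i))"
  shows "act n \<phi> v = act n \<psi> v"
  using assms by (simp add: act_def fun_eq_iff)

lemma act_0: "supp n v \<Longrightarrow> act n 0 v = v"
  by (auto simp: act_def fun_eq_iff supp_def sum.delta' if_distrib[of "\<lambda>z. _ * z"] cong: if_cong)

lemma act_uminus:
  assumes "\<phi> \<in> Aut_Fn n" "supp n v"
  shows "act n (- \<phi>) (act n \<phi> v) = v"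
  using act_add[OF assms(1), of "- \<phi>" v] act_0[OF assms(2)] by simp

lemma N_ab:
  assumes "m \<le> n" "\<phi> \<in> magnus_group n m"
  shows "ab (app \<phi> x) = ab x"
proof -
  have b: "ab (app b z) = ab z" if "b \<in> magnus_gens n m" for b z
  proof -
    have "ab (app b (X l)) a = ab (X l) a" for l a
      using that by (auto simp: magnus_gens_def app_tr)
    then show ?thesis
      by (induction z rule: fword_induct) (auto simp: fun_eq_iff)
  qed
  show ?thesis using assms(2)
  proof (induction arbitrary: x rule: sgen.induct)
    case (plus b y)
    show ?case using plus b[OF plus(1)] by simp
  next
    case (minus b y)
    have "ab (app (- b) z) = ab z" for z
      using b[OF minus(1), of "app (- b) z"] by simp
    then show ?case using minus by simp
  qed simp
qed

lemma act_N:
  assumes "m \<le> n" "\<phi> \<in> magnus_group n m" "supp n v"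
  shows "act n \<phi> v = v"
proof -
  have "act n \<phi> v = act n 0 v"
    by (rule act_cong_ab) (use N_ab[OF assms(1,2)] in simp)
  then show ?thesis using assms(3) by (simp add: act_0)
qed

lemma supp_act: "\<phi> \<in> Aut_Fn n \<Longrightarrow> supp n (act n \<phi> v)"
  unfolding supp_def act_def
  by (intro allI impI sum.neutral ballI) (simp add: ab_outside[OF An_Fs] del: atLeastAtMost_iff)

text \<open>Any \<open>c\<close> other than \<open>1\<close> gives the inverse transvection, so
  \<open>c\<close> is meaningful only as a sign.\<close>

definition EE :: "nat \<Rightarrow> nat \<Rightarrow> int \<Rightarrow> aut" where
  "EE i j c = tr i 0 (sw (c = 1) (X j))"

definition move_vec :: "nat \<Rightarrow> nat \<Rightarrow> int \<Rightarrow> (nat \<Rightarrow> int) \<Rightarrow> nat \<Rightarrow> int" where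
  "move_vec i j c v = v(j := v j + c * v i)"

lemma app_EE: "i \<noteq> j \<Longrightarrow> app (EE i j c) (X l) = (if l = i then X i + sw (c = 1) (X j) else X l)"
  by (simp add: EE_def app_tr sw_def)

lemma EE_E: "i \<noteq> j \<Longrightarrow> EE i j 1 = E i j" "i \<noteq> j \<Longrightarrow> EE i j (-1) = - E i j"
  by (simp_all add: EE_def E_def tr_uminus)

lemma EE_uminus: "i \<noteq> j \<Longrightarrow> c = 1 \<or> c = -1 \<Longrightarrow> - EE i j c = EE i j (- c)"
  by (auto simp: EE_E)

lemma act_EE:
  assumes ij: "i \<in> {1..n}" "j \<in> {1..n}" "i \<noteq> j" and c: "c = 1 \<or> c = -1" and v: "supp n v"
  shows "act n (EE i j c) v = move_vec i j c v"
proof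
  fix a
  have "act n (EE i j c) v a
      = (\<Sum>l\<in>{1..n}. v l * ab (X l) a + (if l = i then v i * (c * ab (X j) a) else 0))"
    unfolding act_def
    by (rule sum.cong) (use ij c in \<open>auto simp: app_EE algebra_simps simp del: ab_X\<close>)
  also have "\<dots> = act n 0 v a + v i * (c * ab (X j) a)"
    using ij(1) by (simp add: sum.distrib act_def del: ab_X)
  finally show "act n (EE i j c) v a = move_vec i j c v a"
    using v by (auto simp: act_0 move_vec_def)
qed

lemma act_signed_perm:
  assumes s: "signed_perm \<sigma> \<epsilon> \<phi>" and o: "\<And>l. l \<notin> {1..n} \<Longrightarrow> \<sigma> l = l" and v: "supp n v"
  shows "act n \<phi> v (\<sigma> l) = sw (\<epsilon> l) (v l)"
proof -
  have b: "inj \<sigma>" using s by (simp add: signed_perm_def bij_is_inj)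
  have "act n \<phi> v (\<sigma> l) = (\<Sum>i\<in>{1..n}. if i = l then sw (\<epsilon> l) (v l) else 0)"
    unfolding act_def
    by (rule sum.cong) (use s b in \<open>auto simp: signed_perm_def sw_def inj_eq\<close>)
  then show ?thesis using v by (auto simp: supp_def sw_def)
qed

section \<open>The norm of an exponent vector\<close>

definition nrm :: "nat \<Rightarrow> (nat \<Rightarrow> int) \<Rightarrow> int" where
  "nrm n v = (\<Sum>a\<in>{1..n}. \<bar>v a\<bar>)"

lemma nrm_mvv: "j \<in> {1..n} \<Longrightarrow> nrm n (move_vec i j c v) = nrm n v - \<bar>v j\<bar> + \<bar>v j + c * v i\<bar>"
  unfolding nrm_def move_vec_def
  by (subst (1 2) sum.remove[of _ j]) (auto intro!: sum.cong)

lemma nrm_ge: "a \<in> {1..n} \<Longrightarrow> \<bar>v a\<bar> \<le> nrm n v"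
  unfolding nrm_def by (rule member_le_sum) auto

lemma nrm_nonneg: "0 \<le> nrm n v"
  by (simp add: nrm_def sum_nonneg)

lemma nrm_ge2:
  assumes "a \<in> {1..n}" "b \<in> {1..n}" "a \<noteq> b"
  shows "\<bar>v a\<bar> + \<bar>v b\<bar> \<le> nrm n v"
proof -
  have "(\<Sum>a\<in>{a, b}. \<bar>v a\<bar>) \<le> nrm n v"
    unfolding nrm_def by (rule sum_mono2) (use assms in auto)
  then show ?thesis using assms by simp
qed

section \<open>Steinberg relations modulo the Magnus automorphisms\<close>

definition is_move :: "nat \<Rightarrow> nat \<Rightarrow> nat \<Rightarrow> nat \<Rightarrow> int \<Rightarrow> bool" where
  "is_move n m i j c \<longleftrightarrow> i \<in> {1..m} \<and> j \<in> {1..n} \<and> i \<noteq> j \<and> (c = 1 \<or> c = -1)"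

lemma is_move_uminus: "is_move n m i j c \<Longrightarrow> is_move n m i j (- c)"
  by (auto simp: is_move_def)

lemma EE_GG:
  assumes "m \<le> n" "is_move n m i j c"
  shows "EE i j c \<in> nielsen_group n m"
  unfolding EE_def using assms by (intro tr_GG) (auto simp: is_move_def)

text \<open>How relations are verified modulo \<open>N\<close>: both sides agree on the basis except
  for a factor \<open>d\<close> with vanishing exponent sums at one letter. They are phrased as a
  detour minus the move that it replaces, the form used in peak reduction.\<close>

lemma tr_diff_mem_N:
  assumes "m \<le> n" "p \<in> {1..m}" "d \<in> Fs ({1..n} - {p})" "\<And>a. ab d a = 0" "q = tr p 0 d + q'"
  shows "q - q' \<in> magnus_group n m"
  using assms tr_comm_N[of p m n 0 d] by simp

lemma rel_commute:
  assumes mn: "m \<le> n" and s: "is_move n m i j a" and t: "is_move n m k l b" and "i \<noteq> l" "j \<noteq> k"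
  shows "EE k l (- b) + (EE i j a + EE k l b) - EE i j a \<in> magnus_group n m"
proof (cases "i = k")
  case True
  let ?x = "sw (a = 1) (X j)" and ?y = "sw (b = 1) (X l)"
  have F: "?x \<in> Fs ({1..n} - {i})" "?y \<in> Fs ({1..n} - {i})"
    using s t True by (auto simp: is_move_def sw_def)
  have "EE k l (- b) = tr i 0 (- ?y)" using t True by (auto simp: EE_def is_move_def)
  then have "EE k l (- b) + (EE i j a + EE k l b) - EE i j a = tr i 0 (- ?y + (?x + ?y) - ?x)"
    using True F[THEN Fs_Compl] tr_uminus[of 0 i ?x]
    by (simp add: EE_def tr_add diff_conv_add_uminus del: add_uminus_conv_diff)
  moreover have "tr i 0 (- ?y + (?x + ?y) - ?x) \<in> magnus_group n m"
    using s F by (intro tr_comm_N mn) (auto simp: is_move_def)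
  ultimately show ?thesis by simp
next
  case False
  have "EE i j a + EE k l b = EE k l b + EE i j a"
    using assms(4,5) s t False by (intro aut_eqI) (auto simp: app_EE is_move_def sw_def)
  then show ?thesis using t by (simp add: EE_uminus[symmetric] is_move_def sgen.zero)
qed

text \<open>This and the next three lemmas are the Steinberg relation saying that the commutator of
  transvections from \<open>p\<close> to \<open>q\<close> and from \<open>q\<close> to
  \<open>r\<close> is one from \<open>p\<close> to \<open>r\<close>. They differ in the factor with
  which the detour starts and in the factor that it replaces, one form for each shape of
  peak.\<close>

lemma rel_same_target1:
  assumes mn: "m \<le> n" and i: "is_move n m i j a" and k: "is_move n m k i c" and "j \<noteq> k"
  shows "EE k i (- c) + (EE i j a + (EE k i c + EE k j (- a * c))) - EE i j a \<in> magnus_group n m"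
proof (rule tr_diff_mem_N[OF mn])
  let ?d' = "- sw (c = 1) (X i) + sw (c = 1) (X i + sw (a = 1) (X j)) + sw (a * c \<noteq> 1) (X j)"
  show "k \<in> {1..m}" "?d' \<in> Fs ({1..n} - {k})" "\<And>c. ab ?d' c = 0"
    using assms by (auto simp: is_move_def sw_def)
  show "EE k i (- c) + (EE i j a + (EE k i c + EE k j (- a * c))) = tr k 0 ?d' + EE i j a"
    using assms unfolding is_move_def
    by (intro aut_eqI)
      (elim conjE disjE; auto simp: app_EE app_tr group_norm simp del: add_uminus_conv_diff)
qed

lemma rel_same_target2:
  assumes mn: "m \<le> n" and k: "is_move n m k j b" and i: "is_move n m i k c" and "i \<noteq> j"
  shows "EE i k (- c) + (EE k j (- b) + (EE i k c + EE k j b)) - EE i j (- b * c) \<in> magnus_group n m"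
proof (rule tr_diff_mem_N[OF mn])
  let ?d = "- sw (c = 1) (X k) + sw (c = 1) (X k - sw (b = 1) (X j)) + sw (b * c = 1) (X j)"
  show "i \<in> {1..m}" "?d \<in> Fs ({1..n} - {i})" "\<And>c. ab ?d c = 0"
    using assms by (auto simp: is_move_def sw_def)
  show "EE i k (- c) + (EE k j (- b) + (EE i k c + EE k j b)) = tr i 0 ?d + EE i j (- b * c)"
    using assms unfolding is_move_def
    by (intro aut_eqI)
      (elim conjE disjE; auto simp: app_EE app_tr group_norm simp del: add_uminus_conv_diff)
qed

lemma rel_chain1:
  assumes mn: "m \<le> n" and p: "is_move n m p q b" and q: "is_move n m q r a" and "p \<noteq> r"
  shows "EE p q (- b) + (EE p r (- a * b) + (EE q r a + EE p q b)) - EE q r a \<in> magnus_group n m"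
proof (rule tr_diff_mem_N[OF mn])
  let ?d = "- sw (b = 1) (X q) + sw (a * b \<noteq> 1) (X r) + sw (b = 1) (X q + sw (a = 1) (X r))"
  show "p \<in> {1..m}" "?d \<in> Fs ({1..n} - {p})" "\<And>c. ab ?d c = 0"
    using assms by (auto simp: is_move_def sw_def)
  show "EE p q (- b) + (EE p r (- a * b) + (EE q r a + EE p q b)) = tr p 0 ?d + EE q r a"
    using assms unfolding is_move_def
    by (intro aut_eqI)
      (elim conjE disjE; auto simp: app_EE app_tr group_norm simp del: add_uminus_conv_diff)
qed

lemma rel_chain2:
  assumes mn: "m \<le> n" and p: "is_move n m p q b" and q: "is_move n m q r a" and "p \<noteq> r"
  shows "EE q r (- a) + (EE p r (a * b) + (EE p q b + EE q r a)) - EE p q b \<in> magnus_group n m"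
proof (rule tr_diff_mem_N[OF mn])
  let ?d = "sw (a * b = 1) (X r) + sw (b = 1) (X q - sw (a = 1) (X r)) - sw (b = 1) (X q)"
  show "p \<in> {1..m}" "?d \<in> Fs ({1..n} - {p})" "\<And>c. ab ?d c = 0"
    using assms by (auto simp: is_move_def sw_def)
  show "EE q r (- a) + (EE p r (a * b) + (EE p q b + EE q r a)) = tr p 0 ?d + EE p q b"
    using assms unfolding is_move_def
    by (intro aut_eqI)
      (elim conjE disjE; auto simp: app_EE app_tr group_norm simp del: add_uminus_conv_diff)
qed

lemma SP_subset_GG: "signed_perms {1..m} \<subseteq> nielsen_group n m"
  by (auto simp: nielsen_gens_def intro: sgen_base)

text \<open>The identity of the Weyl element in \<open>SL_2\<close>: two opposite transvections are
  exchanged at the price of a signed transposition \<open>w\<close>.\<close>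

lemma rel_opposite:
  assumes mn: "m \<le> n" and s: "is_move n m i j a" and j: "j \<in> {1..m}"
  shows "\<exists>w\<in>signed_perms {1..m}. EE j i a + (w + EE j i a) - EE i j a \<in> magnus_group n m"
proof -
  have ij: "i \<noteq> j" "i \<in> {1..m}" using s by (auto simp: is_move_def)
  define \<sigma> where "\<sigma> = id(i := j, j := i)"
  define \<epsilon> where "\<epsilon> l = (if l = i then a = 1 else if l = j then a \<noteq> 1 else True)" for l
  have inv: "\<sigma> (\<sigma> x) = x" for x by (simp add: \<sigma>_def)
  have "bij \<sigma>" by (rule o_bij[of \<sigma>]) (simp_all add: fun_eq_iff inv)
  then obtain w where w: "signed_perm \<sigma> \<epsilon> w" using ex_signed_perm by blast
  have aw: "app w (X l) = (if l = i then sw (a = 1) (X j) else if l = j then sw (a \<noteq> 1) (X i) else X l)" for l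
    using w ij by (simp add: signed_perm_def \<sigma>_def \<epsilon>_def)
  have wS: "w \<in> signed_perms {1..m}"
    unfolding signed_perms_def using w ij j by (auto simp: \<sigma>_def \<epsilon>_def intro!: exI[of _ \<sigma>] exI[of _ \<epsilon>])
  have XX: "tr j (sw e (X i)) (- sw e (X i)) \<in> magnus_group n m" for e
    using ij j mn by (intro tr_conj_N) (auto simp: sw_def)
  consider "a = 1" | "a = -1" using s by (auto simp: is_move_def)
  then have "EE j i a + (w + EE j i a) - EE i j a \<in> magnus_group n m"
  proof cases
    case 1
    have "EE j i a + (w + EE j i a) = tr j (- X i) (X i) + EE i j a"
      using ij 1 by (intro aut_eqI)
        (auto simp: app_EE app_tr aw group_norm simp del: add_uminus_conv_diff)
    then show ?thesis using XX[of False] by simp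
  next
    case 2
    have "EE j i a + (w + EE j i a) = EE i j a + tr j (X i) (- X i)"
      using ij 2 by (intro aut_eqI)
        (auto simp: app_EE app_tr aw group_norm simp del: add_uminus_conv_diff)
    then show ?thesis
      using GG_conj_N[OF mn EE_GG[OF mn s] XX[of True]] by simp
  qed
  then show ?thesis using wS by blast
qed

text \<open>If \<open>w\<close> inverts the image of \<open>x_i\<close>, the conjugate multiplies on
  the left instead of the right; a partial conjugation from \<open>N\<close> repairs this.\<close>

lemma rel_signed_perm:
  assumes mn: "m \<le> n" and s: "is_move n m i j c" and w: "signed_perm \<sigma> \<epsilon> w"
    and \<sigma>: "\<And>l. l \<notin> {1..m} \<Longrightarrow> \<sigma> l = l"
  shows "\<exists>d. is_move n m (\<sigma> i) (\<sigma> j) d \<and> EE (\<sigma> i) (\<sigma> j) d - (w + EE i j c - w) \<in> magnus_group n m"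
proof -
  have inj: "inj \<sigma>" using w by (simp add: signed_perm_def bij_is_inj)
  have ij: "i \<noteq> j" "i \<in> {1..m}" "j \<in> {1..n}" using s by (auto simp: is_move_def)
  have m: "\<sigma> l \<in> {1..m}" if "l \<in> {1..m}" for l
  proof (rule ccontr)
    assume n: "\<sigma> l \<notin> {1..m}"
    then have "\<sigma> (\<sigma> l) = \<sigma> l" by (rule \<sigma>)
    then show False using inj that n by (simp add: inj_eq)
  qed
  have \<sigma>ij: "\<sigma> i \<in> {1..m}" "\<sigma> j \<in> {1..n}" "\<sigma> i \<noteq> \<sigma> j"
  proof -
    show "\<sigma> i \<in> {1..m}" by (rule m[OF ij(2)])
    show "\<sigma> i \<noteq> \<sigma> j" using ij(1) inj by (simp add: inj_eq)
    show "\<sigma> j \<in> {1..n}"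
    proof (cases "j \<in> {1..m}")
      case True
      from m[OF this] show ?thesis using mn by simp
    qed (use \<sigma>[of j] ij(3) in simp)
  qed
  let ?x = "app w (sw (c = 1) (X j))"
  define e where "e = ((c = 1) = (\<epsilon> j = \<epsilon> i))"
  have x: "?x = sw ((c = 1) = \<epsilon> j) (X (\<sigma> j))"
    using w by (auto simp: signed_perm_def sw_def)
  have "w + EE i j c = (if \<epsilon> i then tr (\<sigma> i) 0 ?x else tr (\<sigma> i) (- ?x) 0) + w"
    unfolding EE_def using ij signed_perm_conj_tr[OF w, of 0 i "sw (c = 1) (X j)"] by (simp add: sw_def)
  also have "(if \<epsilon> i then tr (\<sigma> i) 0 ?x else tr (\<sigma> i) (- ?x) 0)
      = (if \<epsilon> i then tr (\<sigma> i) 0 (sw e (X (\<sigma> j))) else tr (\<sigma> i) (sw e (X (\<sigma> j))) 0)"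
    unfolding x e_def by (auto simp: sw_def)
  finally have eq: "w + EE i j c - w
      = (if \<epsilon> i then tr (\<sigma> i) 0 (sw e (X (\<sigma> j))) else tr (\<sigma> i) (sw e (X (\<sigma> j))) 0)"
    by simp
  let ?d = "if e then 1 else -1 :: int"
  have E: "EE (\<sigma> i) (\<sigma> j) ?d = tr (\<sigma> i) 0 (sw e (X (\<sigma> j)))" by (auto simp: EE_def)
  have "EE (\<sigma> i) (\<sigma> j) ?d - (w + EE i j c - w) \<in> magnus_group n m"
  proof (cases "\<epsilon> i")
    case True
    then show ?thesis unfolding eq E by (simp add: sgen.zero)
  next
    case False
    have "tr (\<sigma> i) (- sw e (X (\<sigma> j))) (sw e (X (\<sigma> j))) \<in> magnus_group n m"
      using \<sigma>ij by (intro tr_comm_N mn) (auto simp: sw_def)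
    moreover have "tr (\<sigma> i) 0 (sw e (X (\<sigma> j))) - tr (\<sigma> i) (sw e (X (\<sigma> j))) 0
        = tr (\<sigma> i) (- sw e (X (\<sigma> j))) (sw e (X (\<sigma> j)))"
      using \<sigma>ij
      by (simp add: tr_uminus tr_add sw_def diff_conv_add_uminus del: add_uminus_conv_diff)
    ultimately show ?thesis using False unfolding eq E by simp
  qed
  then show ?thesis using \<sigma>ij by (intro exI[of _ ?d]) (simp add: is_move_def)
qed

section \<open>Peak reduction for vectors\<close>

text \<open>The greatest common divisor is taken over the first \<open>m\<close> coordinates because
  only these are sources of moves; those beyond \<open>m\<close> can be cleared but cannot help to
  reach a unit vector.\<close>

definition adm :: "nat \<Rightarrow> nat \<Rightarrow> (nat \<Rightarrow> int) \<Rightarrow> bool" where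
  "adm n m v \<longleftrightarrow> supp n v \<and> (\<forall>d. (\<forall>i\<in>{1..m}. d dvd v i) \<longrightarrow> d dvd 1)"

definition unit_vec :: "nat \<Rightarrow> nat \<Rightarrow> int" where
  "unit_vec m a = (if a = m then 1 else 0)"

definition strict :: "nat \<Rightarrow> nat \<Rightarrow> (nat \<Rightarrow> int) \<Rightarrow> nat \<times> nat \<times> int \<Rightarrow> bool" where
  "strict n m v s \<longleftrightarrow> (case s of (i, j, c) \<Rightarrow> is_move n m i j c \<and> nrm n (move_vec i j c v) < nrm n v)"

text \<open>Every descent chooses a path from \<open>v\<close> to \<open>unit_vec m\<close>; the value is meaningful only if
  \<open>adm n m v\<close>, that is, if \<open>v\<close> lies in the orbit of \<open>unit_vec m\<close>.\<close>

function desc :: "nat \<Rightarrow> nat \<Rightarrow> (nat \<Rightarrow> int) \<Rightarrow> aut" where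
  "desc n m v = (if \<exists>s. strict n m v s
     then let s = SOME s. strict n m v s
       in desc n m (move_vec (fst s) (fst (snd s)) (snd (snd s)) v) + EE (fst s) (fst (snd s)) (snd (snd s))
     else SOME w. w \<in> signed_perms {1..m} \<and> act n w v = unit_vec m)"
  by pat_completeness auto
termination
proof (relation "measure (\<lambda>(n, m, v). nat (nrm n v))", goal_cases)
  case (2 n m v s)
  then have "strict n m v s" by (metis someI_ex)
  then have "nrm n (move_vec (fst s) (fst (snd s)) (snd (snd s)) v) < nrm n v"
    by (auto simp: strict_def split: prod.splits)
  from this le_less_trans[OF nrm_nonneg this] show ?case by simp
qed simp

declare desc.simps [simp del]

lemma desc_step:
  assumes "strict n m v s"
  obtains i j c where "is_move n m i j c" "nrm n (move_vec i j c v) < nrm n v"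
    "desc n m v = desc n m (move_vec i j c v) + EE i j c"
proof -
  define s where "s = (SOME s. strict n m v s)"
  have ex: "\<exists>s. strict n m v s" using assms by blast
  have "strict n m v s" unfolding s_def by (rule someI_ex[OF ex])
  moreover have "desc n m v = desc n m (move_vec (fst s) (fst (snd s)) (snd (snd s)) v)
      + EE (fst s) (fst (snd s)) (snd (snd s))"
    using ex by (subst desc.simps) (simp add: s_def Let_def)
  ultimately show thesis using that[of "fst s" "fst (snd s)" "snd (snd s)"]
    by (auto simp: strict_def split: prod.splits)
qed

lemma mvv_apply: "move_vec i j c v a = (if a = j then v j + c * v i else v a)"
  by (simp add: move_vec_def)

lemma mvv_inverse: "i \<noteq> j \<Longrightarrow> move_vec i j (- c) (move_vec i j c v) = v"
  by (auto simp: mvv_apply fun_eq_iff)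

lemma exists_reducing_sign:
  fixes x y :: int
  assumes "x \<noteq> 0" "\<bar>x\<bar> \<le> \<bar>y\<bar>"
  obtains c :: int where "c = 1 \<or> c = -1" "\<bar>y + c * x\<bar> < \<bar>y\<bar>"
proof (cases "0 < x \<longleftrightarrow> 0 < y")
  case True
  show thesis by (rule that[of "-1"]) (use assms True in auto)
next
  case False
  show thesis by (rule that[of 1]) (use assms False in auto)
qed

locale peak =
  fixes n m :: nat
  assumes mn: "m \<le> n" and m1: "1 \<le> m"
begin

text \<open>All of \<open>N\<close> is kept, as it fixes every class; the other generators are those
  of level \<open>m - 1\<close>.\<close>

definition SS :: "aut set" where
  "SS = sgen (magnus_gens n m \<union> {E i j | i j. i \<in> {1..m - 1} \<and> j \<in> {1..n} \<and> i \<noteq> j} \<union> signed_perms {1..m - 1})"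

lemma N_SS: "x \<in> magnus_group n m \<Longrightarrow> x \<in> SS"
  unfolding SS_def by (erule subsetD[OF sgen_mono, rotated]) (simp add: Un_assoc)

lemma SP_SS: "x \<in> signed_perms {1..m - 1} \<Longrightarrow> x \<in> SS"
  unfolding SS_def by (rule sgen_base) blast

lemma SS_add: "x \<in> SS \<Longrightarrow> y \<in> SS \<Longrightarrow> x + y \<in> SS"
  and SS_uminus: "x \<in> SS \<Longrightarrow> - x \<in> SS"
  by (auto simp: SS_def intro: sgen_add sgen_uminus)

lemma EE_SS:
  assumes "is_move n m i j c" "i \<noteq> m"
  shows "EE i j c \<in> SS"
proof -
  have "i \<in> {1..m - 1}" "j \<in> {1..n}" "i \<noteq> j" using assms by (auto simp: is_move_def)
  then have "E i j \<in> SS" unfolding SS_def by (intro sgen_base) blast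
  then show ?thesis using assms SS_uminus by (auto simp: is_move_def EE_E)
qed

lemma EE_mem_GG: "is_move n m i j c \<Longrightarrow> EE i j c \<in> nielsen_group n m"
  using EE_GG[OF mn] .

lemma SP_GG: "w \<in> signed_perms {1..m} \<Longrightarrow> w \<in> nielsen_group n m"
  using SP_subset_GG by blast

lemma act_EE_mvv: "is_move n m i j c \<Longrightarrow> supp n v \<Longrightarrow> act n (EE i j c) v = move_vec i j c v"
  using mn by (intro act_EE) (auto simp: is_move_def)

lemma adm_supp: "adm n m v \<Longrightarrow> supp n v"
  by (simp add: adm_def)

lemma adm_mvv:
  assumes s: "is_move n m i j c" and v: "adm n m v"
  shows "adm n m (move_vec i j c v)"
proof -
  have "d dvd 1" if d: "\<And>k. k \<in> {1..m} \<Longrightarrow> d dvd move_vec i j c v k" for d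
  proof -
    have i: "d dvd v i" using d[of i] s by (auto simp: is_move_def mvv_apply)
    have "d dvd v k" if k: "k \<in> {1..m}" for k
    proof (cases "k = j")
      case True
      then have "d dvd (v j + c * v i) - c * v i"
        using d[OF k] i
        by (intro dvd_diff dvd_mult) (auto simp: mvv_apply)
      then show ?thesis using True by simp
    next
      case False
      then show ?thesis using d[OF k] by (simp add: mvv_apply)
    qed
    then show ?thesis using v by (auto simp: adm_def)
  qed
  then show ?thesis using v s by (auto simp: adm_def supp_def mvv_apply is_move_def)
qed

lemma SP_perm:
  assumes "w \<in> signed_perms {1..m}"
  obtains \<sigma> \<epsilon> where "signed_perm \<sigma> \<epsilon> w" "\<And>l. l \<notin> {1..m} \<Longrightarrow> \<sigma> l = l \<and> \<epsilon> l"
    "\<sigma> ` {1..m} = {1..m}" "\<sigma> ` {1..n} = {1..n}"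
    "\<And>v l. supp n v \<Longrightarrow> act n w v (\<sigma> l) = sw (\<epsilon> l) (v l)"
proof -
  obtain \<sigma> \<epsilon> where s: "signed_perm \<sigma> \<epsilon> w" and o: "\<And>l. l \<notin> {1..m} \<Longrightarrow> \<sigma> l = l \<and> \<epsilon> l"
    using assms unfolding signed_perms_def by blast
  have b: "bij \<sigma>" using s by (simp add: signed_perm_def)
  have img: "\<sigma> ` {1..k} = {1..k}" if "m \<le> k" for k
  proof -
    have "\<sigma> l = l" if "l \<notin> {1..k}" for l using o[of l] \<open>m \<le> k\<close> that by auto
    then have "\<sigma> ` (- {1..k}) = - {1..k}" by force
    then show ?thesis using bij_image_Compl_eq[OF b, of "{1..k}"] by auto
  qed
  have "act n w v (\<sigma> l) = sw (\<epsilon> l) (v l)" if "supp n v" for v l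
    by (rule act_signed_perm[OF s _ that]) (use o mn in auto)
  then show thesis using that[OF s o img[OF order_refl] img[OF mn]] by blast
qed

lemma nrm_SP:
  assumes w: "w \<in> signed_perms {1..m}" and v: "supp n v"
  shows "nrm n (act n w v) = nrm n v"
proof -
  obtain \<sigma> \<epsilon> where s: "signed_perm \<sigma> \<epsilon> w" "\<sigma> ` {1..n} = {1..n}"
    "\<And>l. act n w v (\<sigma> l) = sw (\<epsilon> l) (v l)"
    using SP_perm[OF w] v by metis
  have "inj_on \<sigma> {1..n}" using s(1) by (auto simp: signed_perm_def bij_def inj_on_def inj_def)
  then have "(\<Sum>a\<in>\<sigma> ` {1..n}. \<bar>act n w v a\<bar>) = (\<Sum>a\<in>{1..n}. \<bar>act n w v (\<sigma> a)\<bar>)"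
    by (simp add: sum.reindex)
  then show ?thesis unfolding nrm_def s(2) by (simp add: s(3) sw_def if_distrib cong: if_cong)
qed

lemma adm_SP:
  assumes w: "w \<in> signed_perms {1..m}" and v: "adm n m v"
  shows "adm n m (act n w v)"
proof -
  obtain \<sigma> \<epsilon> where s: "\<sigma> ` {1..m} = {1..m}" "\<And>l. act n w v (\<sigma> l) = sw (\<epsilon> l) (v l)"
    using SP_perm[OF w] adm_supp[OF v] by metis
  have "d dvd 1" if d: "\<And>k. k \<in> {1..m} \<Longrightarrow> d dvd act n w v k" for d
  proof -
    have "d dvd v k" if "k \<in> {1..m}" for k
    proof -
      have "\<sigma> k \<in> {1..m}" using s(1) that by blast
      then show ?thesis using d[of "\<sigma> k"] s(2)[of k] by (simp add: sw_def split: if_splits)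
    qed
    then show ?thesis using v by (auto simp: adm_def)
  qed
  moreover have "supp n (act n w v)"
    using SP_An[OF _ w] mn by (intro supp_act) auto
  ultimately show ?thesis by (auto simp: adm_def)
qed

lemma adm_nonzero:
  assumes "adm n m v"
  obtains i where "i \<in> {1..m}" "v i \<noteq> 0"
proof -
  have "\<not> (\<forall>i\<in>{1..m}. 2 dvd v i)" using assms unfolding adm_def by fastforce
  then show thesis using that by force
qed

lemma adm_nrm_pos: "adm n m v \<Longrightarrow> 1 \<le> nrm n v"
proof -
  assume "adm n m v"
  then obtain i where "i \<in> {1..m}" "v i \<noteq> 0" by (rule adm_nonzero)
  then show ?thesis using nrm_ge[of i n v] mn by auto
qed

text \<open>Euclid's algorithm. If nothing can be lowered, the least nonzero absolute value among
  the first \<open>m\<close> coordinates exceeds all other coordinates. The others up to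
  \<open>m\<close> then vanish, the least one is a unit by primitivity, and so everything else
  vanishes.\<close>

lemma exists_strict:
  assumes v: "adm n m v" and "nrm n v \<noteq> 1"
  shows "\<exists>s. strict n m v s"
proof (rule ccontr)
  assume no: "\<not> ?thesis"
  define A where "A = {i \<in> {1..m}. v i \<noteq> 0}"
  have A: "finite ((\<lambda>k. \<bar>v k\<bar>) ` A)" "(\<lambda>k. \<bar>v k\<bar>) ` A \<noteq> {}"
    using adm_nonzero[OF v] by (auto simp: A_def)
  from Min_in[OF this] obtain i where "i \<in> A" "Min ((\<lambda>k. \<bar>v k\<bar>) ` A) = \<bar>v i\<bar>" by auto
  with Min_le[OF A(1)] have i: "i \<in> A" "\<And>k. k \<in> A \<Longrightarrow> \<bar>v i\<bar> \<le> \<bar>v k\<bar>" by auto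
  have small: "\<bar>v j\<bar> < \<bar>v i\<bar>" if j: "j \<in> {1..n}" "j \<noteq> i" for j
  proof (rule ccontr)
    assume "\<not> ?thesis"
    then obtain c :: int where c: "c = 1 \<or> c = -1" "\<bar>v j + c * v i\<bar> < \<bar>v j\<bar>"
      using exists_reducing_sign[of "v i" "v j"] i by (auto simp: A_def)
    then have "strict n m v (i, j, c)"
      using i j by (auto simp: strict_def is_move_def A_def nrm_mvv)
    then show False using no by blast
  qed
  have z: "v j = 0" if "j \<in> {1..m}" "j \<noteq> i" for j
    using small[of j] i(2)[of j] that mn by (force simp: A_def)
  have "v i dvd v j" if "j \<in> {1..m}" for j using z[OF that] by (cases "j = i") auto
  then have "v i dvd 1" using v by (auto simp: adm_def)
  then have vi: "\<bar>v i\<bar> = 1" by simp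
  have "nrm n v = (\<Sum>a\<in>{1..n}. if a = i then 1 else 0)"
    unfolding nrm_def by (rule sum.cong) (use small vi in force)+
  then show False using assms(2) i mn by (simp add: A_def)
qed

lemma nrm_1_to_unit_vec:
  assumes v: "adm n m v" and 1: "nrm n v = 1"
  shows "\<exists>w\<in>signed_perms {1..m}. act n w v = unit_vec m"
proof -
  obtain i where i: "i \<in> {1..m}" "v i \<noteq> 0" by (rule adm_nonzero[OF v])
  have "\<bar>v i\<bar> = 1" using nrm_ge[of i n v] i mn 1 by auto
  have z: "v j = 0" if "j \<noteq> i" for j
  proof (cases "j \<in> {1..n}")
    case True
    then show ?thesis using nrm_ge2[of i n j v] i that 1 mn by auto
  qed (use v in \<open>auto simp: adm_def supp_def\<close>)
  define \<sigma> where "\<sigma> = id(i := m, m := i)"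
  define \<epsilon> where "\<epsilon> l = (l = i \<longrightarrow> v i = 1)" for l
  have inv: "\<sigma> (\<sigma> x) = x" for x by (simp add: \<sigma>_def)
  have "bij \<sigma>" by (rule o_bij[of \<sigma>]) (simp_all add: fun_eq_iff inv)
  then obtain w where w: "signed_perm \<sigma> \<epsilon> w" using ex_signed_perm by blast
  have o: "\<sigma> l = l" if "l \<notin> {1..m}" for l using that i m1 by (auto simp: \<sigma>_def)
  have "w \<in> signed_perms {1..m}"
    unfolding signed_perms_def using w o i by (auto simp: \<epsilon>_def intro!: exI[of _ \<sigma>] exI[of _ \<epsilon>])
  moreover have "act n w v = unit_vec m"
  proof
    fix a
    have "act n w v (\<sigma> (\<sigma> a)) = sw (\<epsilon> (\<sigma> a)) (v (\<sigma> a))"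
      using o mn by (intro act_signed_perm[OF w _ adm_supp[OF v]]) auto
    moreover have "\<sigma> a = i \<longleftrightarrow> a = m" by (auto simp: \<sigma>_def)
    ultimately show "act n w v a = unit_vec m a"
      using z[of "\<sigma> a"] \<open>\<bar>v i\<bar> = 1\<close> unfolding inv
      by (cases "a = m") (auto simp: unit_vec_def \<epsilon>_def sw_def)
  qed
  ultimately show ?thesis by blast
qed

lemma desc_1:
  assumes v: "adm n m v" and 1: "nrm n v = 1"
  shows "desc n m v \<in> signed_perms {1..m} \<and> act n (desc n m v) v = unit_vec m"
proof -
  have "\<not> strict n m v s" for s
    using adm_nrm_pos[OF adm_mvv[OF _ v]] 1 by (fastforce simp: strict_def split: prod.splits)
  then have "desc n m v = (SOME w. w \<in> signed_perms {1..m} \<and> act n w v = unit_vec m)"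
    by (subst desc.simps) simp
  then show ?thesis
    using someI_ex[of "\<lambda>w. w \<in> signed_perms {1..m} \<and> act n w v = unit_vec m"] nrm_1_to_unit_vec[OF assms]
    by (simp add: Bex_def)
qed

lemma desc_GG: "adm n m v \<Longrightarrow> desc n m v \<in> nielsen_group n m"
proof (induction "nat (nrm n v)" arbitrary: v rule: less_induct)
  case less
  show ?case
  proof (cases "nrm n v = 1")
    case True
    then show ?thesis using desc_1[OF less.prems] SP_GG by blast
  next
    case False
    then obtain s where "strict n m v s" using exists_strict less.prems by blast
    then obtain i j c where s: "is_move n m i j c" "nrm n (move_vec i j c v) < nrm n v"
      "desc n m v = desc n m (move_vec i j c v) + EE i j c" by (rule desc_step)
    have "desc n m (move_vec i j c v) \<in> nielsen_group n m"
      using s(1,2) le_less_trans[OF nrm_nonneg s(2)] less.prems by (intro less.hyps adm_mvv) auto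
    then show ?thesis unfolding s(3) by (intro sgen_add EE_mem_GG s(1))
  qed
qed

text \<open>Closing up the step \<open>q\<close> from \<open>v\<close> with the chosen paths gives a loop at \<open>unit_vec m\<close>; the aim is
  that all such loops lie in \<open>SS\<close>, the group generated by the generators that fix \<open>x\<^sub>m\<close>.\<close>

definition ok :: "(nat \<Rightarrow> int) \<Rightarrow> aut \<Rightarrow> bool" where
  "ok v q \<longleftrightarrow> desc n m (act n q v) + q - desc n m v \<in> SS"

text \<open>A path is remembered only through its product \<open>q\<close> and the fact that its
  closed-up loop lies in \<open>SS\<close>; the intermediate vectors are forgotten.\<close>

definition path :: "(nat \<Rightarrow> int) \<Rightarrow> aut \<Rightarrow> (nat \<Rightarrow> int) \<Rightarrow> bool" where
  "path v q u \<longleftrightarrow> q \<in> nielsen_group n m \<and> act n q v = u \<and> adm n m u \<and> ok v q"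

lemma path_ok: "path v q u \<Longrightarrow> ok v q"
  by (simp add: path_def)

lemma path_step:
  assumes q: "path v q u" and p: "p \<in> nielsen_group n m" "ok u p" "adm n m (act n p u)"
  shows "path v (p + q) (act n p u)"
proof -
  have a: "act n (p + q) v = act n p u"
    using q GG_An[OF mn] by (auto simp: path_def act_add)
  have "(desc n m (act n p u) + p - desc n m u) + (desc n m u + q - desc n m v) \<in> SS"
    using q p by (intro SS_add) (auto simp: path_def ok_def)
  then have "ok v (p + q)"
    unfolding ok_def a by (simp add: group_norm del: add_uminus_conv_diff)
  then show ?thesis using q p a by (auto simp: path_def intro: sgen_add)
qed

lemma path_0: "adm n m v \<Longrightarrow> path v 0 v"
  using N_SS[OF sgen.zero] by (simp add: path_def ok_def act_0 adm_supp sgen.zero)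

lemma path_single:
  assumes "adm n m v" "p \<in> nielsen_group n m" "ok v p" "adm n m (act n p v)"
  shows "path v p (act n p v)"
  using path_step[OF path_0[OF assms(1)] assms(2-4)] by simp

lemma path_EE_single:
  assumes "adm n m v" "is_move n m i j c" "ok v (EE i j c)"
  shows "path v (EE i j c) (move_vec i j c v)"
  using path_single[OF assms(1) EE_mem_GG[OF assms(2)] assms(3)] assms
  by (simp add: act_EE_mvv adm_supp adm_mvv)

lemma path_EE:
  assumes "path v q u" "is_move n m i j c" "ok u (EE i j c)"
  shows "path v (EE i j c + q) (move_vec i j c u)"
proof -
  have u: "adm n m u" using assms by (simp add: path_def)
  show ?thesis
    using path_step[OF assms(1) EE_mem_GG[OF assms(2)] assms(3)] u assms(2)
    by (simp add: act_EE_mvv adm_supp adm_mvv)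
qed

text \<open>The use of normality: the loops of \<open>q\<close> and \<open>q'\<close> differ by a
  conjugate of an element of \<open>N\<close>, which is again in \<open>N\<close>.\<close>

lemma path_cong:
  assumes q: "path v q u" and q': "q' \<in> nielsen_group n m" and N: "q - q' \<in> magnus_group n m"
  shows "path v q' u"
proof -
  have u: "adm n m u" "act n q v = u" "desc n m u + q - desc n m v \<in> SS"
    using q by (auto simp: path_def ok_def)
  have "act n (q - q' + q') v = act n q' v"
    using act_N[OF mn N supp_act] GG_An[OF mn q'] by (simp only: act_add)
  then have a: "act n q' v = u" using u by simp
  have "desc n m u + - (q - q') - desc n m u \<in> magnus_group n m"
    by (intro GG_conj_N mn desc_GG u sgen_uminus N)
  from SS_add[OF N_SS[OF this] u(3)] have "desc n m u + q' - desc n m v \<in> SS"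
    by (simp add: group_norm del: add_uminus_conv_diff)
  then show ?thesis using q' a u by (simp add: path_def ok_def)
qed

lemma ok_uminus:
  assumes "supp n v" "q \<in> nielsen_group n m" "ok v q"
  shows "ok (act n q v) (- q)"
proof -
  have "act n (- q) (act n q v) = v" using act_uminus[OF GG_An[OF mn assms(2)] assms(1)] .
  moreover have "- (desc n m (act n q v) + q - desc n m v) \<in> SS"
    using assms(3) unfolding ok_def by (rule SS_uminus)
  ultimately show ?thesis
    by (simp add: ok_def group_norm del: add_uminus_conv_diff)
qed

lemma ok_EE_uminus:
  assumes v: "adm n m v" and s: "is_move n m i j c" and ok: "ok (move_vec i j c v) (EE i j (- c))"
  shows "ok v (EE i j c)"
proof -
  have i: "i \<noteq> j" using s by (simp add: is_move_def)
  have s': "is_move n m i j (- c)" using s by (rule is_move_uminus)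
  have a: "act n (EE i j (- c)) (move_vec i j c v) = v"
    using adm_supp[OF adm_mvv[OF s v]] s' i by (simp add: act_EE_mvv mvv_inverse)
  have "ok (act n (EE i j (- c)) (move_vec i j c v)) (- EE i j (- c))"
    by (rule ok_uminus[OF adm_supp[OF adm_mvv[OF s v]] EE_mem_GG[OF s'] ok])
  moreover have "- EE i j (- c) = EE i j c"
    using EE_uminus[OF i, of "- c"] s by (auto simp: is_move_def)
  ultimately show ?thesis using a by simp
qed

text \<open>The induction hypothesis below the peak. The extra endpoint \<open>z\<close> may have
  norm \<open>r\<close>: a detour stays below \<open>r\<close> until its last step, which may climb
  to \<open>z\<close>.\<close>

definition low :: "int \<Rightarrow> (nat \<Rightarrow> int) \<Rightarrow> bool" where
  "low r z \<longleftrightarrow>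
    (\<forall>u i j c. adm n m u \<longrightarrow> is_move n m i j c \<longrightarrow> nrm n u < r \<longrightarrow>
      nrm n (move_vec i j c u) < r \<or> move_vec i j c u = z \<longrightarrow> ok u (EE i j c)) \<and>
    (\<forall>u w. adm n m u \<longrightarrow> w \<in> signed_perms {1..m} \<longrightarrow> nrm n u < r \<longrightarrow> ok u w)"

lemma low_lt: "low r z \<Longrightarrow> nrm n x < r \<Longrightarrow> low r x"
  unfolding low_def by blast

lemma path_low:
  assumes "path v q u" "low r z" "is_move n m i j c" "nrm n u < r"
    "nrm n (move_vec i j c u) < r \<or> move_vec i j c u = z"
  shows "path v (EE i j c + q) (move_vec i j c u)"
  using assms unfolding low_def by (intro path_EE) (auto simp: path_def)

lemma path_ok_cong:
  assumes "path v q u" "q - EE i j c \<in> magnus_group n m" "is_move n m i j c"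
  shows "ok v (EE i j c)"
  using path_cong[OF assms(1) EE_mem_GG[OF assms(3)] assms(2)] by (rule path_ok)

lemma nrm_mvv': "is_move n m i j c \<Longrightarrow> nrm n (move_vec i j c v) = nrm n v - \<bar>v j\<bar> + \<bar>v j + c * v i\<bar>"
  by (rule nrm_mvv) (simp add: is_move_def)

text \<open>The detour takes the known step, then the wanted one, then the first one back. Condition
  \<open>c\<close> ensures that the two changes of the norm do not interfere.\<close>

lemma peak_commute:
  assumes v: "adm n m v" "nrm n v = r" and t: "is_move n m k l b" and s: "is_move n m i j a"
    and neq: "i \<noteq> l" "j \<noteq> k" and c: "j \<noteq> l \<or> v i = 0"
    and tr: "nrm n (move_vec k l b v) < r" and sr: "nrm n (move_vec i j a v) \<le> r"
    and ok: "ok v (EE k l b)" and low: "low r (move_vec i j a v)"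
  shows "ok v (EE i j a)"
proof -
  have kl: "k \<noteq> l" "i \<noteq> j" using s t by (auto simp: is_move_def)
  note 1 = path_EE_single[OF v(1) t ok]
  have n1: "nrm n (move_vec i j a (move_vec k l b v)) < r"
    using tr sr v(2) c neq kl by (auto simp: nrm_mvv'[OF s] nrm_mvv'[OF t] mvv_apply)
  note 2 = path_low[OF 1 low s tr disjI1[OF n1]]
  have e: "move_vec k l (- b) (move_vec i j a (move_vec k l b v)) = move_vec i j a v"
    using neq kl by (auto simp: fun_eq_iff mvv_apply)
  note 3 = path_low[OF 2 low is_move_uminus[OF t] n1 disjI2[OF e]]
  show ?thesis by (rule path_ok_cong[OF 3 rel_commute[OF mn s t neq] s])
qed

lemma peak_same_target:
  assumes v: "adm n m v" "nrm n v = r" and t: "is_move n m k j b" and s: "is_move n m i j a" and ik: "i \<noteq> k"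
    and tr: "nrm n (move_vec k j b v) < r" and sr: "nrm n (move_vec i j a v) \<le> r"
    and ok: "ok v (EE k j b)" and low: "low r (move_vec i j a v)"
  shows "ok v (EE i j a)"
proof -
  have kj: "k \<noteq> j" "i \<noteq> j" "i \<in> {1..m}" "k \<in> {1..m}" using s t by (auto simp: is_move_def)
  have ab: "a = 1 \<or> a = -1" "b = 1 \<or> b = -1" using s t by (auto simp: is_move_def)
  have tv: "\<bar>v j + b * v k\<bar> < \<bar>v j\<bar>" using tr v(2) nrm_mvv'[OF t] by auto
  have sv: "\<bar>v j + a * v i\<bar> \<le> \<bar>v j\<bar>" using sr v(2) nrm_mvv'[OF s] by auto
  \<comment> \<open>If \<open>v i\<close> is nonzero, both \<open>b * v k\<close> and
    \<open>a * v i\<close> are opposite in sign to \<open>v j\<close>. With this \<open>c\<close>,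
    adding the smaller of the coordinates \<open>v i\<close> and \<open>v k\<close> to the larger
    one lowers the larger one.\<close>
  define c where "c = - a * b"
  have c: "c = 1 \<or> c = -1" "b = - a * c" "a = - b * c" using ab by (auto simp: c_def)
  note 1 = path_EE_single[OF v(1) t ok]
  consider "v i = 0" | "v i \<noteq> 0" "\<bar>v k\<bar> \<le> \<bar>v i\<bar>" | "v i \<noteq> 0" "\<bar>v i\<bar> < \<bar>v k\<bar>" by linarith
  then show ?thesis
  proof cases
    case 1
    then show ?thesis
      using peak_commute[OF v t s _ _ _ tr sr ok low] kj by auto
  next
    case 2
    have ki: "is_move n m k i c" using kj ik c mn by (auto simp: is_move_def)
    have smaller: "\<bar>v i + c * v k\<bar> < \<bar>v i\<bar>"
      using tv sv 2 ab unfolding c_def by (elim disjE; simp; linarith)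
    have n1: "nrm n (move_vec k i c (move_vec k j b v)) < r"
      using tr smaller kj ik by (simp add: nrm_mvv'[OF ki] mvv_apply)
    note 2 = path_low[OF 1 low ki tr disjI1[OF n1]]
    have e1: "move_vec i j a (move_vec k i c (move_vec k j b v)) = move_vec k i c (move_vec i j a v)"
      using ab kj ik unfolding c_def by (auto simp: fun_eq_iff mvv_apply)
    have n2: "nrm n (move_vec i j a (move_vec k i c (move_vec k j b v))) < r"
      unfolding e1 using sr smaller kj ik by (simp add: nrm_mvv'[OF ki] mvv_apply)
    note 3 = path_low[OF 2 low s n1 disjI1[OF n2]]
    have e2: "move_vec k i (- c) (move_vec i j a (move_vec k i c (move_vec k j b v))) = move_vec i j a v"
      unfolding e1 using ik by (simp add: mvv_inverse)
    note 4 = path_low[OF 3 low is_move_uminus[OF ki] n2 disjI2[OF e2]]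
    show ?thesis
      by (rule path_ok_cong[OF 4 _ s])
        (use rel_same_target1[OF mn s ki kj(1)[symmetric]] c(2) in simp)
  next
    case 3
    have ik': "is_move n m i k c" using kj ik c mn by (auto simp: is_move_def)
    have smaller: "\<bar>v k + c * v i\<bar> < \<bar>v k\<bar>"
      using tv sv 3 ab unfolding c_def by (elim disjE; simp; linarith)
    have n1: "nrm n (move_vec i k c (move_vec k j b v)) < r"
      using tr smaller kj ik by (simp add: nrm_mvv'[OF ik'] mvv_apply)
    note 2 = path_low[OF 1 low ik' tr disjI1[OF n1]]
    have e1: "move_vec k j (- b) (move_vec i k c (move_vec k j b v)) = move_vec i k c (move_vec i j a v)"
      using ab kj ik unfolding c_def by (auto simp: fun_eq_iff mvv_apply)
    have n2: "nrm n (move_vec k j (- b) (move_vec i k c (move_vec k j b v))) < r"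
      unfolding e1 using sr smaller kj ik by (simp add: nrm_mvv'[OF ik'] mvv_apply)
    note 3 = path_low[OF 2 low is_move_uminus[OF t] n1 disjI1[OF n2]]
    have e2: "move_vec i k (- c) (move_vec k j (- b) (move_vec i k c (move_vec k j b v))) = move_vec i j a v"
      unfolding e1 using ik by (simp add: mvv_inverse)
    note 4 = path_low[OF 3 low is_move_uminus[OF ik'] n2 disjI2[OF e2]]
    show ?thesis
      by (rule path_ok_cong[OF 4 _ s])
        (use rel_same_target2[OF mn t ik' kj(2)] c(3) in simp)
  qed
qed

text \<open>Both inequalities say that \<open>v i\<close> and \<open>v j\<close> have opposite signs
  up to the sign of the move, so \<open>b = a\<close>. The detour then passes through a signed
  permutation, which preserves the norm.\<close>

lemma peak_opposite:
  assumes v: "adm n m v" "nrm n v = r" and t: "is_move n m j i b" and s: "is_move n m i j a"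
    and tr: "nrm n (move_vec j i b v) < r" and sr: "nrm n (move_vec i j a v) \<le> r"
    and ok: "ok v (EE j i b)" and low: "low r (move_vec i j a v)"
  shows "ok v (EE i j a)"
proof -
  have ij: "i \<noteq> j" "j \<in> {1..m}" using s t by (auto simp: is_move_def)
  have "\<bar>v i + b * v j\<bar> < \<bar>v i\<bar>" using tr v(2) nrm_mvv'[OF t] by auto
  moreover have "\<bar>v j + a * v i\<bar> \<le> \<bar>v j\<bar>" using sr v(2) nrm_mvv'[OF s] by auto
  ultimately have ba: "b = a" using s t by (auto simp: is_move_def)
  obtain w where w: "w \<in> signed_perms {1..m}" and rel: "EE j i a + (w + EE j i a) - EE i j a \<in> magnus_group n m"
    using rel_opposite[OF mn s ij(2)] by blast
  note 1 = path_EE_single[OF v(1) t ok]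
  let ?u = "act n w (move_vec j i b v)"
  have u: "adm n m ?u" by (intro adm_SP w adm_mvv t v)
  have n1: "nrm n ?u < r" using nrm_SP[OF w adm_supp[OF adm_mvv[OF t v(1)]]] tr by simp
  have "ok (move_vec j i b v) w" using low w tr adm_mvv[OF t v(1)] unfolding low_def by blast
  note 2 = path_step[OF 1 SP_GG[OF w] this u]
  have a2: "act n (w + EE j i b) v = ?u" using 2 by (simp add: path_def)
  \<comment> \<open>The end of the detour is read off from the relation, since elements of
    \<open>N\<close> fix every vector.\<close>
  have "move_vec j i b ?u = act n (EE j i b) ?u" by (rule act_EE_mvv[symmetric, OF t adm_supp[OF u]])
  also have "\<dots> = act n (EE j i b + (w + EE j i b)) v"
    using 2 GG_An[OF mn] by (simp add: act_add path_def)
  also have "\<dots> = act n ((EE j i a + (w + EE j i a) - EE i j a) + EE i j a) v"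
    unfolding ba by (simp only: diff_add_cancel)
  also have "\<dots> = act n (EE i j a) v"
    using act_N[OF mn rel supp_act] GG_An[OF mn EE_mem_GG[OF s]] by (simp only: act_add)
  also have "\<dots> = move_vec i j a v" by (rule act_EE_mvv[OF s adm_supp[OF v(1)]])
  finally have e: "move_vec j i b ?u = move_vec i j a v" .
  note 3 = path_low[OF 2 low t n1 disjI2[OF e]]
  show ?thesis by (rule path_ok_cong[OF 3 _ s]) (use rel ba in simp)
qed

lemma peak_chain1:
  assumes v: "adm n m v" "nrm n v = r" and t: "is_move n m p q b" and s: "is_move n m q k a"
    and pk: "p \<noteq> k" and tr: "nrm n (move_vec p q b v) < r" and sr: "nrm n (move_vec q k a v) \<le> r"
    and ok: "ok v (EE p q b)" and low: "low r (move_vec q k a v)"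
  shows "ok v (EE q k a)"
proof -
  have neq: "p \<noteq> q" "q \<noteq> k" "p \<in> {1..m}" "q \<in> {1..m}" "k \<in> {1..n}" using s t by (auto simp: is_move_def)
  have ab: "a = 1 \<or> a = -1" "b = 1 \<or> b = -1" using s t by (auto simp: is_move_def)
  have tv: "\<bar>v q + b * v p\<bar> < \<bar>v q\<bar>" using tr v(2) nrm_mvv'[OF t] by auto
  have sv: "\<bar>v k + a * v q\<bar> \<le> \<bar>v k\<bar>" using sr v(2) nrm_mvv'[OF s] by auto
  show ?thesis
  proof (cases "\<bar>v p\<bar> \<le> \<bar>v q\<bar>")
    case True
    have pk': "is_move n m p k (- a * b)" using neq ab pk by (auto simp: is_move_def)
    note 1 = path_EE_single[OF v(1) t ok]
    \<comment> \<open>The value \<open>v q + b * v p\<close> lies between \<open>0\<close> and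
      \<open>v q\<close>, so by convexity adding it to \<open>v k\<close> with sign \<open>a\<close>
      does not increase the absolute value.\<close>
    have n1: "nrm n (move_vec q k a (move_vec p q b v)) < r"
    proof -
      have "nrm n (move_vec q k a (move_vec p q b v)) = r - \<bar>v q\<bar> + \<bar>v q + b * v p\<bar> - \<bar>v k\<bar> + \<bar>v k + a * (v q + b * v p)\<bar>"
        using v(2) neq pk by (simp add: nrm_mvv'[OF s] nrm_mvv'[OF t] mvv_apply)
      then show ?thesis using tv sv True ab by (elim disjE) (simp_all, linarith+)
    qed
    note 2 = path_low[OF 1 low s tr disjI1[OF n1]]
    have n2: "nrm n (move_vec p k (- a * b) (move_vec q k a (move_vec p q b v))) < r"
    proof -
      have "nrm n (move_vec p k (- a * b) (move_vec q k a (move_vec p q b v))) = r - \<bar>v q\<bar> + \<bar>v q + b * v p\<bar> - \<bar>v k\<bar> + \<bar>v k + a * v q\<bar>"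
        unfolding nrm_mvv'[OF pk'] using v(2) neq pk
        by (simp add: nrm_mvv'[OF s] nrm_mvv'[OF t] mvv_apply algebra_simps)
      then show ?thesis using tv sv by linarith
    qed
    note 3 = path_low[OF 2 low pk' n1 disjI1[OF n2]]
    have e: "move_vec p q (- b) (move_vec p k (- a * b) (move_vec q k a (move_vec p q b v))) = move_vec q k a v"
      using ab neq pk by (auto simp: fun_eq_iff mvv_apply)
    note 4 = path_low[OF 3 low is_move_uminus[OF t] n2 disjI2[OF e]]
    show ?thesis by (rule path_ok_cong[OF 4 rel_chain1[OF mn t s pk] s])
  next
    case False
    have "v q \<noteq> 0" using tv by (cases "v q = 0") simp_all
    \<comment> \<open>Now \<open>v p\<close> is the larger coordinate, and an auxiliary descent from
      \<open>q\<close> to \<open>p\<close> splits the peak into an opposite pair and a commuting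
      pair.\<close>
    with False obtain c :: int where c: "c = 1 \<or> c = -1" "\<bar>v p + c * v q\<bar> < \<bar>v p\<bar>"
      using exists_reducing_sign[of "v q" "v p"] by auto
    have qp: "is_move n m q p c" using neq c mn by (auto simp: is_move_def)
    have n: "nrm n (move_vec q p c v) < r" using c v(2) by (simp add: nrm_mvv'[OF qp])
    have "ok v (EE q p c)"
      by (rule peak_opposite[OF v t qp tr less_imp_le[OF n] ok low_lt[OF low n]])
    then show ?thesis
      using peak_commute[OF v qp s _ _ _ n sr _ low] neq pk by auto
  qed
qed

text \<open>The same configuration with known and wanted step exchanged; the auxiliary descent now
  meets the commuting pair first and the opposite pair second.\<close>

lemma peak_chain2:
  assumes v: "adm n m v" "nrm n v = r" and s: "is_move n m p q b" and t: "is_move n m q k a"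
    and pk: "p \<noteq> k" and tr: "nrm n (move_vec q k a v) < r" and sr: "nrm n (move_vec p q b v) \<le> r"
    and ok: "ok v (EE q k a)" and low: "low r (move_vec p q b v)"
  shows "ok v (EE p q b)"
proof -
  have neq: "p \<noteq> q" "q \<noteq> k" "p \<in> {1..m}" "q \<in> {1..m}" "k \<in> {1..n}" using s t by (auto simp: is_move_def)
  have ab: "a = 1 \<or> a = -1" "b = 1 \<or> b = -1" using s t by (auto simp: is_move_def)
  have sv: "\<bar>v q + b * v p\<bar> \<le> \<bar>v q\<bar>" using sr v(2) nrm_mvv'[OF s] by auto
  have tv: "\<bar>v k + a * v q\<bar> < \<bar>v k\<bar>" using tr v(2) nrm_mvv'[OF t] by auto
  show ?thesis
  proof (cases "\<bar>v p\<bar> \<le> \<bar>v q\<bar>")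
    case True
    have pk': "is_move n m p k (a * b)" using neq ab pk by (auto simp: is_move_def)
    note 1 = path_EE_single[OF v(1) t ok]
    have n1: "nrm n (move_vec p q b (move_vec q k a v)) < r"
    proof -
      have "nrm n (move_vec p q b (move_vec q k a v)) = r - \<bar>v q\<bar> + \<bar>v q + b * v p\<bar> - \<bar>v k\<bar> + \<bar>v k + a * v q\<bar>"
        using v(2) neq pk by (simp add: nrm_mvv'[OF s] nrm_mvv'[OF t] mvv_apply)
      then show ?thesis using tv sv by linarith
    qed
    note 2 = path_low[OF 1 low s tr disjI1[OF n1]]
    have n2: "nrm n (move_vec p k (a * b) (move_vec p q b (move_vec q k a v))) < r"
    proof -
      have "nrm n (move_vec p k (a * b) (move_vec p q b (move_vec q k a v))) = r - \<bar>v q\<bar> + \<bar>v q + b * v p\<bar> - \<bar>v k\<bar> + \<bar>v k + a * v q + a * b * v p\<bar>"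
        unfolding nrm_mvv'[OF pk'] using v(2) neq pk
        by (simp add: nrm_mvv'[OF s] nrm_mvv'[OF t] mvv_apply)
      then show ?thesis using tv sv True ab by (elim disjE) (simp_all, linarith+)
    qed
    note 3 = path_low[OF 2 low pk' n1 disjI1[OF n2]]
    have e: "move_vec q k (- a) (move_vec p k (a * b) (move_vec p q b (move_vec q k a v))) = move_vec p q b v"
      using ab neq pk by (auto simp: fun_eq_iff mvv_apply)
    note 4 = path_low[OF 3 low is_move_uminus[OF t] n2 disjI2[OF e]]
    show ?thesis by (rule path_ok_cong[OF 4 rel_chain2[OF mn s t pk] s])
  next
    case False
    have "v q \<noteq> 0" using tv by (cases "v q = 0") simp_all
    with False obtain c :: int where c: "c = 1 \<or> c = -1" "\<bar>v p + c * v q\<bar> < \<bar>v p\<bar>"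
      using exists_reducing_sign[of "v q" "v p"] by auto
    have qp: "is_move n m q p c" using neq c mn by (auto simp: is_move_def)
    have n: "nrm n (move_vec q p c v) < r" using c v(2) by (simp add: nrm_mvv'[OF qp])
    have "ok v (EE q p c)"
      using peak_commute[OF v t qp _ _ _ tr less_imp_le[OF n] ok low_lt[OF low n]] neq pk by auto
    then show ?thesis
      by (rule peak_opposite[OF v qp s n sr _ low])
  qed
qed

text \<open>One descending step from \<open>v\<close> that is already \<open>ok\<close> settles
  every other step that does not raise the norm. The coincidences among the indices decide which
  relation fills the peak.\<close>

lemma peak_reduction:
  assumes v: "adm n m v" "nrm n v = r" and t: "is_move n m k l b" and s: "is_move n m i j a"
    and tr: "nrm n (move_vec k l b v) < r" and sr: "nrm n (move_vec i j a v) \<le> r"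
    and ok: "ok v (EE k l b)" and low: "low r (move_vec i j a v)"
  shows "ok v (EE i j a)"
proof -
  consider "j = l" "i = k" | "j = l" "i \<noteq> k" | "j \<noteq> l" "i \<noteq> l" "j \<noteq> k" | "i = l" "j = k"
    | "j \<noteq> l" "i \<noteq> l" "j = k" | "j \<noteq> l" "i = l" "j \<noteq> k" by blast
  then show ?thesis
  proof cases
    case 1
    have "\<bar>v l + b * v k\<bar> < \<bar>v l\<bar>" using tr v(2) nrm_mvv'[OF t] by auto
    moreover have "\<bar>v j + a * v i\<bar> \<le> \<bar>v j\<bar>" using sr v(2) nrm_mvv'[OF s] by auto
    ultimately have "a = b" using 1 s t by (auto simp: is_move_def)
    then show ?thesis using ok 1 by simp
  next
    case 2
    then show ?thesis using peak_same_target[of v r k l b i a] assms by simp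
  next
    case 3
    then show ?thesis using peak_commute[OF v t s _ _ _ tr sr ok low] by simp
  next
    case 4
    then show ?thesis using peak_opposite[of v r k l b a] assms by simp
  next
    case 5
    then show ?thesis using peak_chain2[of v r i k a l b] assms by simp
  next
    case 6
    then show ?thesis using peak_chain1[of v r k l b j a] assms by simp
  qed
qed

end

section \<open>Induction on the norm\<close>

lemma magnus_gens_mono:
  assumes "k \<le> m"
  shows "magnus_gens n k \<subseteq> magnus_gens n m"
proof -
  have "i \<in> {1..m}" if "i \<in> {1..k}" for i using that assms by auto
  then show ?thesis unfolding magnus_gens_def by (intro Un_mono order_refl) blast
qed

context peak
begin

definition level :: "int \<Rightarrow> bool" where
  "level r \<longleftrightarrow>
    (\<forall>v i j c. adm n m v \<longrightarrow> is_move n m i j c \<longrightarrow> nrm n v \<le> r \<longrightarrow> nrm n (move_vec i j c v) \<le> r \<longrightarrow>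
      ok v (EE i j c)) \<and>
    (\<forall>v w. adm n m v \<longrightarrow> w \<in> signed_perms {1..m} \<longrightarrow> nrm n v \<le> r \<longrightarrow> ok v w)"

lemma SP_stabilizer:
  assumes w: "w \<in> signed_perms {1..m}" and a: "act n w (unit_vec m) = unit_vec m"
  shows "w \<in> signed_perms {1..m - 1}"
proof -
  have supp: "supp n (unit_vec m)" using mn m1 by (auto simp: supp_def unit_vec_def)
  obtain \<sigma> \<epsilon> where s: "signed_perm \<sigma> \<epsilon> w" and o: "\<And>l. l \<notin> {1..m} \<Longrightarrow> \<sigma> l = l \<and> \<epsilon> l"
    and e: "\<And>l. act n w (unit_vec m) (\<sigma> l) = sw (\<epsilon> l) (unit_vec m l)"
    using SP_perm[OF w] supp by metis
  have "\<sigma> m = m \<and> \<epsilon> m"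
    using e[of m] unfolding a by (auto simp: unit_vec_def sw_def split: if_splits)
  moreover have "l = m \<or> l \<notin> {1..m}" if "l \<notin> {1..m - 1}" for l using that by auto
  ultimately have "\<sigma> l = l \<and> \<epsilon> l" if "l \<notin> {1..m - 1}" for l using o that by blast
  then show ?thesis using s unfolding signed_perms_def by blast
qed

text \<open>At norm one a move that does not raise the norm has \<open>v i = 0\<close> and fixes
  \<open>v\<close>. Conjugated by the chosen path it becomes, modulo \<open>N\<close>, a
  transvection whose source is not \<open>m\<close>, since the coordinate of
  \<open>unit_vec m\<close> at that source is zero.\<close>

lemma level_1: "level 1"
  unfolding level_def
proof (intro conjI allI impI)
  fix v i j c
  assume v: "adm n m v" and s: "is_move n m i j c" and le: "nrm n v \<le> 1" "nrm n (move_vec i j c v) \<le> 1"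
  have n1: "nrm n v = 1" using adm_nrm_pos[OF v] le by simp
  have ij: "i \<in> {1..n}" "j \<in> {1..n}" "i \<noteq> j" "c = 1 \<or> c = -1" using s mn by (auto simp: is_move_def)
  have vi: "v i = 0"
  proof (rule ccontr)
    assume "v i \<noteq> 0"
    moreover have "\<bar>v i\<bar> + \<bar>v j\<bar> \<le> 1" using nrm_ge2[OF ij(1-3)] n1 by metis
    ultimately have "\<bar>v i\<bar> = 1" "v j = 0" by auto
    then have "nrm n (move_vec i j c v) = 2" using n1 ij(4) by (auto simp: nrm_mvv'[OF s])
    then show False using le by simp
  qed
  have same: "move_vec i j c v = v" using vi by (simp add: move_vec_def fun_eq_iff)
  define w where "w = desc n m v"
  have w: "w \<in> signed_perms {1..m}" "act n w v = unit_vec m" using desc_1[OF v n1] by (simp_all add: w_def)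
  obtain \<sigma> \<epsilon> where \<sigma>: "signed_perm \<sigma> \<epsilon> w" "\<And>l. l \<notin> {1..m} \<Longrightarrow> \<sigma> l = l \<and> \<epsilon> l"
    "\<And>l. act n w v (\<sigma> l) = sw (\<epsilon> l) (v l)"
    using SP_perm[OF w(1)] adm_supp[OF v] by metis
  obtain d where d: "is_move n m (\<sigma> i) (\<sigma> j) d" "EE (\<sigma> i) (\<sigma> j) d - (w + EE i j c - w) \<in> magnus_group n m"
    using rel_signed_perm[OF mn s \<sigma>(1)] \<sigma>(2) by blast
  have "\<sigma> i \<noteq> m"
    using \<sigma>(3)[of i] vi unfolding w(2) by (auto simp: unit_vec_def sw_def split: if_splits)
  then have "EE (\<sigma> i) (\<sigma> j) d \<in> SS" by (rule EE_SS[OF d(1)])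
  from SS_add[OF SS_uminus[OF N_SS[OF d(2)]] this] have "w + EE i j c - w \<in> SS"
    by (simp add: group_norm del: add_uminus_conv_diff)
  then show "ok v (EE i j c)"
    unfolding ok_def act_EE_mvv[OF s adm_supp[OF v]] same by (simp add: w_def)
next
  fix v w
  assume v: "adm n m v" and w: "w \<in> signed_perms {1..m}" and le: "nrm n v \<le> 1"
  have n1: "nrm n v = 1" using adm_nrm_pos[OF v] le by simp
  have v': "adm n m (act n w v)" "nrm n (act n w v) = 1"
    using adm_SP[OF w v] nrm_SP[OF w adm_supp[OF v]] n1 by simp_all
  note d = desc_1[OF v n1] and d' = desc_1[OF v']
  let ?x = "desc n m (act n w v) + (w + - desc n m v)"
  have x: "?x \<in> signed_perms {1..m}" using d d' w by (intro SP_add SP_uminus) auto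
  have An: "\<phi> \<in> Aut_Fn n" if "\<phi> \<in> signed_perms {1..m}" for \<phi> using SP_An[OF _ that] mn by auto
  have "act n (- desc n m v) (unit_vec m) = v"
    using act_uminus[OF An adm_supp[OF v]] d by metis
  then have "act n ?x (unit_vec m) = unit_vec m"
    using d d' w An SP_uminus by (simp add: act_add SP_add del: add_uminus_conv_diff)
  from SP_SS[OF SP_stabilizer[OF x this]] show "ok v w"
    by (simp add: ok_def group_norm del: add_uminus_conv_diff)
qed

text \<open>The step chosen by \<open>desc\<close> seeds \<open>peak_reduction\<close> at each
  vector of norm \<open>r\<close>. Strictly descending steps come first; their inverses then provide
  the climbing steps needed to treat steps between two vectors of norm \<open>r\<close>.\<close>

lemma level_step:
  assumes IH: "level (r - 1)" and r: "r > 1"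
  shows "level r"
proof -
  have low_strict: "low r z" if "nrm n z < r" for z
    using IH that unfolding low_def level_def by auto
  have tree: "\<exists>i j c. is_move n m i j c \<and> nrm n (move_vec i j c v) < r \<and> ok v (EE i j c)"
    if v: "adm n m v" "nrm n v = r" for v
  proof -
    have "\<exists>s. strict n m v s" using v r by (intro exists_strict) auto
    then obtain s where "strict n m v s" by blast
    then obtain i j c where s: "is_move n m i j c" "nrm n (move_vec i j c v) < nrm n v"
      "desc n m v = desc n m (move_vec i j c v) + EE i j c" by (rule desc_step)
    \<comment> \<open>Along the step chosen by \<open>desc\<close> itself the loop is
      trivial.\<close>
    have "ok v (EE i j c)"
      unfolding ok_def act_EE_mvv[OF s(1) adm_supp[OF v(1)]] s(3)[symmetric]
      using N_SS[OF sgen.zero] by simp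
    then show ?thesis using s v by blast
  qed
  have strict: "ok v (EE i j c)"
    if v: "adm n m v" "nrm n v = r" and s: "is_move n m i j c" "nrm n (move_vec i j c v) < r" for v i j c
    using tree[OF v] peak_reduction[OF v _ s(1) _ less_imp_le[OF s(2)] _ low_strict[OF s(2)]] by blast
  have low: "low r z" if z: "adm n m z" "nrm n z = r" for z
    unfolding low_def
  proof (intro conjI allI impI)
    fix u i j c
    assume u: "adm n m u" "is_move n m i j c" "nrm n u < r" "nrm n (move_vec i j c u) < r \<or> move_vec i j c u = z"
    show "ok u (EE i j c)"
    proof (cases "nrm n (move_vec i j c u) < r")
      case True
      then show ?thesis using low_strict[OF True] u unfolding low_def by blast
    next
      case False
      then have e: "move_vec i j c u = z" using u by simp
      have "i \<noteq> j" using u(2) by (simp add: is_move_def)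
      then have "move_vec i j (- c) z = u" using mvv_inverse e by blast
      \<comment> \<open>A step that climbs to \<open>z\<close> is the inverse of a strict descent
        from \<open>z\<close>.\<close>
      then have "ok z (EE i j (- c))" using strict[OF z is_move_uminus[OF u(2)]] u(3) by simp
      then show ?thesis using ok_EE_uminus[OF u(1,2)] e by simp
    qed
  next
    fix u w assume "adm n m u" "w \<in> signed_perms {1..m}" "nrm n u < r"
    then show "ok u w" using IH unfolding level_def by simp
  qed
  show ?thesis
    unfolding level_def
  proof (intro conjI allI impI)
    fix v i j c
    assume v: "adm n m v" and s: "is_move n m i j c" and le: "nrm n v \<le> r" "nrm n (move_vec i j c v) \<le> r"
    have low': "low r (move_vec i j c v)"
      using le(2) low_strict low[OF adm_mvv[OF s v]] by (cases "nrm n (move_vec i j c v) = r") auto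
    show "ok v (EE i j c)"
    proof (cases "nrm n v = r")
      case True
      then show ?thesis using tree[OF v] peak_reduction[OF v _ _ s _ le(2) _ low'] by blast
    next
      case False
      then show ?thesis using low' le v s unfolding low_def by auto
    qed
  next
    fix v w
    assume v: "adm n m v" and w: "w \<in> signed_perms {1..m}" and le: "nrm n v \<le> r"
    show "ok v w"
    proof (cases "nrm n v = r")
      case False
      then show ?thesis using IH le v w unfolding level_def by simp
    next
      case True
      obtain i j c where t: "is_move n m i j c" "nrm n (move_vec i j c v) < r" "ok v (EE i j c)"
        using tree[OF v True] by blast
      \<comment> \<open>As \<open>w\<close> keeps the norm, the detour descends by the chosen step,
        applies \<open>w\<close> below the peak and climbs back by the inverse of the conjugated
        step.\<close>
      obtain \<sigma> \<epsilon> where \<sigma>: "signed_perm \<sigma> \<epsilon> w" "\<And>l. l \<notin> {1..m} \<Longrightarrow> \<sigma> l = l \<and> \<epsilon> l"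
        using SP_perm[OF w] by metis
      obtain d where d: "is_move n m (\<sigma> i) (\<sigma> j) d" "EE (\<sigma> i) (\<sigma> j) d - (w + EE i j c - w) \<in> magnus_group n m"
        using rel_signed_perm[OF mn t(1) \<sigma>(1)] \<sigma>(2) by blast
      let ?E = "EE (\<sigma> i) (\<sigma> j) d" and ?tv = "move_vec i j c v"
      let ?\<nu> = "?E - (w + EE i j c - w)"
      have \<sigma>ij: "\<sigma> i \<noteq> \<sigma> j" "d = 1 \<or> d = -1" using d(1) by (auto simp: is_move_def)
      have tv: "adm n m ?tv" by (rule adm_mvv[OF t(1) v])
      let ?z = "act n w v"
      have z: "adm n m ?z" "nrm n ?z = r" using adm_SP[OF w v] nrm_SP[OF w adm_supp[OF v]] True by auto
      note 1 = path_EE_single[OF v t(1,3)]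
      have "ok ?tv w" using IH t(2) tv w unfolding level_def by simp
      note 2 = path_step[OF 1 SP_GG[OF w] this adm_SP[OF w tv]]
      have nu: "nrm n (act n w ?tv) < r" using nrm_SP[OF w adm_supp[OF tv]] t(2) by simp
      have "move_vec (\<sigma> i) (\<sigma> j) d ?z = act n (?E + w) v"
        using GG_An[OF mn SP_GG[OF w]] act_EE_mvv[OF d(1) adm_supp[OF z(1)]] by (simp add: act_add)
      also have "?E + w = ?\<nu> + (w + EE i j c)"
        by (simp add: group_norm del: add_uminus_conv_diff)
      also have "act n (?\<nu> + (w + EE i j c)) v = act n (w + EE i j c) v"
      proof -
        have "w + EE i j c \<in> Aut_Fn n" using 2 GG_An[OF mn] by (simp add: path_def)
        then show ?thesis by (simp only: act_add act_N[OF mn d(2) supp_act])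
      qed
      also have "\<dots> = act n w ?tv" using 2 by (simp add: path_def)
      finally have e: "move_vec (\<sigma> i) (\<sigma> j) (- d) (act n w ?tv) = ?z"
        using mvv_inverse[OF \<sigma>ij(1)] by metis
      note 3 = path_low[OF 2 low[OF z] is_move_uminus[OF d(1)] nu disjI2[OF e]]
      have "- ?E + - ?\<nu> - - ?E \<in> magnus_group n m"
        by (intro GG_conj_N mn sgen_uminus d(2) EE_mem_GG d(1))
      moreover have "- ?E + - ?\<nu> - - ?E = EE (\<sigma> i) (\<sigma> j) (- d) + (w + EE i j c) - w"
        unfolding EE_uminus[OF \<sigma>ij, symmetric]
        by (simp add: group_norm del: add_uminus_conv_diff)
      ultimately show ?thesis using path_ok[OF path_cong[OF 3 SP_GG[OF w]]] by simp
    qed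
  qed
qed

lemma level_all: "level (int k)"
proof (induction k)
  case 0
  have "nrm n v > 0" if "adm n m v" for v using adm_nrm_pos[OF that] by simp
  then show ?case by (auto simp: level_def not_less[symmetric])
next
  case (Suc k)
  then show ?case using level_1 level_step[of "int (Suc k)"] by (cases "k = 0") auto
qed

section \<open>The stabiliser of the unit vector and the induction on \<open>m\<close>\<close>

lemma ok_EE_SP:
  assumes "adm n m v"
  shows "is_move n m i j c \<Longrightarrow> ok v (EE i j c)" "w \<in> signed_perms {1..m} \<Longrightarrow> ok v w"
proof -
  define r where "r = max (nrm n v) (nrm n (move_vec i j c v))"
  have "level (int (nat r))" by (rule level_all)
  moreover have "0 \<le> r" using nrm_nonneg[of n v] by (simp add: r_def)
  ultimately have "level r" by simp
  then show "is_move n m i j c \<Longrightarrow> ok v (EE i j c)" "w \<in> signed_perms {1..m} \<Longrightarrow> ok v w"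
    using assms unfolding level_def by (simp_all add: r_def)
qed

lemma GG_path:
  assumes v: "adm n m v" and q: "q \<in> nielsen_group n m"
  shows "path v q (act n q v)"
proof -
  have "\<exists>u. path v q u" using q
  proof (induction rule: sgen_induct)
    case zero
    show ?case using path_0[OF v] by blast
  next
    case (step b x)
    then obtain u where p: "path v x u" by blast
    have u: "adm n m u" using p by (simp add: path_def)
    have GG: "b + x \<in> nielsen_group n m" using step by (intro sgen_step)
    from step(1) consider "b \<in> magnus_group n m" | i j c where "b = EE i j c" "is_move n m i j c" | "b \<in> signed_perms {1..m}"
    proof (elim disjE)
      assume "b \<in> nielsen_gens n m"
      then consider "b \<in> magnus_gens n m" | i j where "b = E i j" "is_move n m i j 1" | "b \<in> signed_perms {1..m}"
        unfolding nielsen_gens_def is_move_def by blast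
      then show thesis
      proof cases
        case 1
        then show ?thesis using that(1) sgen_base by blast
      next
        case 2
        then have "b = EE i j 1" by (simp add: EE_E is_move_def)
        then show ?thesis using that(2) 2(2) by blast
      qed (rule that(3))
    next
      assume "- b \<in> nielsen_gens n m"
      then consider "- b \<in> magnus_gens n m" | i j where "- b = E i j" "is_move n m i j 1" | "- b \<in> signed_perms {1..m}"
        unfolding nielsen_gens_def is_move_def by blast
      then show thesis
      proof cases
        case 1
        then show ?thesis using that(1) sgen_uminus[OF sgen_base] by fastforce
      next
        case 2
        then have "b = EE i j (- 1)" by (simp add: EE_E is_move_def flip: 2(1))
        then show ?thesis using that(2) is_move_uminus[OF 2(2)] by blast
      next
        case 3
        then show ?thesis using that(3) SP_uminus by fastforce
      qed
    qed
    then show ?case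
    proof cases
      case 1
      have "x - (b + x) = - b" by (simp add: group_norm del: add_uminus_conv_diff)
      then have "x - (b + x) \<in> magnus_group n m" using 1 by (simp add: sgen_uminus)
      then show ?thesis using path_cong[OF p GG] by blast
    next
      case 2
      then show ?thesis using path_EE[OF p 2(2) ok_EE_SP(1)[OF u 2(2)]] by auto
    next
      case 3
      then show ?thesis using path_step[OF p SP_GG ok_EE_SP(2)[OF u] adm_SP[OF _ u]] by blast
    qed
  qed
  then show ?thesis by (auto simp: path_def)
qed

text \<open>The descent at \<open>unit_vec m\<close> may be nontrivial, but it is a signed
  permutation fixing that vector and so lies in \<open>SS\<close>; conjugation by it can be undone
  there.\<close>

lemma stabilizer_SS:
  assumes q: "q \<in> nielsen_group n m" and a: "act n q (unit_vec m) = unit_vec m"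
  shows "q \<in> SS"
proof -
  have v: "adm n m (unit_vec m)"
  proof -
    have "d dvd 1" if "\<forall>i\<in>{1..m}. d dvd unit_vec m i" for d
      using that m1 by (auto simp: unit_vec_def dest: bspec[of _ _ m])
    then show ?thesis using mn m1 by (auto simp: adm_def supp_def unit_vec_def)
  qed
  have n1: "nrm n (unit_vec m) = 1"
    using mn m1 by (simp add: nrm_def unit_vec_def if_distrib cong: if_cong)
  define w where "w = desc n m (unit_vec m)"
  have "w \<in> signed_perms {1..m - 1}" using desc_1[OF v n1] SP_stabilizer by (simp add: w_def)
  then have w: "w \<in> SS" by (rule SP_SS)
  have "w + q - w \<in> SS" using path_ok[OF GG_path[OF v q]] a by (simp add: ok_def w_def)
  from SS_add[OF SS_add[OF SS_uminus[OF w] this] w] show ?thesis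
    by (simp add: group_norm del: add_uminus_conv_diff)
qed

text \<open>Normality of \<open>N\<close> lets all factors from \<open>N\<close> be collected at the
  front.\<close>

lemma SS_decompose:
  assumes "q \<in> SS"
  shows "\<exists>\<nu>\<in>magnus_group n m. \<exists>\<gamma>\<in>nielsen_group n (m - 1). q = \<nu> + \<gamma>"
proof -
  have mono: "nielsen_gens n (m - 1) \<subseteq> nielsen_group n m"
  proof -
    have "signed_perms {1..m - 1} \<subseteq> signed_perms {1..m}" unfolding signed_perms_def by fastforce
    moreover have "magnus_gens n (m - 1) \<subseteq> magnus_gens n m" by (rule magnus_gens_mono) simp
    moreover have "E i j \<in> nielsen_gens n m" if "i \<in> {1..m - 1}" "j \<in> {1..n}" "i \<noteq> j" for i j
    proof -
      have "i \<in> {1..m}" using that(1) by auto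
      then show ?thesis using that(2,3) unfolding nielsen_gens_def by blast
    qed
    ultimately have "nielsen_gens n (m - 1) \<subseteq> nielsen_gens n m" unfolding nielsen_gens_def by blast
    then show ?thesis using sgen_base by blast
  qed
  have conj: "b + (\<nu> + \<gamma>) = (b + \<nu> - b) + (b + \<gamma>)" for b \<nu> \<gamma> :: aut
    by (simp add: group_norm del: add_uminus_conv_diff)
  have split: "b \<in> magnus_group n m \<or> b \<in> nielsen_gens n (m - 1)"
    if "b \<in> magnus_gens n m \<union> {E i j | i j. i \<in> {1..m - 1} \<and> j \<in> {1..n} \<and> i \<noteq> j} \<union> signed_perms {1..m - 1}" for b
    using that sgen_base[of b "magnus_gens n m"] unfolding nielsen_gens_def by blast
  show ?thesis using assms unfolding SS_def
  proof (induction rule: sgen_induct)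
    case zero
    have "(0 :: aut) = 0 + 0" by simp
    then show ?case using sgen.zero by blast
  next
    case (step b x)
    then obtain \<nu> \<gamma> where x: "\<nu> \<in> magnus_group n m" "\<gamma> \<in> nielsen_group n (m - 1)" "x = \<nu> + \<gamma>" by blast
    have "b \<in> magnus_group n m \<or> b \<in> nielsen_gens n (m - 1) \<or> - b \<in> nielsen_gens n (m - 1)"
      using step(1) split[of b] split[of "- b"] sgen_uminus_iff[of b] by blast
    then show ?case
    proof
      assume "b \<in> magnus_group n m"
      then show ?thesis using x by (intro bexI[of _ "b + \<nu>"] bexI[of _ \<gamma>]) (auto simp: add.assoc sgen_add)
    next
      assume b: "b \<in> nielsen_gens n (m - 1) \<or> - b \<in> nielsen_gens n (m - 1)"
      then have "b \<in> nielsen_group n m" using mono sgen_uminus_iff by blast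
      then have "b + \<nu> - b \<in> magnus_group n m" using x by (intro GG_conj_N mn)
      moreover have "b + \<gamma> \<in> nielsen_group n (m - 1)" using b x(2) by (rule sgen_step)
      ultimately show ?thesis using conj[of b \<nu> \<gamma>] x(3) by blast
    qed
  qed
qed

end

text \<open>The factor \<open>\<nu>\<close> acts trivially on exponent vectors, so
  \<open>\<gamma>\<close> inherits the hypothesis one level lower. At level \<open>0\<close> there
  are no transvections and only the trivial signed permutation.\<close>

lemma GG_ab_trivial:
  assumes "m \<le> n" "\<phi> \<in> nielsen_group n m" "\<And>v. supp n v \<Longrightarrow> act n \<phi> v = v"
  shows "\<phi> \<in> magnus_group n m"
  using assms
proof (induction m arbitrary: \<phi>)
  case 0
  have "w = 0" if "w \<in> signed_perms {}" for w
    using that unfolding signed_perms_def signed_perm_def by (auto intro!: aut_eqI)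
  then have "nielsen_gens n 0 \<subseteq> magnus_group n 0"
    by (auto simp: nielsen_gens_def intro: sgen_base sgen.zero)
  then show ?case using sgen_subset 0 by blast
next
  case (Suc m)
  interpret peak n "Suc m" by unfold_locales (use Suc.prems in auto)
  have "supp n (unit_vec (Suc m))" using Suc.prems by (auto simp: supp_def unit_vec_def)
  then have "\<phi> \<in> SS" using Suc.prems by (intro stabilizer_SS) auto
  then obtain \<nu> \<gamma> where d: "\<nu> \<in> magnus_group n (Suc m)" "\<gamma> \<in> nielsen_group n m" "\<phi> = \<nu> + \<gamma>"
    using SS_decompose by force
  have "act n \<gamma> v = v" if v: "supp n v" for v
  proof -
    have \<gamma>: "\<gamma> \<in> Aut_Fn n" using GG_An[OF _ d(2)] Suc.prems by simp
    have "act n \<gamma> v = act n \<nu> (act n \<gamma> v)"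
      using act_N[OF Suc.prems(1) d(1) supp_act[OF \<gamma>]] by simp
    also have "\<dots> = act n \<phi> v" by (simp only: d(3) act_add[OF \<gamma>])
    finally show ?thesis using Suc.prems(3)[OF v] by simp
  qed
  then have "\<gamma> \<in> magnus_group n m" using Suc d by auto
  moreover have "magnus_group n m \<subseteq> magnus_group n (Suc m)"
    by (intro sgen_mono magnus_gens_mono) simp
  ultimately show ?case unfolding d(3) using d(1) by (intro sgen_add) auto
qed

lemma N_eq:
  assumes mn: "m \<le> n"
  shows "magnus_group n m = {\<phi> \<in> Conj_Fn n m. \<forall>x\<in>Fs {1..n}. ab (app \<phi> x) = ab x}"
proof (intro equalityI subsetI)
  fix \<phi> assume N: "\<phi> \<in> magnus_group n m"
  have K: "b \<in> Conj_Fn n m \<and> - b \<in> Conj_Fn n m" if b: "b \<in> magnus_gens n m" for b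
  proof -
    from b consider i j where "b = tr i (X j) (- X j)" "i \<in> {1..n}" "j \<in> {1..n}" "i \<noteq> j"
      | i j k where "b = tr i 0 (X j + X k - X j - X k)" "i \<in> {1..m}" "j \<in> {1..n}" "k \<in> {1..n}"
          "i \<noteq> j" "i \<noteq> k"
      unfolding magnus_gens_def by blast
    then show ?thesis
    proof cases
      case 1
      then show ?thesis by (auto simp: tr_uminus intro!: tr_Gam)
    next
      case 2
      then have "i \<in> {1..n}" using mn by auto
      with 2 show ?thesis
        by (auto simp: tr_uminus Fs_Compl simp del: minus_diff_eq intro!: tr_Gam)
    qed
  qed
  have "\<phi> \<in> Conj_Fn n m" using N
  proof (induction rule: sgen.induct)
    case zero
    show ?case by (auto simp: Conj_Fn_def Aut_Fn_def intro!: bexI[of _ 0])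
  qed (use K in \<open>auto intro: Gam_add\<close>)
  then show "\<phi> \<in> {\<phi> \<in> Conj_Fn n m. \<forall>x\<in>Fs {1..n}. ab (app \<phi> x) = ab x}"
    using N_ab[OF mn N] by simp
next
  fix \<phi> assume \<phi>: "\<phi> \<in> {\<phi> \<in> Conj_Fn n m. \<forall>x\<in>Fs {1..n}. ab (app \<phi> x) = ab x}"
  then have "\<phi> \<in> nielsen_group n m" by (intro Gam_subset_GG mn) simp
  moreover have "act n \<phi> v = v" if "supp n v" for v
  proof -
    have "act n \<phi> v = act n 0 v" using \<phi> by (intro act_cong_ab) simp
    then show ?thesis using that by (simp add: act_0)
  qed
  ultimately show "\<phi> \<in> magnus_group n m" by (rule GG_ab_trivial[OF mn])
qed

section \<open>Transfer to the group of automorphisms of \<open>Fn n\<close>\<close>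

declare One_nat_def [simp del]

lemma carrier_Fn_iff: "w \<in> carrier (free_group A) \<longleftrightarrow> reduced w \<and> Fword w \<in> Fs A"
  by (simp add: free_group_def Fs_def letters_Fword cong: conj_cong)

lemma letters_carrier: "x \<in> Fs A \<Longrightarrow> letters x \<in> carrier (free_group A)"
  by (simp add: carrier_Fn_iff letters_inverse)

lemma letters_Fword_carrier: "w \<in> carrier (free_group A) \<Longrightarrow> letters (Fword w) = w"
  by (simp add: carrier_Fn_iff letters_Fword)

lemma letters_mult: "letters (x + y) = letters x \<otimes>\<^bsub>free_group A\<^esub> letters y"
  by (simp add: free_group_def letters_plus)

lemma letters_one: "letters 0 = \<one>\<^bsub>free_group A\<^esub>"
  by (simp add: free_group_def)

lemma letters_gen: "letters (X a) = gen a"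
  by (simp add: letters_X gen_def)

lemma letters_inv:
  assumes "x \<in> Fs A"
  shows "letters (- x) = inv\<^bsub>free_group A\<^esub> letters x"
  using assms by (intro group.inv_equality[OF group_free_group, symmetric])
    (simp_all add: letters_carrier letters_mult[symmetric] letters_one[symmetric])

lemma Fword_mult:
  assumes "v \<in> carrier (free_group A)" "w \<in> carrier (free_group A)"
  shows "Fword (v \<otimes>\<^bsub>free_group A\<^esub> w) = Fword v + Fword w"
  using letters_mult[of "Fword v" "Fword w" A] assms by (metis letters_Fword_carrier letters_inverse)

lemma Fword_inv:
  assumes "v \<in> carrier (free_group A)"
  shows "Fword (inv\<^bsub>free_group A\<^esub> v) = - Fword v"
proof -
  have "Fword v \<in> Fs A" using assms by (simp add: carrier_Fn_iff)
  from letters_inv[OF this] show ?thesis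
    using assms by (metis letters_Fword_carrier letters_inverse)
qed

lemma Fword_gen: "Fword (gen a) = X a"
  by (simp add: X_def gen_def)

lemma Fword_inject_carrier:
  "v \<in> carrier (free_group A) \<Longrightarrow> w \<in> carrier (free_group A) \<Longrightarrow> Fword v = Fword w \<Longrightarrow> v = w"
  by (metis letters_Fword_carrier)

section \<open>Restriction of automorphisms to \<open>Fn n\<close>\<close>

definition rst :: "nat \<Rightarrow> aut \<Rightarrow> (nat \<times> bool) list \<Rightarrow> (nat \<times> bool) list" where
  "rst n \<psi> = restrict (\<lambda>w. letters (app \<psi> (Fword w))) (carrier (Fn n))"

lemma rst_apply: "w \<in> carrier (Fn n) \<Longrightarrow> rst n \<psi> w = letters (app \<psi> (Fword w))"
  by (simp add: rst_def)

lemma Fword_rst: "w \<in> carrier (Fn n) \<Longrightarrow> Fword (rst n \<psi> w) = app \<psi> (Fword w)"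
  by (simp add: rst_def letters_inverse)

lemma rst_closed: "\<psi> \<in> Aut_Fn n \<Longrightarrow> w \<in> carrier (Fn n) \<Longrightarrow> rst n \<psi> w \<in> carrier (Fn n)"
  unfolding rst_apply by (intro letters_carrier An_Fs) (simp_all add: carrier_Fn_iff)

lemma rst_carrier:
  assumes "\<psi> \<in> Aut_Fn n"
  shows "rst n \<psi> \<in> carrier (AutoGroup (Fn n))"
proof -
  have hom: "rst n \<psi> \<in> hom (Fn n) (Fn n)"
  proof (rule homI)
    fix v w assume vw: "v \<in> carrier (Fn n)" "w \<in> carrier (Fn n)"
    then have "v \<otimes>\<^bsub>Fn n\<^esub> w \<in> carrier (Fn n)"
      by (rule monoid.m_closed[OF group.is_monoid[OF group_free_group]])
    then show "rst n \<psi> (v \<otimes>\<^bsub>Fn n\<^esub> w) = rst n \<psi> v \<otimes>\<^bsub>Fn n\<^esub> rst n \<psi> w"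
      using vw by (simp only: rst_apply Fword_mult app_add letters_mult)
  qed (rule rst_closed[OF assms])
  have inv: "rst n \<phi> (rst n \<psi> w) = w" if "\<phi> + \<psi> = 0" "\<psi> \<in> Aut_Fn n" "w \<in> carrier (Fn n)" for \<phi> \<psi> w
  proof -
    have "app \<phi> (app \<psi> (Fword w)) = Fword w" using that(1) by (metis app_plus_aut app_zero_aut)
    then show ?thesis
      using that rst_closed[OF that(2,3)]
      by (simp add: rst_apply[of "rst n \<psi> w"] Fword_rst letters_Fword_carrier)
  qed
  have "bij_betw (rst n \<psi>) (carrier (Fn n)) (carrier (Fn n))"
    by (rule bij_betwI[where g = "rst n (- \<psi>)"])
      (use rst_closed assms An_uminus inv[of "- \<psi>" \<psi>] inv[of \<psi> "- \<psi>"] in auto)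
  then show ?thesis using hom by (simp add: AutoGroup_def auto_def Bij_def rst_def)
qed

lemma AutoGroup_mult:
  "f \<in> Bij (carrier G) \<Longrightarrow> g \<in> Bij (carrier G) \<Longrightarrow> f \<otimes>\<^bsub>AutoGroup G\<^esub> g = compose (carrier G) f g"
  by (simp add: AutoGroup_def BijGroup_def)

lemma AutoGroup_one: "\<one>\<^bsub>AutoGroup G\<^esub> = (\<lambda>x\<in>carrier G. x)"
  by (simp add: AutoGroup_def BijGroup_def)

lemma rst_add:
  assumes "\<phi> \<in> Aut_Fn n" "\<psi> \<in> Aut_Fn n"
  shows "rst n (\<phi> + \<psi>) = rst n \<phi> \<otimes>\<^bsub>AutoGroup (Fn n)\<^esub> rst n \<psi>"
proof -
  have "rst n \<phi> \<in> Bij (carrier (Fn n))" "rst n \<psi> \<in> Bij (carrier (Fn n))"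
    using rst_carrier[OF assms(1)] rst_carrier[OF assms(2)]
    by (simp_all add: AutoGroup_def auto_def)
  then have "rst n \<phi> \<otimes>\<^bsub>AutoGroup (Fn n)\<^esub> rst n \<psi> = compose (carrier (Fn n)) (rst n \<phi>) (rst n \<psi>)"
    by (rule AutoGroup_mult)
  also have "\<dots> = rst n (\<phi> + \<psi>)"
  proof (rule extensionalityI[OF compose_extensional])
    fix w assume w: "w \<in> carrier (Fn n)"
    have "rst n \<phi> (rst n \<psi> w) = letters (app \<phi> (app \<psi> (Fword w)))"
      by (simp only: rst_apply[OF rst_closed[OF assms(2) w]] Fword_rst[OF w])
    then show "compose (carrier (Fn n)) (rst n \<phi>) (rst n \<psi>) w = rst n (\<phi> + \<psi>) w"
      by (simp only: compose_eq[OF w] rst_apply[OF w, of "\<phi> + \<psi>"] app_plus_aut)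
  qed (simp add: rst_def)
  finally show ?thesis by simp
qed

lemma rst_zero: "rst n 0 = \<one>\<^bsub>AutoGroup (Fn n)\<^esub>"
  by (auto simp: rst_def AutoGroup_one letters_Fword_carrier restrict_def fun_eq_iff)

lemma group_AutoGroup_Fn: "group (AutoGroup (Fn n))"
  by (rule group.AutoGroup[OF group_free_group])

lemma rst_uminus:
  assumes "\<psi> \<in> Aut_Fn n"
  shows "rst n (- \<psi>) = inv\<^bsub>AutoGroup (Fn n)\<^esub> rst n \<psi>"
proof (rule group.inv_equality[OF group_AutoGroup_Fn, symmetric])
  show "rst n (- \<psi>) \<otimes>\<^bsub>AutoGroup (Fn n)\<^esub> rst n \<psi> = \<one>\<^bsub>AutoGroup (Fn n)\<^esub>"
    using rst_add[OF An_uminus[OF assms] assms] rst_zero[of n] by simp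
qed (use assms in \<open>auto intro: rst_carrier An_uminus\<close>)

text \<open>The automorphism and its inverse are both continued by the identity on the letters
  outside \<open>{1..n}\<close>; the continuations are inverse to each other because they are so on
  the basis.\<close>

lemma rst_surj:
  assumes "\<phi> \<in> carrier (AutoGroup (Fn n))"
  shows "\<exists>\<psi>\<in>Aut_Fn n. rst n \<psi> = \<phi>"
proof -
  let ?C = "carrier (Fn n)"
  define \<phi>' where "\<phi>' = inv\<^bsub>AutoGroup (Fn n)\<^esub> \<phi>"
  have \<phi>': "\<phi>' \<in> carrier (AutoGroup (Fn n))"
    using assms group.inv_closed[OF group_AutoGroup_Fn] by (simp add: \<phi>'_def)
  have hom: "\<phi> \<in> hom (Fn n) (Fn n)" "\<phi>' \<in> hom (Fn n) (Fn n)" "\<phi> \<in> extensional ?C"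
    and Bij: "\<phi> \<in> Bij ?C" "\<phi>' \<in> Bij ?C"
    using assms \<phi>' by (simp_all add: AutoGroup_def auto_def Bij_def)
  have "compose ?C \<phi> \<phi>' = (\<lambda>w\<in>?C. w)" "compose ?C \<phi>' \<phi> = (\<lambda>w\<in>?C. w)"
    using group.r_inv[OF group_AutoGroup_Fn assms] group.l_inv[OF group_AutoGroup_Fn assms]
    by (simp_all only: \<phi>'_def[symmetric] AutoGroup_mult[OF Bij] AutoGroup_mult[OF Bij(2,1)] AutoGroup_one)
  then have inv: "\<phi> (\<phi>' w) = w" "\<phi>' (\<phi> w) = w" if "w \<in> ?C" for w
    using that by (metis compose_eq restrict_apply')+
  define F where "F \<chi> l = (if l \<in> {1..n} then Fword (\<chi> (gen l)) else X l)"
    for \<chi> :: "(nat \<times> bool) list \<Rightarrow> (nat \<times> bool) list" and l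
  have F: "fhom (F \<chi>) x = Fword (\<chi> (letters x))" and F_Fs: "fhom (F \<chi>) x \<in> Fs {1..n}"
    if x: "x \<in> Fs {1..n}" and \<chi>: "\<chi> \<in> hom (Fn n) (Fn n)" for \<chi> x
  proof -
    interpret h: group_hom "Fn n" "Fn n" \<chi>
      by (intro group_hom.intro group_free_group group_hom_axioms.intro \<chi>)
    show "fhom (F \<chi>) x = Fword (\<chi> (letters x))" using x
    proof (induction rule: Fs_induct)
      case zero
      have "Fword (\<chi> (letters 0)) = 0"
        by (simp only: letters_one[of "{1..n}"] h.hom_one) (simp only: letters_one[symmetric] letters_inverse)
      then show ?case by (simp only: hom_f_0 hom_f_fhom)
    next
      case (plus a x)
      have c: "gen a \<in> ?C" by (rule gen_closed[OF plus(1)])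
      moreover have "letters x \<in> ?C" by (rule letters_carrier[OF plus(2)])
      ultimately have "Fword (\<chi> (letters (X a + x))) = Fword (\<chi> (gen a)) + Fword (\<chi> (letters x))"
        using h.hom_closed by (simp only: letters_mult[of _ _ "{1..n}"] letters_gen h.hom_mult Fword_mult)
      then show ?case using plus by (simp only: fhom_add fhom_X) (simp add: F_def)
    next
      case (minus a x)
      have "gen a \<in> ?C" by (rule gen_closed[OF minus(1)])
      moreover have "letters x \<in> ?C" by (rule letters_carrier[OF minus(2)])
      moreover have "inv\<^bsub>Fn n\<^esub> gen a \<in> ?C"
        by (rule group.inv_closed[OF group_free_group gen_closed[OF minus(1)]])
      ultimately have c: "gen a \<in> ?C" "letters x \<in> ?C" "inv\<^bsub>Fn n\<^esub> gen a \<in> ?C" .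
      have "letters (- X a) = inv\<^bsub>Fn n\<^esub> gen a"
        using letters_inv[of "X a" "{1..n}"] minus(1) by (simp only: Fs_X letters_gen)
      with c have "Fword (\<chi> (letters (- X a + x))) = - Fword (\<chi> (gen a)) + Fword (\<chi> (letters x))"
        using h.hom_closed
        by (simp only: letters_mult[of _ _ "{1..n}"] h.hom_mult Fword_mult h.hom_inv Fword_inv
            group.inv_closed[OF group_free_group])
      then show ?case using minus
        by (simp only: fhom_add hom_f_minus[OF hom_f_fhom] fhom_X) (simp add: F_def)
    qed
    then show "fhom (F \<chi>) x \<in> Fs {1..n}"
      using h.hom_closed[OF letters_carrier[OF x]] by (simp add: carrier_Fn_iff)
  qed
  have comp: "fhom (F \<chi>) (F \<chi>' a) = X a"
    if "\<chi> \<in> hom (Fn n) (Fn n)" "\<chi>' \<in> hom (Fn n) (Fn n)" "\<And>w. w \<in> ?C \<Longrightarrow> \<chi> (\<chi>' w) = w" for \<chi> \<chi>' a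
  proof (cases "a \<in> {1..n}")
    case True
    then have c: "\<chi>' (gen a) \<in> ?C" using that(2) gen_closed by (auto simp: hom_def)
    then have "Fword (\<chi>' (gen a)) \<in> Fs {1..n}" by (simp add: carrier_Fn_iff)
    then have "fhom (F \<chi>) (Fword (\<chi>' (gen a))) = Fword (gen a)"
      using F[OF _ that(1)] c that(3) gen_closed[OF True] by (simp add: letters_Fword_carrier)
    then show ?thesis using True by (simp add: F_def Fword_gen)
  next
    case False
    then show ?thesis by (simp only: F_def if_False fhom_X)
  qed
  define \<psi> where "\<psi> = Aut (fhom (F \<phi>))"
  define \<psi>' where "\<psi>' = Aut (fhom (F \<phi>'))"
  have app: "app \<psi> = fhom (F \<phi>)" "app \<psi>' = fhom (F \<phi>')"
    unfolding \<psi>_def \<psi>'_def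
    using comp[OF hom(1,2) inv(1)] comp[OF hom(2,1) inv(2)] by (intro Aut_fhom; blast)+
  have "\<psi> + \<psi>' = 0"
    by (rule aut_eqI) (use comp[OF hom(1,2) inv(1)] in \<open>simp add: app\<close>)
  then have "- \<psi> = \<psi>'" by (rule minus_unique)
  then have "\<psi> \<in> Aut_Fn n"
    using F_Fs[OF _ hom(1)] F_Fs[OF _ hom(2)] by (auto simp: Aut_Fn_def app) (auto simp: F_def)
  moreover have "rst n \<psi> = \<phi>"
  proof (rule extensionalityI[OF _ hom(3)])
    fix w assume w: "w \<in> ?C"
    then have "app \<psi> (Fword w) = Fword (\<phi> w)"
      using F[OF _ hom(1), of "Fword w"] by (simp add: app carrier_Fn_iff letters_Fword)
    moreover have "\<phi> w \<in> ?C" using w hom(1) by (auto simp: hom_def)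
    ultimately show "rst n \<psi> w = \<phi> w" using w by (simp add: rst_apply letters_Fword_carrier)
  qed (simp add: rst_def)
  ultimately show ?thesis by blast
qed

text \<open>For the backward direction \<open>ab_0_imp_mem\<close> is applied with the derived
  subgroup as \<open>D\<close>, which is normal and contains the basic commutators.\<close>

lemma derived_iff:
  assumes w: "w \<in> carrier (Fn n)"
  shows "w \<in> derived (Fn n) (carrier (Fn n)) \<longleftrightarrow> ab (Fword w) = (\<lambda>_. 0)"
proof -
  interpret G: group "Fn n" by (rule group_free_group)
  let ?C = "carrier (Fn n)" and ?D = "derived (Fn n) (carrier (Fn n))"
  have D: "?D \<subseteq> ?C" by (intro G.derived_in_carrier) simp
  interpret D: normal ?D "Fn n" by (rule G.derived_self_is_normal)
  show ?thesis
  proof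
    assume "w \<in> ?D"
    then have "w \<in> ?C \<and> ab (Fword w) = (\<lambda>_. 0)"
      unfolding derived_def
    proof (induction rule: generate.induct)
      case one
      have "Fword \<one>\<^bsub>Fn n\<^esub> = 0" by (simp only: letters_one[symmetric] letters_inverse)
      then show ?case by (simp add: fun_eq_iff)
    next
      case (incl h)
      then show ?case by (auto simp: Fword_mult Fword_inv fun_eq_iff)
    next
      case (inv h)
      then show ?case by (auto simp: Fword_mult Fword_inv fun_eq_iff)
    next
      case (eng h k)
      then show ?case by (simp add: Fword_mult fun_eq_iff)
    qed
    then show "ab (Fword w) = (\<lambda>_. 0)" by simp
  next
    assume ab: "ab (Fword w) = (\<lambda>_. 0)"
    let ?S = "{x \<in> Fs {1..n}. letters x \<in> ?D}"
    have "Fword w \<in> ?S"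
    proof (rule ab_0_imp_mem[where A = "{1..n}"])
      show "0 \<in> ?S"
        using D.one_closed by (simp add: letters_one[of "{1..n}"] del: letters_0)
      show "x + y \<in> ?S"
        if "x \<in> ?S" "y \<in> ?S" for x y
        using that D.m_closed by (simp add: letters_mult[of _ _ "{1..n}"])
      show "- x \<in> ?S" if "x \<in> ?S" for x
        using that D.m_inv_closed by (simp add: letters_inv[of _ "{1..n}"])
      have conj: "g + x - g \<in> ?S"
        if "x \<in> ?S" "g \<in> Fs {1..n}" for x g
        using that D.inv_op_closed2[of "letters g" "letters x"]
        by (simp add: diff_conv_add_uminus letters_mult[of _ _ "{1..n}"] letters_inv[of _ "{1..n}"]
            letters_carrier del: add_uminus_conv_diff)
      show "X a + x - X a \<in> ?S \<and>
          - X a + x + X a \<in> ?S"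
        if "x \<in> ?S" "a \<in> {1..n}" for x a
        using conj[OF that(1), of "X a"] conj[OF that(1), of "- X a"] that(2) by simp
      show "X a + X b - X a - X b \<in> ?S"
        if "a \<in> {1..n}" "b \<in> {1..n}" "a \<noteq> b" for a b
      proof -
        have "gen a \<otimes>\<^bsub>Fn n\<^esub> gen b \<otimes>\<^bsub>Fn n\<^esub> inv\<^bsub>Fn n\<^esub> gen a \<otimes>\<^bsub>Fn n\<^esub> inv\<^bsub>Fn n\<^esub> gen b \<in> ?D"
          unfolding derived_def using gen_closed[OF that(1)] gen_closed[OF that(2)]
          by (intro generate.incl) blast
        moreover have "letters (X a + X b - X a - X b)
            = gen a \<otimes>\<^bsub>Fn n\<^esub> gen b \<otimes>\<^bsub>Fn n\<^esub> inv\<^bsub>Fn n\<^esub> gen a \<otimes>\<^bsub>Fn n\<^esub> inv\<^bsub>Fn n\<^esub> gen b"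
          using letters_inv[of "X a" "{1..n}"] letters_inv[of "X b" "{1..n}"] that
          by (simp only: diff_conv_add_uminus letters_mult[of _ _ "{1..n}"] letters_gen Fs_X)
        ultimately show ?thesis using that by simp
      qed
      show "Fword w \<in> Fs {1..n}" using w by (simp add: carrier_Fn_iff)
    qed (rule ab)
    then show "w \<in> ?D" using w by (simp add: letters_Fword_carrier)
  qed
qed

text \<open>The cosets of the derived subgroup are the fibres of the exponent vector, which turns
  the condition defining \<open>IA\<close> into one on exponent sums.\<close>

lemma derived_coset:
  assumes a: "a \<in> carrier (Fn n)"
  shows "derived (Fn n) (carrier (Fn n)) #>\<^bsub>Fn n\<^esub> a
    = {y \<in> carrier (Fn n). ab (Fword y) = ab (Fword a)}"
proof -
  interpret G: group "Fn n" by (rule group_free_group)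
  let ?C = "carrier (Fn n)" and ?D = "derived (Fn n) (carrier (Fn n))"
  have D: "?D \<subseteq> ?C" by (intro G.derived_in_carrier) simp
  show ?thesis
  proof (intro equalityI subsetI)
    fix y assume "y \<in> ?D #>\<^bsub>Fn n\<^esub> a"
    then obtain d where d: "d \<in> ?D" "y = d \<otimes>\<^bsub>Fn n\<^esub> a" by (auto simp: r_coset_def)
    then have "d \<in> ?C" using D by blast
    then show "y \<in> {y \<in> ?C. ab (Fword y) = ab (Fword a)}"
      using d a derived_iff[of d n] G.m_closed[of d a] by (simp add: Fword_mult fun_eq_iff)
  next
    fix y assume y: "y \<in> {y \<in> ?C. ab (Fword y) = ab (Fword a)}"
    then have "y \<otimes>\<^bsub>Fn n\<^esub> inv\<^bsub>Fn n\<^esub> a \<in> ?D"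
      using a by (subst derived_iff) (simp_all add: Fword_mult Fword_inv fun_eq_iff)
    moreover have "y = y \<otimes>\<^bsub>Fn n\<^esub> inv\<^bsub>Fn n\<^esub> a \<otimes>\<^bsub>Fn n\<^esub> a"
      using y a by (simp add: G.m_assoc)
    ultimately show "y \<in> ?D #>\<^bsub>Fn n\<^esub> a" unfolding r_coset_def by blast
  qed
qed

lemma rst_IA_iff:
  assumes \<psi>: "\<psi> \<in> Aut_Fn n"
  shows "rst n \<psi> \<in> IA (Fn n) \<longleftrightarrow> (\<forall>x\<in>Fs {1..n}. ab (app \<psi> x) = ab x)"
proof -
  let ?C = "carrier (Fn n)" and ?D = "derived (Fn n) (carrier (Fn n))"
  have cosets: "carrier (Fn n Mod ?D) = {?D #>\<^bsub>Fn n\<^esub> a | a. a \<in> ?C}"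
    by (auto simp: FactGroup_def RCOSETS_def)
  have bij: "bij_betw (rst n \<psi>) ?C ?C"
    using rst_carrier[OF \<psi>] by (simp add: AutoGroup_def auto_def Bij_def)
  show ?thesis
  proof
    assume IA: "rst n \<psi> \<in> IA (Fn n)"
    show "\<forall>x\<in>Fs {1..n}. ab (app \<psi> x) = ab x"
    proof
      fix x assume x: "x \<in> Fs {1..n}"
      then have c: "letters x \<in> ?C" by (rule letters_carrier)
      then have "rst n \<psi> ` (?D #>\<^bsub>Fn n\<^esub> letters x) = ?D #>\<^bsub>Fn n\<^esub> letters x"
        using IA cosets unfolding IA_def by blast
      then have "rst n \<psi> (letters x) \<in> ?D #>\<^bsub>Fn n\<^esub> letters x"
        using c derived_coset[OF c] by blast
      then show "ab (app \<psi> x) = ab x"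
        using derived_coset[OF c] Fword_rst[OF c] by (simp add: letters_inverse)
    qed
  next
    assume ab: "\<forall>x\<in>Fs {1..n}. ab (app \<psi> x) = ab x"
    have "rst n \<psi> ` (?D #>\<^bsub>Fn n\<^esub> a) = ?D #>\<^bsub>Fn n\<^esub> a" if a: "a \<in> ?C" for a
    proof -
      have "ab (Fword (rst n \<psi> y)) = ab (Fword y)" if "y \<in> ?C" for y
        using ab that by (simp add: Fword_rst carrier_Fn_iff)
      note ab = this
      show ?thesis
        unfolding derived_coset[OF a]
      proof (intro equalityI subsetI)
        fix y assume "y \<in> rst n \<psi> ` {y \<in> ?C. ab (Fword y) = ab (Fword a)}"
        then obtain z where "z \<in> ?C" "ab (Fword z) = ab (Fword a)" "y = rst n \<psi> z" by blast
        then show "y \<in> {y \<in> ?C. ab (Fword y) = ab (Fword a)}"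
          using ab rst_closed[OF \<psi>] by simp
      next
        \<comment> \<open>A coset must equal its image and not merely contain it, so bijectivity
          supplies the preimage of \<open>y\<close>.\<close>
        fix y assume y: "y \<in> {y \<in> ?C. ab (Fword y) = ab (Fword a)}"
        then obtain z where z: "z \<in> ?C" "y = rst n \<psi> z"
          using bij_betw_imp_surj_on[OF bij] by blast
        then have "ab (Fword z) = ab (Fword a)" using y ab by simp
        then show "y \<in> rst n \<psi> ` {y \<in> ?C. ab (Fword y) = ab (Fword a)}" using z by blast
      qed
    qed
    then show "rst n \<psi> \<in> IA (Fn n)"
      unfolding IA_def cosets using rst_carrier[OF \<psi>] by blast
  qed
qed

lemma rst_Fix_c_iff:
  assumes \<psi>: "\<psi> \<in> Aut_Fn n"
  shows "rst n \<psi> \<in> Fix_c (Fn n) (gen ` {m+1..n}) \<longleftrightarrow> \<psi> \<in> Conj_Fn n m"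
proof -
  interpret G: group "Fn n" by (rule group_free_group)
  have "(\<exists>g\<in>carrier (Fn n). rst n \<psi> (gen j) = g \<otimes>\<^bsub>Fn n\<^esub> gen j \<otimes>\<^bsub>Fn n\<^esub> inv\<^bsub>Fn n\<^esub> g)
      \<longleftrightarrow> (\<exists>g\<in>Fs {1..n}. app \<psi> (X j) = g + X j - g)" if "j \<in> {m+1..n}" for j
  proof -
    have j: "j \<in> {1..n}" using that by auto
    then have jc: "gen j \<in> carrier (Fn n)" by (rule gen_closed)
    have "rst n \<psi> (gen j) = g \<otimes>\<^bsub>Fn n\<^esub> gen j \<otimes>\<^bsub>Fn n\<^esub> inv\<^bsub>Fn n\<^esub> g
        \<longleftrightarrow> app \<psi> (X j) = Fword g + X j - Fword g" if g: "g \<in> carrier (Fn n)" for g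
    proof -
      have "rst n \<psi> (gen j) = g \<otimes>\<^bsub>Fn n\<^esub> gen j \<otimes>\<^bsub>Fn n\<^esub> inv\<^bsub>Fn n\<^esub> g \<longleftrightarrow>
          Fword (rst n \<psi> (gen j)) = Fword (g \<otimes>\<^bsub>Fn n\<^esub> gen j \<otimes>\<^bsub>Fn n\<^esub> inv\<^bsub>Fn n\<^esub> g)"
      proof
        assume "Fword (rst n \<psi> (gen j)) = Fword (g \<otimes>\<^bsub>Fn n\<^esub> gen j \<otimes>\<^bsub>Fn n\<^esub> inv\<^bsub>Fn n\<^esub> g)"
        then show "rst n \<psi> (gen j) = g \<otimes>\<^bsub>Fn n\<^esub> gen j \<otimes>\<^bsub>Fn n\<^esub> inv\<^bsub>Fn n\<^esub> g"
          by (rule Fword_inject_carrier[OF rst_closed[OF \<psi> jc], rotated])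
            (intro G.m_closed G.inv_closed g jc)
      qed simp
      also have "Fword (g \<otimes>\<^bsub>Fn n\<^esub> gen j \<otimes>\<^bsub>Fn n\<^esub> inv\<^bsub>Fn n\<^esub> g) = Fword g + X j - Fword g"
        using g jc G.inv_closed[OF g] G.m_closed[OF g jc]
        by (simp only: Fword_mult Fword_inv Fword_gen add_uminus_conv_diff)
      also have "Fword (rst n \<psi> (gen j)) = app \<psi> (X j)"
        by (simp only: Fword_rst[OF jc] Fword_gen)
      finally show ?thesis .
    qed
    then have "(\<exists>g\<in>carrier (Fn n). rst n \<psi> (gen j) = g \<otimes>\<^bsub>Fn n\<^esub> gen j \<otimes>\<^bsub>Fn n\<^esub> inv\<^bsub>Fn n\<^esub> g)
        \<longleftrightarrow> (\<exists>g\<in>Fword ` carrier (Fn n). app \<psi> (X j) = g + X j - g)"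
      by blast
    moreover have "Fword ` carrier (Fn n) = Fs {1..n}"
    proof (intro equalityI subsetI)
      fix x assume "x \<in> Fs {1..n}"
      then show "x \<in> Fword ` carrier (Fn n)"
        using letters_carrier by (metis image_eqI letters_inverse)
    qed (auto simp: carrier_Fn_iff)
    ultimately show ?thesis by simp
  qed
  then show ?thesis using \<psi> rst_carrier[OF \<psi>] by (simp add: Fix_c_def Conj_Fn_def)
qed

lemma rst_Kset:
  assumes mn: "m \<le> n"
  shows "rst n ` magnus_gens n m = magnus_set n m"
proof -
  interpret G: group "Fn n" by (rule group_free_group)
  have eqI: "rst n \<psi> = \<chi>"
    if \<psi>: "\<psi> \<in> Aut_Fn n" and \<chi>: "\<chi> \<in> carrier (AutoGroup (Fn n))"
      and eq: "\<And>l. l \<in> {1..n} \<Longrightarrow> letters (app \<psi> (X l)) = \<chi> (gen l)" for \<psi> \<chi>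
  proof (rule extensionalityI[where A = "carrier (Fn n)"])
    fix w assume w: "w \<in> carrier (Fn n)"
    show "rst n \<psi> w = \<chi> w"
    proof (rule hom_free_group_eqI[OF _ _ _ w])
      show "rst n \<psi> \<in> hom (Fn n) (Fn n)" "\<chi> \<in> hom (Fn n) (Fn n)"
        using rst_carrier[OF \<psi>] \<chi> by (simp_all add: AutoGroup_def auto_def)
      show "rst n \<psi> (gen l) = \<chi> (gen l)" if "l \<in> {1..n}" for l
        using eq[OF that] gen_closed[OF that] by (simp add: rst_apply Fword_gen)
    qed
  qed (use \<chi> in \<open>simp_all add: rst_def AutoGroup_def auto_def Bij_def\<close>)
  have letters_conv: "letters (X j + X k - X j - X k) = commutator (Fn n) (gen j) (gen k)"
    "letters (X j + X k - X j) = gen j \<otimes>\<^bsub>Fn n\<^esub> gen k \<otimes>\<^bsub>Fn n\<^esub> inv\<^bsub>Fn n\<^esub> gen j"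
    if "j \<in> {1..n}" "k \<in> {1..n}" for j k
    using letters_inv[of "X j" "{1..n}"] letters_inv[of "X k" "{1..n}"] that
    by (simp_all only: diff_conv_add_uminus letters_mult[of _ _ "{1..n}"] letters_gen Fs_X commutator_def)
  have K2: "rst n (tr i (X j) (- X j)) = K2 n i j" if "i \<in> {1..n}" "j \<in> {1..n}" "i \<noteq> j" for i j
  proof (rule eqI[OF tr_An K2_auto[OF that]])
    fix l assume "l \<in> {1..n}"
    then show "letters (app (tr i (X j) (- X j)) (X l)) = K2 n i j (gen l)"
      using that letters_conv(2)[OF that(2,1)] by (subst K2_gen) (auto simp: app_tr letters_gen)
  qed (use that in auto)
  have K3: "rst n (tr i 0 (X j + X k - X j - X k)) = K3 n i j k"
    if "i \<in> {1..n}" "j \<in> {1..n}" "k \<in> {1..n}" "i \<noteq> j" "i \<noteq> k" for i j k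
  proof (rule eqI[OF tr_An K3_auto[OF that]])
    fix l assume "l \<in> {1..n}"
    then show "letters (app (tr i 0 (X j + X k - X j - X k)) (X l)) = K3 n i j k (gen l)"
      using that letters_conv(1)[OF that(2,3)] letters_mult[of "X i" _ "{1..n}"]
      by (subst K3_gen) (auto simp: app_tr letters_gen)
  qed (use that in auto)
  show ?thesis
  proof (intro equalityI subsetI)
    fix \<chi> assume "\<chi> \<in> rst n ` magnus_gens n m"
    then obtain b where b: "b \<in> magnus_gens n m" "\<chi> = rst n b" by blast
    from b(1) consider i j where "b = tr i (X j) (- X j)" "i \<in> {1..n}" "j \<in> {1..n}" "i \<noteq> j"
      | i j k where "b = tr i 0 (X j + X k - X j - X k)" "i \<in> {1..m}" "j \<in> {1..n}" "k \<in> {1..n}"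
          "i \<noteq> j" "i \<noteq> k" "j \<noteq> k"
      unfolding magnus_gens_def by blast
    then show "\<chi> \<in> magnus_set n m"
    proof cases
      case 1
      then show ?thesis using K2 b(2) unfolding magnus_set_def by blast
    next
      case 2
      moreover from this have "i \<in> {1..n}" using mn by auto
      ultimately have "\<chi> = K3 n i j k" using K3 b(2) by simp
      then show ?thesis using 2 unfolding magnus_set_def by blast
    qed
  next
    fix \<chi> assume "\<chi> \<in> magnus_set n m"
    then consider i j where "\<chi> = K2 n i j" "i \<in> {1..n}" "j \<in> {1..n}" "i \<noteq> j"
      | i j k where "\<chi> = K3 n i j k" "i \<in> {1..m}" "j \<in> {1..n}" "k \<in> {1..n}"
          "i \<noteq> j" "i \<noteq> k" "j \<noteq> k"
      unfolding magnus_set_def by blast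
    then show "\<chi> \<in> rst n ` magnus_gens n m"
    proof cases
      case 1
      then have "tr i (X j) (- X j) \<in> magnus_gens n m" unfolding magnus_gens_def by blast
      then show ?thesis using K2 1 by (metis image_eqI)
    next
      case 2
      then have "tr i 0 (X j + X k - X j - X k) \<in> magnus_gens n m" unfolding magnus_gens_def by blast
      moreover have "i \<in> {1..n}" using 2 mn by auto
      ultimately show ?thesis using K3 2 by (metis image_eqI)
    qed
  qed
qed

lemma generate_rst:
  assumes K: "K \<subseteq> Aut_Fn n"
  shows "generate (AutoGroup (Fn n)) (rst n ` K) = rst n ` sgen K"
proof -
  have An: "\<phi> \<in> Aut_Fn n" if "\<phi> \<in> sgen K" for \<phi> using sgen_An[OF _ that] K by blast
  show ?thesis
  proof (intro equalityI subsetI)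
    fix \<chi> assume "\<chi> \<in> generate (AutoGroup (Fn n)) (rst n ` K)"
    then show "\<chi> \<in> rst n ` sgen K"
    proof (induction rule: generate.induct)
      case one
      show ?case using rst_zero sgen.zero by (metis image_eqI)
    next
      case (incl h)
      then show ?case using sgen_base by blast
    next
      case (inv h)
      then obtain k where k: "k \<in> K" "h = rst n k" by blast
      then have "rst n (- k) = inv\<^bsub>AutoGroup (Fn n)\<^esub> h" using K rst_uminus by blast
      then show ?case using sgen_uminus[OF sgen_base[OF k(1)]] by (metis image_eqI)
    next
      case (eng h k)
      then obtain a b where "a \<in> sgen K" "h = rst n a" "b \<in> sgen K" "k = rst n b" by blast
      then show ?case using rst_add An sgen_add by (metis image_eqI)
    qed
  next
    fix \<chi> assume "\<chi> \<in> rst n ` sgen K"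
    then obtain \<phi> where "\<phi> \<in> sgen K" "\<chi> = rst n \<phi>" by blast
    from this(1) have "rst n \<phi> \<in> generate (AutoGroup (Fn n)) (rst n ` K)"
    proof (induction rule: sgen.induct)
      case zero
      show ?case unfolding rst_zero by (rule generate.one)
    next
      case (plus b x)
      then have "b \<in> Aut_Fn n" "x \<in> Aut_Fn n" using K An by auto
      then show ?case unfolding rst_add[OF \<open>b \<in> Aut_Fn n\<close> \<open>x \<in> Aut_Fn n\<close>]
        using plus by (intro generate.eng[OF generate.incl]) auto
    next
      case (minus b x)
      then have b: "b \<in> Aut_Fn n" "x \<in> Aut_Fn n" using K An by auto
      show ?case unfolding rst_add[OF An_uminus[OF b(1)] b(2)] rst_uminus[OF b(1)]
        using minus by (intro generate.eng[OF generate.inv]) auto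
    qed
    then show "\<chi> \<in> generate (AutoGroup (Fn n)) (rst n ` K)" using \<open>\<chi> = rst n \<phi>\<close> by simp
  qed
qed

theorem theorem4p3:
  fixes m n :: nat
  assumes "m \<le> n"
  shows "generate (AutoGroup (Fn n)) (magnus_set n m) =
         IA (Fn n) \<inter> Fix_c (Fn n) (gen ` {m+1..n})"
proof -
  have "magnus_gens n m \<subseteq> Aut_Fn n" using N_An[OF assms] sgen_base by blast
  then have "generate (AutoGroup (Fn n)) (magnus_set n m) = rst n ` magnus_group n m"
    using generate_rst rst_Kset[OF assms] by metis
  also have "\<dots> = rst n ` {\<psi> \<in> Aut_Fn n. rst n \<psi> \<in> IA (Fn n) \<inter> Fix_c (Fn n) (gen ` {m+1..n})}"
    unfolding N_eq[OF assms]
    by (rule arg_cong[where f = "image (rst n)"])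
      (use rst_IA_iff rst_Fix_c_iff in \<open>auto simp: Conj_Fn_def simp del: atLeastAtMost_iff\<close>)
  also have "\<dots> = IA (Fn n) \<inter> Fix_c (Fn n) (gen ` {m+1..n})"
  proof -
    have "\<exists>\<psi>\<in>Aut_Fn n. rst n \<psi> = \<phi>" if "\<phi> \<in> IA (Fn n)" for \<phi>
      using that by (intro rst_surj) (simp add: IA_def)
    then show ?thesis by blast
  qed
  finally show ?thesis .
qed

end
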